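(* Let $n\ge1$, $1<m_1\le m_2$, $-\frac n2\le b_1\le b_2$, and $\nu_j=\frac{n(m_j-2)-2b_j}{2(m_j-1)}$ for $j=1,2$. Let $a,\psi\in C^\infty(\mathbb{R}^n\setminus\{0\})$ with $a$ real valued, and suppose there exist $0<r_0<R_0$ such that, with $B_1=\{\xi\in\mathbb{R}^n\setminus\{0\};\ |\xi|<R_0\}$ and $B_2=\{\xi\in\mathbb{R}^n;\ |\xi|>r_0\}$, we have $a\in S^{m_j}(B_j)$ and $\psi\in S^{b_j}(B_j)$ for $j=1,2$. Assume there are constants $c_1',c_2'>0$ with $c_1'|\xi|^{n(m_j-2)}\le|\det Ha(\xi)|\le c_2'|\xi|^{n(m_j-2)}$ for $\xi\in B_j$, $j=1,2$, and constants $d_1,d_1',d_2,d_2'>0$ with $d_1r_0^{m_2-1}\le d_2R_0^{m_1-1}$ such that $$d_2'|\xi|^{m_1-1}\le|\nabla a(\xi)|\le d_2|\xi|^{m_1-1}\ (\xi\in B_1),\qquad d_1|\xi|^{m_2-1}\le|\nabla a(\xi)|\le d_1'|\xi|^{m_2-1}\ (\xi\in B_2).$$ Let $I(t,x)=\int_{\mathbb{R}^n\setminus\{0\}}e^{i(ta(\xi)+x\cdot\xi)}\psi(\xi)\,d\xi$ (the tempered distribution $\mathcal F^{-1}((2\pi)^ne^{ita}\psi)$ in $x$). Then for any fixed $t_0,N>0$ there is $C$ independent of $t,x$ such that $$|I(t,x)|\le\begin{cases}C|t|^{-\frac{n+b_2}{m_2}}\big(1+|t|^{-\frac1{m_2}}|x|\big)^{-\nu_2}&\text{if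 }0<|t|<t_0,\ x\in\mathbb{R}^n,\ \text{or }|t|\ge t_0,\ |t|^{-1}|x|>N;\\ C|t|^{-\frac{n+b_1}{m_1}}\big(1+|t|^{-\frac1{m_1}}|x|\big)^{-\nu_1}&\text{if }|t|\ge t_0,\ |t|^{-1}|x|\le N.\end{cases}$$
   Context: For $b\in\mathbb{R}$, $k\in\mathbb{N}_0$ and an open set $U\subset\mathbb{R}^n$, $S^b_k(U)$ denotes the class of all $f\in C^k(U)$ such that for every multi-index $\alpha$ with $|\alpha|\le k$ there is $c_\alpha$ with $|\partial^\alpha f(\xi)|\le c_\alpha|\xi|^{b-|\alpha|}$ for $\xi\in U$; $S^b(U)=\bigcap_{k\ge0}S^b_k(U)$. $Ha$ is the Hessian of $a$. *)

theory Defs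
  imports "HOL-Analysis.Analysis"
begin

definition partial_deriv :: "'n::finite \<Rightarrow> (real^'n \<Rightarrow> 'b::real_normed_vector) \<Rightarrow> real^'n \<Rightarrow> 'b" where
  "partial_deriv i f x = vector_derivative (\<lambda>s. f (x + s *\<^sub>R axis i 1)) (at 0)"

definition has_partial :: "'n::finite \<Rightarrow> (real^'n \<Rightarrow> 'b::real_normed_vector) \<Rightarrow> real^'n \<Rightarrow> bool" where
  "has_partial i f x \<longleftrightarrow> (\<lambda>s. f (x + s *\<^sub>R axis i 1)) differentiable (at 0)"

text \<open>Iterated partial derivative; a multi-index alpha is encoded as a list of directions, |alpha| = length.\<close>
fun pderivs :: "'n::finite list \<Rightarrow> (real^'n \<Rightarrow> 'b::real_normed_vector) \<Rightarrow> real^'n \<Rightarrow> 'b" where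
  "pderivs [] f = f"
| "pderivs (i # is) f = partial_deriv i (pderivs is f)"

definition Ck_on :: "nat \<Rightarrow> (real^'n::finite) set \<Rightarrow> (real^'n \<Rightarrow> 'b::real_normed_vector) \<Rightarrow> bool" where
  "Ck_on k U f \<longleftrightarrow>
     (\<forall>is. length is \<le> k \<longrightarrow> continuous_on U (pderivs is f)) \<and>
     (\<forall>is i. length is < k \<longrightarrow> (\<forall>x\<in>U. has_partial i (pderivs is f) x))"

definition smooth_on :: "(real^'n::finite) set \<Rightarrow> (real^'n \<Rightarrow> 'b::real_normed_vector) \<Rightarrow> bool" where
  "smooth_on U f \<longleftrightarrow> (\<forall>k. Ck_on k U f)"

definition symb_k :: "real \<Rightarrow> nat \<Rightarrow> (real^'n::finite) set \<Rightarrow> (real^'n \<Rightarrow> 'b::real_normed_vector) \<Rightarrow> bool" where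
  "symb_k b k U f \<longleftrightarrow> Ck_on k U f \<and>
     (\<forall>is. length is \<le> k \<longrightarrow>
        (\<exists>c. \<forall>\<xi>\<in>U. norm (pderivs is f \<xi>) \<le> c * norm \<xi> powr (b - real (length is))))"

definition symb :: "real \<Rightarrow> (real^'n::finite) set \<Rightarrow> (real^'n \<Rightarrow> 'b::real_normed_vector) \<Rightarrow> bool" where
  "symb b U f \<longleftrightarrow> (\<forall>k. symb_k b k U f)"

definition grad :: "(real^'n::finite \<Rightarrow> real) \<Rightarrow> real^'n \<Rightarrow> real^'n" where
  "grad f x = (\<chi> i. partial_deriv i f x)"

definition hessian :: "(real^'n::finite \<Rightarrow> real) \<Rightarrow> real^'n \<Rightarrow> real^'n^'n" where
  "hessian f x = (\<chi> i j. partial_deriv i (partial_deriv j f) x)"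

definition test_fun :: "(real^'n::finite \<Rightarrow> complex) \<Rightarrow> bool" where
  "test_fun \<phi> \<longleftrightarrow> smooth_on UNIV \<phi> \<and> bounded {x. \<phi> x \<noteq> 0}"

end

theory Submission
  imports Defs
begin

text \<open>
  The amplitude \<open>\<psi>\<close> is split by a continuous partition of unity into pieces localised to balls of radius
  comparable to \<open>r\<cdot>norm c\<close> around \<open>c\<close>.  After rescaling by \<open>\<rho> = norm c\<close>, a piece becomes \<open>\<rho>\<^sup>b\<close> times an
  oscillatory integral with phase \<open>\<tau>\<cdot>P + y\<cdot>\<eta>\<close>, \<open>\<tau> = t\<rho>\<^sup>m\<close>, \<open>y = \<rho>x\<close>, where \<open>P\<close> ranges over a bounded family of
  functions with nondegenerate Hessian and non-vanishing gradient.  If \<open>y\<close> and \<open>\<tau>\<close> are not comparable,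
  repeated integration by parts in a single coordinate direction gives arbitrary decay.  In general the
  square of the integral is the integral over \<open>h\<close> of its autocorrelation at \<open>h\<close>, whose phase has a gradient of
  size at least \<open>\<tau>\<cdot>norm h\<close>; integration by parts then gives decay \<open>\<tau>\<close> to the power \<open>-n/2\<close>, without locating
  critical points.  Integrating these bounds over \<open>c\<close> gives the estimates, the condition \<open>b \<ge> -n/2\<close> making
  the non-stationary contribution of the small frequencies dominated by the stationary one.
\<close>

subsection \<open>Derivatives along a coordinate direction\<close>

text \<open>The obstacle is uniformity: stationary points move with t, x and the scale, and only a
  lower bound for the Hessian determinant is given. The autocorrelation removes x, since a linear
  phase changes it only by a unimodular constant; what remains is the increment of the gradient
  along h, which the Hessian controls. After n + 1 integrations by parts the bound (tau |h|)^(-n-1)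
  is integrable off the ball |h| <= 1/tau, the trivial bound covers that ball, and both give
  tau^(-n), whose square root is the stationary rate. Homogeneous weights make every piece a
  rescaling of one centred at a unit vector, so constants do not depend on the frequency and sums
  become integrals of radial powers. The exponent nu is what the shell |c| ~ (|x|/|t|)^(1/(m-1))
  contributes. Each range of frequencies must also obey the rate of the other scale: where the
  second rate is claimed, low frequencies cost at most a multiple of (1 + |x|)^(-n/2); where the
  first is claimed, high frequencies can be stationary only if |x| and |t| are comparable.\<close>

definition has_pd :: "'n::finite \<Rightarrow> (real^'n \<Rightarrow> 'b::real_normed_vector) \<Rightarrow> real^'n \<Rightarrow> 'b \<Rightarrow> bool" where
  "has_pd i f x D \<longleftrightarrow> ((\<lambda>s. f (x + s *\<^sub>R axis i 1)) has_vector_derivative D) (at 0)"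

lemma has_pd_partial_deriv: "has_partial i f x \<Longrightarrow> has_pd i f x (partial_deriv i f x)"
  unfolding has_pd_def has_partial_def partial_deriv_def by (simp add: vector_derivative_works)

lemma has_pd_unique: "has_pd i f x D \<Longrightarrow> has_pd i f x D' \<Longrightarrow> D = D'"
  unfolding has_pd_def by (rule vector_derivative_unique_at)

lemma has_pd_eventually:
  assumes "has_pd i f x D" "open U" "x \<in> U" "\<And>y. y \<in> U \<Longrightarrow> f y = g y"
  shows "has_pd i g x D"
proof -
  let ?L = "\<lambda>s::real. x + s *\<^sub>R axis i 1"
  have "open (?L -` U)"
    by (intro open_vimage assms continuous_intros)
  then show ?thesis
    using assms unfolding has_pd_def
    by (elim has_vector_derivative_transform_within_open) auto
qed

lemma has_pd_along:
  assumes "has_pd i f (x + s *\<^sub>R axis i 1) D"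
  shows "((\<lambda>s. f (x + s *\<^sub>R axis i 1)) has_vector_derivative D) (at s)"
proof -
  let ?f = "\<lambda>s. f (x + s *\<^sub>R axis i 1)"
  have "(\<lambda>s'. f (x + s *\<^sub>R axis i 1 + s' *\<^sub>R axis i 1)) = (\<lambda>s'. ?f (s + s'))"
    by (simp add: scaleR_left_distrib add.assoc)
  then have 1: "((\<lambda>s'. ?f (s + s')) has_vector_derivative D) (at 0)"
    using assms unfolding has_pd_def by simp
  have "((\<lambda>s'. s' - s) has_vector_derivative 1) (at s)"
    by (auto intro!: derivative_eq_intros)
  from vector_diff_chain_at[OF this, of "\<lambda>s'. ?f (s + s')" D] 1 show ?thesis
    by (simp add: o_def)
qed

lemma has_pd_const: "has_pd i (\<lambda>x. c) x 0"
  unfolding has_pd_def by simp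

lemma has_pd_add: "has_pd i f x D \<Longrightarrow> has_pd i g x E \<Longrightarrow> has_pd i (\<lambda>x. f x + g x) x (D + E)"
  unfolding has_pd_def by (rule has_vector_derivative_add)

lemma has_pd_diff: "has_pd i f x D \<Longrightarrow> has_pd i g x E \<Longrightarrow> has_pd i (\<lambda>x. f x - g x) x (D - E)"
  unfolding has_pd_def by (rule has_vector_derivative_diff)

lemma has_pd_bilinear:
  assumes "bounded_bilinear p" "has_pd i f x D" "has_pd i g x E"
  shows "has_pd i (\<lambda>x. p (f x) (g x)) x (p (f x) E + p D (g x))"
  using bounded_bilinear.has_vector_derivative[OF assms(1) assms(2,3)[unfolded has_pd_def]]
  by (simp add: has_pd_def)

lemma has_pd_linear:
  assumes "bounded_linear L" "has_pd i f x D"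
  shows "has_pd i (\<lambda>x. L (f x)) x (L D)"
  using bounded_linear.has_vector_derivative[OF assms(1)] assms(2)
  unfolding has_pd_def by blast

lemma has_pd_comp:
  assumes "has_pd i f x D" "(H has_vector_derivative E) (at (f x))"
  shows "has_pd i (\<lambda>x. H (f x)) x (D *\<^sub>R E)"
  using vector_diff_chain_at[of "\<lambda>s. f (x + s *\<^sub>R axis i 1)" D 0 H E] assms
  by (simp add: has_pd_def o_def)

lemma has_pd_affine:
  assumes "has_pd i f (c + \<rho> *\<^sub>R x) D"
  shows "has_pd i (\<lambda>y. f (c + \<rho> *\<^sub>R y)) x (\<rho> *\<^sub>R D)"
proof -
  have "((\<lambda>s. \<rho> * s) has_vector_derivative \<rho>) (at 0)"
    by (auto intro!: derivative_eq_intros)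
  from vector_diff_chain_at[OF this, of "\<lambda>s. f (c + \<rho> *\<^sub>R x + s *\<^sub>R axis i 1)" D] assms
  show ?thesis
    by (simp add: has_pd_def o_def algebra_simps)
qed

lemma has_pd_inner_left: "has_pd i (\<lambda>x. y \<bullet> x) x (y $ i)"
  unfolding has_pd_def
  by (auto intro!: derivative_eq_intros simp: inner_axis inner_add_right)

text \<open>Only derivatives in the one direction \<open>i\<close> are recorded, since an iterated
  integration by parts never leaves its direction. The single bound \<open>K\<close> covers all
  orders up to \<open>k\<close>, and the existential witness \<open>f'\<close> spares naming the
  iterated derivatives of products and composites.\<close>

primrec pd_bd :: "'n::finite \<Rightarrow> nat \<Rightarrow> real \<Rightarrow> (real^'n) set \<Rightarrow> (real^'n \<Rightarrow> 'b::real_normed_vector) \<Rightarrow> bool" where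
  "pd_bd i 0 K U f \<longleftrightarrow> continuous_on U f \<and> (\<forall>x\<in>U. norm (f x) \<le> K)"
| "pd_bd i (Suc k) K U f \<longleftrightarrow> continuous_on U f \<and> (\<forall>x\<in>U. norm (f x) \<le> K) \<and>
     (\<exists>f'. (\<forall>x\<in>U. has_pd i f x (f' x)) \<and> pd_bd i k K U f')"

lemma pd_bd_SucI:
  assumes "continuous_on U f" "\<And>x. x \<in> U \<Longrightarrow> norm (f x) \<le> K"
    "\<And>x. x \<in> U \<Longrightarrow> has_pd i f x (f' x)" "pd_bd i k K U f'"
  shows "pd_bd i (Suc k) K U f"
  using assms by auto

lemma pd_bd_cont: "pd_bd i k K U f \<Longrightarrow> continuous_on U f"
  by (cases k) auto

lemma pd_bd_norm: "pd_bd i k K U f \<Longrightarrow> x \<in> U \<Longrightarrow> norm (f x) \<le> K"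
  by (cases k) auto

lemma pd_bd_less: "pd_bd i (Suc k) K U f \<Longrightarrow> pd_bd i k K U f"
  by (induction k arbitrary: f) (simp, metis pd_bd.simps(2))

lemma pd_bd_le_order: "k \<le> l \<Longrightarrow> pd_bd i l K U f \<Longrightarrow> pd_bd i k K U f"
proof (induction l rule: dec_induct)
  case (step l)
  then show ?case using pd_bd_less by blast
qed

lemma pd_bd_mono: "pd_bd i k K U f \<Longrightarrow> K \<le> K' \<Longrightarrow> V \<subseteq> U \<Longrightarrow> pd_bd i k K' V f"
proof (induction k arbitrary: f)
  case 0
  then show ?case by (auto intro: continuous_on_subset order_trans)
next
  case (Suc k)
  then obtain f' where "\<forall>x\<in>U. has_pd i f x (f' x)" "pd_bd i k K U f'" by auto
  with Suc show ?case
    by (intro pd_bd_SucI[of _ _ _ _ f']) (auto intro: continuous_on_subset order_trans)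
qed

lemma pd_bd_cong:
  assumes "pd_bd i k K U f" "open U" "\<And>x. x \<in> U \<Longrightarrow> f x = g x"
  shows "pd_bd i k K U g"
proof (cases k)
  case 0
  with assms show ?thesis by (simp cong: continuous_on_cong)
next
  case (Suc l)
  with assms(1) obtain f' where "\<forall>x\<in>U. has_pd i f x (f' x)" "pd_bd i l K U f'" by auto
  moreover from this have "\<forall>x\<in>U. has_pd i g x (f' x)"
    using assms by (blast intro: has_pd_eventually)
  moreover have "continuous_on U g"
    using pd_bd_cont[OF assms(1)] assms(3) by (simp cong: continuous_on_cong)
  ultimately show ?thesis
    using pd_bd_norm[OF assms(1)] assms(3) by (auto simp: Suc)
qed

lemma pd_bd_const: 
  fixes c :: "'b::real_normed_vector"
  shows "norm c \<le> K \<Longrightarrow> pd_bd i k K U (\<lambda>x. c)"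
proof (induction k arbitrary: c)
  case (Suc k)
  then have "pd_bd i k K U (\<lambda>x. 0::'b)"
    by (metis norm_ge_zero norm_zero order_trans)
  with Suc show ?case
    by (intro pd_bd_SucI[of _ _ _ _ "\<lambda>x. 0"]) (auto intro: has_pd_const)
qed simp

lemma pd_bd_add:
  "pd_bd i k K U f \<Longrightarrow> pd_bd i k K' U g \<Longrightarrow> pd_bd i k (K + K') U (\<lambda>x. f x + g x)"
proof (induction k arbitrary: f g)
  case 0
  then show ?case by (auto intro!: continuous_intros norm_triangle_mono)
next
  case (Suc k)
  from Suc.prems obtain f' g' where "\<forall>x\<in>U. has_pd i f x (f' x)" "pd_bd i k K U f'"
    "\<forall>x\<in>U. has_pd i g x (g' x)" "pd_bd i k K' U g'" by auto
  with Suc show ?case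
    by (intro pd_bd_SucI[of _ _ _ _ "\<lambda>x. f' x + g' x"])
      (auto intro!: continuous_intros norm_triangle_mono has_pd_add)
qed

text \<open>The factor \<open>2^k\<close> counts the terms of the Leibniz rule, each of which is at
  most \<open>K * K'\<close>. A general \<open>p\<close> treats products and multiplication of a
  vector by a real function at once.\<close>

lemma pd_bd_bilinear:
  assumes p: "bounded_bilinear p" "\<And>a b. norm (p a b) \<le> norm a * norm b" and "0 \<le> K" "0 \<le> K'"
  shows "pd_bd i k K U f \<Longrightarrow> pd_bd i k K' U g \<Longrightarrow> pd_bd i k (2^k * (K * K')) U (\<lambda>x. p (f x) (g x))"
proof (induction k arbitrary: f g)
  case 0
  have "norm (p (f x) (g x)) \<le> K * K'" if "x \<in> U" for x
    using 0 that by (intro order_trans[OF p(2)] mult_mono) (auto simp: \<open>0 \<le> K\<close>)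
  moreover have "continuous_on U (\<lambda>x. p (f x) (g x))"
    using 0 by (intro bounded_bilinear.continuous_on[OF p(1)]) auto
  ultimately show ?case by simp
next
  case (Suc k)
  from Suc.prems obtain f' g' where *: "\<forall>x\<in>U. has_pd i f x (f' x)" "pd_bd i k K U f'"
    "\<forall>x\<in>U. has_pd i g x (g' x)" "pd_bd i k K' U g'" by auto
  have "norm (p (f x) (g x)) \<le> 2 ^ Suc k * (K * K')" if "x \<in> U" for x
  proof -
    have "norm (p (f x) (g x)) \<le> K * K'"
      using Suc.prems that by (intro order_trans[OF p(2)] mult_mono) (auto simp: \<open>0 \<le> K\<close>)
    also have "\<dots> \<le> 2 ^ Suc k * (K * K')"
      using assms(3,4) two_realpow_ge_one[of "Suc k"]
        mult_right_mono[of 1 "2 ^ Suc k" "K * K'"] by simp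
    finally show ?thesis .
  qed
  moreover have "pd_bd i k (2 ^ Suc k * (K * K')) U (\<lambda>x. p (f x) (g' x) + p (f' x) (g x))"
    using pd_bd_mono[OF pd_bd_add[OF Suc.IH[OF pd_bd_less[OF Suc.prems(1)] *(4)]
          Suc.IH[OF *(2) pd_bd_less[OF Suc.prems(2)]]] _ order_refl]
    by simp
  moreover have "continuous_on U (\<lambda>x. p (f x) (g x))"
    using Suc.prems by (intro bounded_bilinear.continuous_on[OF p(1)]) auto
  ultimately show ?case
    using * by (intro pd_bd_SucI[of _ _ _ _ "\<lambda>x. p (f x) (g' x) + p (f' x) (g x)"])
      (simp_all add: has_pd_bilinear[OF p(1)])
qed

lemma pd_bd_scaleR:
  "0 \<le> K \<Longrightarrow> 0 \<le> K' \<Longrightarrow> pd_bd i k K U f \<Longrightarrow> pd_bd i k K' U g \<Longrightarrow>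
     pd_bd i k (2^k * (K * K')) U (\<lambda>x. f x *\<^sub>R g x)"
  by (rule pd_bd_bilinear[OF bounded_bilinear_scaleR]) auto

lemma pd_bd_mult:
  fixes f g :: "real^'n::finite \<Rightarrow> 'b::real_normed_algebra"
  shows "0 \<le> K \<Longrightarrow> 0 \<le> K' \<Longrightarrow> pd_bd i k K U f \<Longrightarrow> pd_bd i k K' U g \<Longrightarrow>
     pd_bd i k (2^k * (K * K')) U (\<lambda>x. f x * g x)"
  by (rule pd_bd_bilinear[OF bounded_bilinear_mult]) (auto intro: norm_mult_ineq)

lemma pd_bd_linear:
  assumes "bounded_linear L" "\<And>a. norm (L a) \<le> norm a"
  shows "pd_bd i k K U f \<Longrightarrow> pd_bd i k K U (\<lambda>x. L (f x))"
proof (induction k arbitrary: f)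
  case 0
  then show ?case
    by (auto intro: bounded_linear.continuous_on[OF assms(1)] order_trans[OF assms(2)])
next
  case (Suc k)
  then obtain f' where "\<forall>x\<in>U. has_pd i f x (f' x)" "pd_bd i k K U f'" by auto
  with Suc show ?case
    by (intro pd_bd_SucI[of _ _ _ _ "\<lambda>x. L (f' x)"])
      (auto intro: bounded_linear.continuous_on[OF assms(1)] has_pd_linear[OF assms(1)]
        order_trans[OF assms(2)])
qed

lemma pd_bd_translate:
  "pd_bd i k K U f \<Longrightarrow> (\<And>x. x \<in> V \<Longrightarrow> h + x \<in> U) \<Longrightarrow> pd_bd i k K V (\<lambda>x. f (h + x))"
proof (induction k arbitrary: f)
  case 0
  then show ?case
    by (auto intro!: continuous_on_compose2[of U f] continuous_intros)
next
  case (Suc k)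
  then obtain f' where f': "\<forall>x\<in>U. has_pd i f x (f' x)" "pd_bd i k K U f'" by auto
  have "has_pd i (\<lambda>x. f (h + x)) x (f' (h + x))" if "x \<in> V" for x
    using has_pd_affine[of i f h 1 x "f' (h + x)"] f' Suc.prems(2)[OF that] by simp
  with f' Suc show ?case
    by (intro pd_bd_SucI[of _ _ _ _ "\<lambda>x. f' (h + x)"])
      (auto intro!: continuous_on_compose2[of U f] continuous_intros)
qed

text \<open>One step of the chain rule: the derivative of \<open>H 0 (f x)\<close> is
  \<open>f' x\<close> times \<open>H 1 (f x)\<close>; the product costs the Leibniz factor
  \<open>2^k\<close>, and its second factor is bounded recursively. The summand \<open>B\<close>
  covers the undifferentiated function.\<close>

primrec comp_bound :: "nat \<Rightarrow> real \<Rightarrow> real \<Rightarrow> real" where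
  "comp_bound 0 B K = B"
| "comp_bound (Suc k) B K = B + 2^k * (K * comp_bound k B K)"

lemma comp_bound_nonneg: "0 \<le> B \<Longrightarrow> 0 \<le> K \<Longrightarrow> 0 \<le> comp_bound k B K"
  by (induction k) auto

lemma comp_bound_ge: "0 \<le> B \<Longrightarrow> 0 \<le> K \<Longrightarrow> B \<le> comp_bound k B K"
  by (cases k) (auto simp: comp_bound_nonneg)

text \<open>\<open>H j\<close> stands for the j-th derivative of the outer function, and the
  induction shifts this sequence. Everything is required only on the range of \<open>f\<close> and
  up to order \<open>k\<close>, so that reciprocals, real powers and truncated powers of limited
  smoothness are admissible.\<close>

lemma pd_bd_comp:
  fixes f :: "real^'n::finite \<Rightarrow> real" and H :: "nat \<Rightarrow> real \<Rightarrow> real"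
  assumes "0 \<le> B" "0 \<le> K"
  shows "pd_bd i k K U f \<Longrightarrow>
    (\<And>j x. j < k \<Longrightarrow> x \<in> U \<Longrightarrow> (H j has_real_derivative H (Suc j) (f x)) (at (f x))) \<Longrightarrow>
    (\<And>j. j \<le> k \<Longrightarrow> continuous_on (f ` U) (H j)) \<Longrightarrow>
    (\<And>j x. j \<le> k \<Longrightarrow> x \<in> U \<Longrightarrow> \<bar>H j (f x)\<bar> \<le> B) \<Longrightarrow>
    pd_bd i k (comp_bound k B K) U (\<lambda>x. H 0 (f x))"
proof (induction k arbitrary: H)
  case 0
  then show ?case by (auto intro: continuous_on_compose2)
next
  case (Suc k)
  from Suc.prems(1) obtain f' where f': "\<forall>x\<in>U. has_pd i f x (f' x)" "pd_bd i k K U f'" by auto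
  have 1: "pd_bd i k (comp_bound k B K) U (\<lambda>x. H (Suc 0) (f x))"
    by (rule Suc.IH[of "\<lambda>j. H (Suc j)"]) (use pd_bd_less[OF Suc.prems(1)] Suc.prems in auto)
  have "has_pd i (\<lambda>x. H 0 (f x)) x (f' x *\<^sub>R H (Suc 0) (f x))" if "x \<in> U" for x
    using f' that Suc.prems(2)[of 0 x] by (intro has_pd_comp)
      (auto simp: has_real_derivative_iff_has_vector_derivative)
  moreover have "pd_bd i k (comp_bound (Suc k) B K) U (\<lambda>x. f' x *\<^sub>R H (Suc 0) (f x))"
    using assms by (intro pd_bd_mono[OF pd_bd_scaleR[OF _ _ f'(2) 1]] comp_bound_nonneg) auto
  moreover have "continuous_on U (\<lambda>x. H 0 (f x))"
    by (rule continuous_on_compose2[OF Suc.prems(3)[of 0] pd_bd_cont[OF Suc.prems(1)]]) simp_all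
  moreover have "\<bar>H 0 (f x)\<bar> \<le> comp_bound (Suc k) B K" if "x \<in> U" for x
    using Suc.prems(4)[of 0 x] that comp_bound_ge[OF assms, of "Suc k"] by force
  ultimately show ?case by (intro pd_bd_SucI[of _ _ _ _ "\<lambda>x. f' x *\<^sub>R H (Suc 0) (f x)"]) auto
qed

section \<open>Extension by zero, and reciprocals\<close>

lemma continuous_on_zero_extend:
  fixes f :: "'a::topological_space \<Rightarrow> 'b::real_normed_vector"
  assumes "continuous_on U f" "open U" "closed S" "S \<subseteq> U" "\<And>x. x \<notin> S \<Longrightarrow> f x = 0"
  shows "continuous_on UNIV f"
proof -
  have "continuous_on (- S) f \<longleftrightarrow> continuous_on (- S) (\<lambda>x. 0 :: 'b)"
    using assms(5) by (intro continuous_on_cong) auto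
  then have "continuous_on (- S) f" by simp
  then have "continuous_on (U \<union> - S) f"
    using assms by (intro continuous_on_open_Un) auto
  moreover have "U \<union> - S = UNIV" using assms by auto
  ultimately show ?thesis by simp
qed

lemma has_pd_zero:
  assumes "closed S" "x \<notin> S" "\<And>x. x \<notin> S \<Longrightarrow> f x = 0"
  shows "has_pd i f x 0"
  using assms by (intro has_pd_eventually[OF has_pd_const, of "-S"]) auto

text \<open>An amplitude is controlled only near its support, while the integration runs over the
  whole space. On \<open>U - S\<close> a derivative witness must be 0 because derivatives are
  unique, so its extension by zero is again a derivative and the induction continues.\<close>

lemma pd_bd_zero_extend:
  assumes "open U" "closed S" "S \<subseteq> U" "0 \<le> K"
  shows "pd_bd i k K U f \<Longrightarrow> (\<And>x. x \<notin> S \<Longrightarrow> f x = 0) \<Longrightarrow> pd_bd i k K UNIV f"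
proof (induction k arbitrary: f)
  case 0
  have "norm (f x) \<le> K" for x
    using 0 assms by (cases "x \<in> S") auto
  with 0 assms show ?case
    by (auto intro!: continuous_on_zero_extend[of U f S])
next
  case (Suc k)
  from Suc.prems(1) obtain f' where f': "\<forall>x\<in>U. has_pd i f x (f' x)" "pd_bd i k K U f'" by auto
  define g where "g x = (if x \<in> U then f' x else 0)" for x
  have 0: "has_pd i f x 0" if "x \<notin> S" for x
    using assms Suc.prems that by (intro has_pd_zero[of S]) auto
  then have g0: "g x = 0" if "x \<notin> S" for x
    using f'(1) that has_pd_unique[OF _ 0[OF that]] by (auto simp: g_def)
  have "has_pd i f x (g x)" for x
    using f' 0 g0 assms by (cases "x \<in> U") (auto simp: g_def)
  moreover have "pd_bd i k K U g"
    using f'(2) assms(1) by (rule pd_bd_cong) (auto simp: g_def)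
  then have "pd_bd i k K UNIV g" using g0 by (rule Suc.IH)
  moreover have "norm (f x) \<le> K" for x
    using Suc.prems assms by (cases "x \<in> S") auto
  moreover have "continuous_on UNIV f"
    using Suc.prems assms by (auto intro!: continuous_on_zero_extend[of U f S])
  ultimately show ?case by auto
qed

text \<open>\<open>L'\<close> is fixed before the function, the direction and the set: this
  uniformity lets one constant serve all pieces. It holds because every derivative of the reciprocal
  is bounded where |y| >= c.\<close>

lemma pd_bd_inverse:
  assumes "0 < c" "0 \<le> L"
  obtains L' where "0 \<le> L'" "\<And>i U (f::real^'n::finite \<Rightarrow> real). pd_bd i k L U f \<Longrightarrow>
     (\<And>x. x \<in> U \<Longrightarrow> c \<le> \<bar>f x\<bar>) \<Longrightarrow> pd_bd i k L' U (\<lambda>x. inverse (f x))"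
proof -
  \<comment> \<open>\<open>H j\<close> is the j-th derivative of the reciprocal.\<close>
  define H :: "nat \<Rightarrow> real \<Rightarrow> real" where "H j y = (-1)^j * fact j * inverse y ^ Suc j" for j y
  define B where "B = (\<Sum>j\<le>k. fact j * inverse c ^ Suc j)"
  have B: "0 \<le> B" using assms by (auto simp: B_def intro!: sum_nonneg)
  show ?thesis
  proof (rule that[of "comp_bound k B L"])
    show "0 \<le> comp_bound k B L" using assms B by (intro comp_bound_nonneg)
  next
    fix i U and f :: "real^'n \<Rightarrow> real"
    assume f: "pd_bd i k L U f" "\<And>x. x \<in> U \<Longrightarrow> c \<le> \<bar>f x\<bar>"
    have nz: "f x \<noteq> 0" if "x \<in> U" for x using f(2)[OF that] assms by auto
    have "pd_bd i k (comp_bound k B L) U (\<lambda>x. H 0 (f x))"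
    proof (rule pd_bd_comp[OF B assms(2) f(1)])
      fix j x assume "j < k" "x \<in> U"
      then have "f x \<noteq> 0" using nz by auto
      then have "((\<lambda>y. (-1)^j * fact j * inverse y ^ Suc j) has_real_derivative
          (-1)^j * fact j * ((1 + real j) * (- (inverse (f x) ^ Suc (Suc 0)) * inverse (f x) ^ j))) (at (f x))"
        by (intro DERIV_cmult DERIV_power_Suc DERIV_inverse)
      then show "(H j has_real_derivative H (Suc j) (f x)) (at (f x))"
        unfolding H_def[abs_def] by (simp add: algebra_simps)
    next
      fix j assume "j \<le> k"
      show "continuous_on (f ` U) (H j)"
        unfolding H_def using nz by (auto intro!: continuous_intros)
    next
      fix j x assume *: "j \<le> k" "x \<in> U"
      have "\<bar>H j (f x)\<bar> = fact j * inverse \<bar>f x\<bar> ^ Suc j"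
        by (simp add: H_def abs_mult power_abs)
      also have "\<dots> \<le> fact j * inverse c ^ Suc j"
        using f(2)[OF *(2)] assms by (intro mult_left_mono power_mono) (auto intro: le_imp_inverse_le)
      also have "\<dots> \<le> B"
        unfolding B_def using * assms by (intro member_le_sum) auto
      finally show "\<bar>H j (f x)\<bar> \<le> B" .
    qed
    then show "pd_bd i k (comp_bound k B L) U (\<lambda>x. inverse (f x))" by (simp add: H_def)
  qed
qed

subsection \<open>Non-stationary phase\<close>

text \<open>There is no measurability hypothesis: if \<open>f\<close> is not measurable, neither is
  its translate, and both integrals take the default value 0.\<close>

lemma lborel_integral_translate:
  fixes f :: "real^'n::finite \<Rightarrow> 'b::{banach, second_countable_topology}"
  shows "(\<integral>x. f (h + x) \<partial>lborel) = (\<integral>x. f x \<partial>lborel)"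
proof (cases "f \<in> borel_measurable borel")
  case True
  have "(\<integral>x. f x \<partial>lborel) = (\<integral>x. f x \<partial>(distr lborel borel ((+) h)))"
    by (subst lborel_distr_plus) simp
  also have "\<dots> = (\<integral>x. f (h + x) \<partial>lborel)"
    using True by (intro integral_distr) auto
  finally show ?thesis by simp
next
  case False
  have "(\<lambda>x. f (h + x)) \<notin> borel_measurable borel"
  proof
    assume "(\<lambda>x. f (h + x)) \<in> borel_measurable borel"
    then have "(\<lambda>x. f (h + (- h + x))) \<in> borel_measurable borel"
      by (rule measurable_compose[rotated]) simp
    with False show False by simp
  qed
  with False have "\<not> integrable lborel f" "\<not> integrable lborel (\<lambda>x. f (h + x))"
    by (auto dest: borel_measurable_integrable)
  then show ?thesis by (simp add: not_integrable_integral_eq)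
qed

lemma integrable_compact_support:
  fixes f :: "real^'n::finite \<Rightarrow> 'b::{banach, second_countable_topology}"
  assumes "continuous_on UNIV f" "compact S" "\<And>x. x \<notin> S \<Longrightarrow> f x = 0"
  shows "integrable lborel f"
proof -
  have "integrable lborel (\<lambda>x. indicator S x *\<^sub>R f x)"
    using assms by (intro borel_integrable_compact) (auto intro: continuous_on_subset)
  also have "(\<lambda>x. indicator S x *\<^sub>R f x) = f"
    using assms(3) by (auto simp: indicator_def fun_eq_iff)
  finally show ?thesis .
qed

section \<open>Integration by parts without boundary terms\<close>

lemma has_pd_mean_bound:
  assumes "\<And>x. has_pd i f x (f' x)" "\<And>x. norm (f' x) \<le> B"
  shows "norm (f (x + s *\<^sub>R axis i 1) - f x) \<le> B * \<bar>s\<bar>"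
proof -
  let ?g = "\<lambda>s. f (x + s *\<^sub>R axis i 1)"
  have "norm (?g s - ?g 0) \<le> B * norm (s - 0)"
  proof (rule differentiable_bound[of UNIV])
    fix t :: real
    show "(?g has_derivative (\<lambda>h. h *\<^sub>R f' (x + t *\<^sub>R axis i 1))) (at t)"
      using has_pd_along[OF assms(1)] by (simp add: has_vector_derivative_def)
    show "onorm (\<lambda>h. h *\<^sub>R f' (x + t *\<^sub>R axis i 1)) \<le> B"
      using assms(2) by (intro onorm_bound order_trans[OF norm_ge_zero assms(2)])
        (auto simp: mult.commute[of B] assms(2) mult_left_mono)
  qed auto
  then show ?thesis by simp
qed

text \<open>Difference quotients of \<open>F\<close> have integral 0 by translation invariance, and
  they converge dominatedly to \<open>F'\<close>. This avoids splitting the space into a line and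
  its complement.\<close>

lemma integral_pd_eq_0:
  fixes F :: "real^'n::finite \<Rightarrow> 'b::{banach, second_countable_topology}"
  assumes pd: "\<And>x. has_pd i F x (F' x)" and cont: "continuous_on UNIV F" "continuous_on UNIV F'"
    and S: "compact S" "\<And>x. x \<notin> S \<Longrightarrow> F x = 0"
  shows "(\<integral>x. F' x \<partial>lborel) = 0"
proof -
  have F'0: "F' x = 0" if "x \<notin> S" for x
    using has_pd_zero[of S x F i] S that pd compact_imp_closed has_pd_unique by blast
  have "compact (F' ` S)"
    using cont S by (intro compact_continuous_image) (auto intro: continuous_on_subset)
  then obtain B0 where "\<And>x. x \<in> S \<Longrightarrow> norm (F' x) \<le> B0"
    by (meson bounded_iff compact_imp_bounded imageI)
  then have B: "norm (F' x) \<le> max B0 0" for x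
    using F'0 by (cases "x \<in> S") (auto simp: le_max_iff_disj)
  define B where "B = max B0 0"
  obtain R where R: "\<And>x. x \<in> S \<Longrightarrow> norm x \<le> R"
    using compact_imp_bounded[OF S(1)] by (auto simp: bounded_iff)
  \<comment> \<open>The step lengths are at most 1, so every difference quotient vanishes outside
    the ball of radius \<open>R + 1\<close>, on which the constant \<open>B\<close>
    dominates.\<close>
  define h :: "nat \<Rightarrow> real" where "h j = inverse (real (Suc j))" for j
  have h: "0 < h j" "h j \<le> 1" for j by (auto simp: h_def inverse_le_1_iff)
  define q where "q j x = (1 / h j) *\<^sub>R (F (h j *\<^sub>R axis i 1 + x) - F x)" for j x
  have intF: "integrable lborel F"
    by (rule integrable_compact_support[OF cont(1) S])
  have contq: "continuous_on UNIV (q j)" for j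
    unfolding q_def by (intro continuous_intros continuous_on_compose2[OF cont(1)]) auto
  have "(\<lambda>j. \<integral>x. q j x \<partial>lborel) \<longlonglongrightarrow> (\<integral>x. F' x \<partial>lborel)"
  proof (rule integral_dominated_convergence[where w="\<lambda>x. indicator (cball 0 (R + 1)) x *\<^sub>R B"])
    show "F' \<in> borel_measurable lborel" "\<And>j. q j \<in> borel_measurable lborel"
      using cont contq by (auto intro: borel_measurable_continuous_onI)
    show "integrable lborel (\<lambda>x. indicator (cball 0 (R + 1)) x *\<^sub>R B)"
      by (intro borel_integrable_compact) auto
    show "AE x in lborel. (\<lambda>j. q j x) \<longlonglongrightarrow> F' x"
    proof (rule AE_I2)
      fix x
      let ?g = "\<lambda>s. F (x + s *\<^sub>R axis i 1)"
      have "((\<lambda>s. (?g s - ?g 0) /\<^sub>R s) \<longlongrightarrow> F' x) (at 0)"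
      proof (rule LIM_zero_cancel, rule tendsto_norm_zero_cancel, rule Lim_transform_eventually)
        show "((\<lambda>s. norm (?g s - ?g 0 - (s - 0) *\<^sub>R F' x) / norm (s - 0)) \<longlongrightarrow> 0) (at 0)"
          using pd[of x] unfolding has_pd_def has_vector_derivative_def has_derivative_iff_norm by blast
        have "norm (?g s - ?g 0 - s *\<^sub>R F' x) / norm s = norm ((?g s - ?g 0) /\<^sub>R s - F' x)"
          if "s \<noteq> 0" for s
        proof -
          have "(?g s - ?g 0) /\<^sub>R s - F' x = (?g s - ?g 0 - s *\<^sub>R F' x) /\<^sub>R s"
            using that by (simp add: scaleR_diff_right)
          then show ?thesis by (simp add: divide_inverse mult.commute)
        qed
        then show "\<forall>\<^sub>F s in at 0. norm (?g s - ?g 0 - (s - 0) *\<^sub>R F' x) / norm (s - 0)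
            = norm ((?g s - ?g 0) /\<^sub>R s - F' x)"
          by (auto simp: eventually_at_filter)
      qed
      moreover have "filterlim h (at 0) sequentially"
        unfolding filterlim_at using h LIMSEQ_inverse_real_of_nat
        by (auto simp: h_def[abs_def])
      ultimately have "(\<lambda>j. (?g (h j) - ?g 0) /\<^sub>R h j) \<longlonglongrightarrow> F' x"
        by (rule filterlim_compose)
      then show "(\<lambda>j. q j x) \<longlonglongrightarrow> F' x"
        by (simp add: q_def[abs_def] add.commute divide_inverse)
    qed
    fix j
    show "AE x in lborel. norm (q j x) \<le> indicator (cball 0 (R + 1)) x *\<^sub>R B"
    proof (rule AE_I2)
      fix x
      show "norm (q j x) \<le> indicator (cball 0 (R + 1)) x *\<^sub>R B"
      proof (cases "norm x \<le> R + 1")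
        case True
        have "norm (F (x + h j *\<^sub>R axis i 1) - F x) \<le> B * \<bar>h j\<bar>"
          using pd B unfolding B_def by (rule has_pd_mean_bound)
        then show ?thesis using True h[of j]
          by (simp add: q_def add.commute pos_divide_le_eq)
      next
        case False
        have "norm x \<le> norm (h j *\<^sub>R axis i 1 + x) + norm (h j *\<^sub>R axis i (1::real))"
          by (metis add_diff_cancel_left' norm_triangle_sub add.commute norm_triangle_ineq4)
        then have "norm (h j *\<^sub>R axis i 1 + x) > R"
          using False h[of j] by simp
        then have "F (h j *\<^sub>R axis i 1 + x) = 0" "F x = 0"
          using S R False by force+
        then show ?thesis by (simp add: q_def B_def)
      qed
    qed
  qed
  moreover have "(\<integral>x. q j x \<partial>lborel) = 0" for j
  proof -
    have "integrable lborel (\<lambda>x. F (h j *\<^sub>R axis i 1 + x))"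
    proof (rule integrable_compact_support)
      show "continuous_on UNIV (\<lambda>x. F (h j *\<^sub>R axis i 1 + x))"
        by (intro continuous_intros continuous_on_compose2[OF cont(1)]) auto
      show "compact ((\<lambda>y. - h j *\<^sub>R axis i 1 + y) ` S)"
        by (rule compact_translation[OF S(1)])
      fix x assume *: "x \<notin> (\<lambda>y. - h j *\<^sub>R axis i 1 + y) ` S"
      show "F (h j *\<^sub>R axis i 1 + x) = 0"
      proof (rule S(2), rule notI)
        assume "h j *\<^sub>R axis i 1 + x \<in> S"
        from imageI[OF this, of "\<lambda>y. - h j *\<^sub>R axis i 1 + y"] * show False by simp
      qed
    qed
    then show ?thesis
      using intF by (simp add: q_def lborel_integral_translate)
  qed
  ultimately show ?thesis
    by (simp add: LIMSEQ_const_iff)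
qed

text \<open>The accumulated Leibniz factors of the integrations by parts: a step with
  \<open>M\<close> further ones to come multiplies the amplitude bound by
  \<open>2 ^ Suc M * L\<close>, where \<open>L\<close> bounds the reciprocal of the phase
  derivative.\<close>

primrec ns_const :: "real \<Rightarrow> nat \<Rightarrow> real" where
  "ns_const L 0 = 1"
| "ns_const L (Suc M) = 2 ^ Suc M * L * ns_const L M"

lemma ns_const_nonneg: "0 \<le> L \<Longrightarrow> 0 \<le> ns_const L M"
  by (induction M) auto

text \<open>Each integration by parts replaces the amplitude \<open>\<beta>\<close> by the
  derivative of \<open>v *\<^sub>R \<beta>\<close>, where \<open>v\<close> is the reciprocal of the
  phase derivative, and gains a factor 1 / \<open>\<mu>\<close>. The supports stay inside
  \<open>S\<close>, so the volume bound \<open>V\<close> is paid only once.\<close>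

lemma nonstationary_phase:
  fixes \<beta> :: "real^'n::finite \<Rightarrow> complex"
  assumes U: "open U" "compact S" "S \<subseteq> U" and V: "measure lborel S \<le> V"
    and g: "continuous_on U g" "\<And>x. x \<in> U \<Longrightarrow> has_pd i g x (g' x)"
    and v: "\<And>x. x \<in> U \<Longrightarrow> v x * g' x = 1" and "0 \<le> L" "0 < \<mu>"
  shows "pd_bd i M L U v \<Longrightarrow> pd_bd i M K UNIV \<beta> \<Longrightarrow> (\<And>x. x \<notin> S \<Longrightarrow> \<beta> x = 0) \<Longrightarrow>
     norm (\<integral>x. cis (\<mu> * g x) * \<beta> x \<partial>lborel) \<le> V * K * ns_const L M / \<mu> ^ M"
proof (induction M arbitrary: K \<beta>)
  case 0
  have K: "0 \<le> K" using 0 by (auto intro: order_trans[OF norm_ge_zero])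
  have "norm (\<integral>x. cis (\<mu> * g x) * \<beta> x \<partial>lborel) \<le> (\<integral>x. indicator S x *\<^sub>R K \<partial>lborel)"
  proof (rule Bochner_Integration.integral_norm_bound_integral)
    show "integrable lborel (\<lambda>x. indicator S x *\<^sub>R K)"
      using U by (intro borel_integrable_compact) auto
    show "integrable lborel (\<lambda>x. cis (\<mu> * g x) * \<beta> x)"
    proof (rule integrable_compact_support[OF _ U(2)])
      show "continuous_on UNIV (\<lambda>x. cis (\<mu> * g x) * \<beta> x)"
        using U g 0 by (intro continuous_on_zero_extend[of U _ S])
          (auto intro!: continuous_intros intro: compact_imp_closed continuous_on_subset)
    qed (use 0 in auto)
    fix x
    show "norm (cis (\<mu> * g x) * \<beta> x) \<le> indicator S x *\<^sub>R K"
      using 0 by (auto simp: norm_mult indicator_def)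
  qed
  also have "\<dots> = measure lborel S * K"
    using U(2) by (simp add: compact_imp_closed)
  also have "\<dots> \<le> V * K * ns_const L 0 / \<mu> ^ 0"
    using V K by (simp add: mult_right_mono)
  finally show ?case .
next
  case (Suc M)
  have K: "0 \<le> K" using Suc.prems by (auto intro: order_trans[OF norm_ge_zero])
  define w where "w x = v x *\<^sub>R \<beta> x" for x
  define K' where "K' = 2 ^ Suc M * (L * K)"
  have clS: "closed S" using U by (auto intro: compact_imp_closed)
  have w0: "w x = 0" if "x \<notin> S" for x using Suc.prems that by (simp add: w_def)
  have "pd_bd i (Suc M) K' U w"
    unfolding K'_def w_def using \<open>0 \<le> L\<close> K Suc.prems(1)
      pd_bd_mono[OF Suc.prems(2) order_refl subset_UNIV] by (rule pd_bd_scaleR)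
  then have "pd_bd i (Suc M) K' UNIV w"
    using U clS w0 \<open>0 \<le> L\<close> K by (intro pd_bd_zero_extend) (auto simp: K'_def)
  then obtain w' where w': "\<And>x. has_pd i w x (w' x)" "pd_bd i M K' UNIV w'"
    and contw: "continuous_on UNIV w" by auto
  have w'0: "w' x = 0" if "x \<notin> S" for x
    using has_pd_zero[of S x w i] clS that w0 w'(1) has_pd_unique by blast
  have cont\<beta>: "continuous_on UNIV \<beta>" using Suc.prems(2) by (rule pd_bd_cont)
  have contw': "continuous_on UNIV w'" using w'(2) by (rule pd_bd_cont)
  \<comment> \<open>The product rule for \<open>F\<close> yields \<open>F'\<close> because
    \<open>v x * g' x = 1\<close> on \<open>U\<close>. As the integral of \<open>F'\<close>
    vanishes, the integral with amplitude \<open>\<beta>\<close>, times i mu, is minus the one with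
    amplitude \<open>w'\<close>.\<close>
  define F where "F x = cis (\<mu> * g x) * w x" for x
  define F' where "F' x = cis (\<mu> * g x) * w' x + \<i> * of_real \<mu> * (cis (\<mu> * g x) * \<beta> x)" for x
  have pdF: "has_pd i F x (F' x)" for x
  proof (cases "x \<in> S")
    case True
    then have xU: "x \<in> U" using U by auto
    have "has_pd i (\<lambda>x. cis (\<mu> * g x)) x (g' x *\<^sub>R (of_real \<mu> * \<i> * cis (\<mu> * g x)))"
    proof (rule has_pd_comp[OF g(2)[OF xU]])
      show "((\<lambda>y. cis (\<mu> * y)) has_vector_derivative of_real \<mu> * \<i> * cis (\<mu> * g x)) (at (g x))"
        unfolding has_vector_derivative_def
        by (auto intro!: derivative_eq_intros simp: scaleR_conv_of_real algebra_simps)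
    qed
    from has_pd_bilinear[OF bounded_bilinear_mult this w'(1)[of x]]
    have "has_pd i F x (cis (\<mu> * g x) * w' x + g' x *\<^sub>R (of_real \<mu> * \<i> * cis (\<mu> * g x)) * w x)"
      by (simp add: F_def[abs_def])
    also have "g' x *\<^sub>R (of_real \<mu> * \<i> * cis (\<mu> * g x)) * w x
        = of_real (v x * g' x) * (\<i> * of_real \<mu> * (cis (\<mu> * g x) * \<beta> x))"
      by (simp add: w_def scaleR_conv_of_real)
    finally show ?thesis using v[OF xU] by (simp add: F'_def)
  next
    case False
    then have "F' x = 0" using w'0 Suc.prems(3) by (simp add: F'_def)
    then show ?thesis
      using has_pd_zero[of S x F i] clS False w0 by (simp add: F_def)
  qed
  have c1: "continuous_on UNIV (\<lambda>x. cis (\<mu> * g x) * f x)"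
    if "continuous_on UNIV f" "\<And>x. x \<notin> S \<Longrightarrow> f x = 0" for f
    using that U g clS by (intro continuous_on_zero_extend[of U _ S])
          (auto intro!: continuous_intros intro: continuous_on_subset)
  have i1: "integrable lborel (\<lambda>x. cis (\<mu> * g x) * f x)"
    if "continuous_on UNIV f" "\<And>x. x \<notin> S \<Longrightarrow> f x = 0" for f
    using that by (intro integrable_compact_support[OF c1 U(2)]) auto
  have "(\<integral>x. F' x \<partial>lborel) = 0"
  proof (rule integral_pd_eq_0[OF pdF _ _ U(2)])
    show "continuous_on UNIV F" unfolding F_def using contw w0 by (rule c1)
    show "continuous_on UNIV F'" unfolding F'_def
      by (rule continuous_on_add[OF c1[OF contw' w'0] continuous_on_mult[OF continuous_on_const
            c1[OF cont\<beta> Suc.prems(3)]]])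
    fix x assume "x \<notin> S" then show "F x = 0" using w0 by (simp add: F_def)
  qed
  moreover have "(\<integral>x. F' x \<partial>lborel) = (\<integral>x. cis (\<mu> * g x) * w' x \<partial>lborel)
      + \<i> * of_real \<mu> * (\<integral>x. cis (\<mu> * g x) * \<beta> x \<partial>lborel)"
    unfolding F'_def using i1[OF contw' w'0] i1[OF cont\<beta> Suc.prems(3)]
    by (subst Bochner_Integration.integral_add) auto
  ultimately have "\<i> * of_real \<mu> * (\<integral>x. cis (\<mu> * g x) * \<beta> x \<partial>lborel)
      = - (\<integral>x. cis (\<mu> * g x) * w' x \<partial>lborel)"
    by (simp only: eq_neg_iff_add_eq_0 add.commute)
  then have "norm (\<i> * of_real \<mu> * (\<integral>x. cis (\<mu> * g x) * \<beta> x \<partial>lborel))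
      = norm (\<integral>x. cis (\<mu> * g x) * w' x \<partial>lborel)"
    by simp
  also have "\<dots> \<le> V * K' * ns_const L M / \<mu> ^ M"
    using pd_bd_less[OF Suc.prems(1)] w'(2) w'0 by (rule Suc.IH)
  finally show ?case
    using \<open>0 < \<mu>\<close> by (simp add: norm_mult K'_def field_simps)
qed

subsection \<open>Integrals of radial powers\<close>

abbreviation nnint :: "(real^'n::finite \<Rightarrow> real) \<Rightarrow> ennreal" where
  "nnint Y \<equiv> \<integral>\<^sup>+c. ennreal (Y c) \<partial>lborel"

abbreviation radial_mass :: "real \<Rightarrow> (real^'n::finite) set \<Rightarrow> ennreal" where
  "radial_mass p S \<equiv> \<integral>\<^sup>+c. ennreal (norm c powr p) * indicator S c \<partial>lborel"

lemma emeasure_lborel_cball_real_n: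
  assumes "0 \<le> R"
  shows "emeasure lborel (cball (p::real^'n::finite) R) = ennreal (unit_ball_vol CARD('n) * R powr CARD('n))"
proof (cases "R = 0")
  case False
  then show ?thesis using emeasure_cball[OF assms, of p] assms by (simp add: powr_realpow)
qed (simp add: emeasure_lborel_singleton)

lemma ennreal_le_suminf: "(t :: nat \<Rightarrow> ennreal) k \<le> (\<Sum>k. t k)"
  using sum_le_suminf[OF summableI, of "{k}" t] by simp

lemma exists_dyadic:
  fixes x :: real
  assumes "1 \<le> x"
  obtains k :: nat where "2 ^ k \<le> x" "x < 2 ^ Suc k"
proof -
  define k where "k = nat \<lfloor>log 2 x\<rfloor>"
  have 0: "0 \<le> log 2 x" using assms by simp
  have "real k \<le> log 2 x" "log 2 x < real k + 1"
    using 0 by (auto simp: k_def)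
  then have "2 powr real k \<le> x" "x < 2 powr real (Suc k)"
    using assms by (simp_all add: le_log_iff log_less_iff add.commute)
  then show ?thesis using that[of k] powr_realpow[of 2 k] powr_realpow[of 2 "Suc k"] by simp
qed

text \<open>A substitute for polar coordinates: each point of \<open>A\<close> lies in some ball of
  radius \<open>\<rho> k\<close> on which the bound is a geometric term divided by the n-th power of
  the radius. That power cancels the volume of the ball, so the integrals add up to a geometric
  series whatever the radii are.\<close>

lemma nn_integral_dyadic_balls:
  fixes q :: real
  assumes "q < 0" "0 \<le> D" "0 < R"
  assumes f: "\<And>c::real^'n::finite. c \<in> A \<Longrightarrow> \<exists>k::nat. f c \<le> D * (2 powr q) ^ k * (\<rho> k) powr (- real CARD('n)) \<and> norm c \<le> \<rho> k"
    and \<rho>: "\<And>k. 0 < \<rho> k"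
  shows "(\<integral>\<^sup>+c. ennreal (f c) * indicator A c \<partial>lborel) \<le> ennreal (D * unit_ball_vol CARD('n) / (1 - 2 powr q))"
proof -
  define \<theta> where "\<theta> = 2 powr q"
  have \<theta>: "0 < \<theta>" "\<theta> < 1" using assms(1) by (auto simp: \<theta>_def powr_less_one)
  let ?n = "real CARD('n)"
  have "(\<integral>\<^sup>+c. ennreal (f c) * indicator A c \<partial>lborel)
      \<le> (\<integral>\<^sup>+c. (\<Sum>k. ennreal (D * \<theta> ^ k * \<rho> k powr (- ?n)) * indicator (cball 0 (\<rho> k)) (c::real^'n)) \<partial>lborel)"
  proof (rule nn_integral_mono)
    fix c
    show "ennreal (f c) * indicator A c
       \<le> (\<Sum>k. ennreal (D * \<theta> ^ k * \<rho> k powr (- ?n)) * indicator (cball 0 (\<rho> k)) c)" (is "_ \<le> (\<Sum>k. ?t k)")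
    proof (cases "c \<in> A")
      case True
      then obtain k where k: "f c \<le> D * \<theta> ^ k * \<rho> k powr (- ?n)" "norm c \<le> \<rho> k"
        using f \<theta>_def by blast
      have "ennreal (f c) * indicator A c \<le> ?t k"
        using k True by (simp add: ennreal_leI)
      also have "\<dots> \<le> (\<Sum>k. ?t k)"
        by (rule ennreal_le_suminf)
      finally show ?thesis .
    qed simp
  qed
  also have "\<dots> = (\<Sum>k. \<integral>\<^sup>+c. ennreal (D * \<theta> ^ k * \<rho> k powr (- ?n)) * indicator (cball 0 (\<rho> k)) (c::real^'n) \<partial>lborel)"
  proof (rule nn_integral_suminf)
    fix k
    have "cball 0 (\<rho> k) \<in> sets (lborel :: (real^'n) measure)" by simp
    then show "(\<lambda>c. ennreal (D * \<theta> ^ k * \<rho> k powr (- ?n)) * indicator (cball 0 (\<rho> k)) (c::real^'n))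
        \<in> borel_measurable lborel"
      by (rule borel_measurable_times_ennreal[OF borel_measurable_const borel_measurable_indicator])
  qed
  also have "\<dots> = (\<Sum>k. ennreal (D * unit_ball_vol ?n * \<theta> ^ k))"
  proof (rule arg_cong[where f=suminf], rule ext)
    fix k
    have "(\<integral>\<^sup>+c. ennreal (D * \<theta> ^ k * \<rho> k powr (- ?n)) * indicator (cball 0 (\<rho> k)) (c::real^'n) \<partial>lborel)
       = ennreal (D * \<theta> ^ k * \<rho> k powr (- ?n)) * ennreal (unit_ball_vol ?n * \<rho> k powr ?n)"
      using \<rho>[of k] by (subst nn_integral_cmult_indicator) (auto simp: emeasure_lborel_cball_real_n)
    also have "\<dots> = ennreal (D * \<theta> ^ k * unit_ball_vol ?n * (\<rho> k powr (- ?n) * \<rho> k powr ?n))"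
      using assms(2) \<theta> by (subst ennreal_mult'[symmetric]) (auto simp: mult_ac)
    also have "\<dots> = ennreal (D * unit_ball_vol ?n * \<theta> ^ k)"
      using \<rho>[of k] by (simp add: powr_add[symmetric] mult_ac)
    finally show "(\<integral>\<^sup>+c. ennreal (D * \<theta> ^ k * \<rho> k powr (- ?n)) * indicator (cball 0 (\<rho> k)) (c::real^'n) \<partial>lborel)
       = ennreal (D * unit_ball_vol ?n * \<theta> ^ k)" .
  qed
  also have "\<dots> = ennreal (D * unit_ball_vol ?n * (1 / (1 - \<theta>)))"
    using \<theta> assms(2) by (intro suminf_ennreal_eq sums_mult geometric_sums) auto
  finally show ?thesis by (simp add: \<theta>_def)
qed

lemma nn_integral_norm_powr_cball:
  assumes p: "- real CARD('n) < p"
  obtains C where "0 \<le> C" "\<And>R. 0 < R \<Longrightarrow>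
    radial_mass p ({c. norm c \<le> R} :: (real^'n) set)
      \<le> ennreal (C * R powr (p + CARD('n)))"
proof -
  let ?n = "real CARD('n)"
  define q where "q = - (p + ?n)"
  have q: "q < 0" using p by (simp add: q_def)
  show ?thesis
  proof (rule that[of "2 powr \<bar>p\<bar> * unit_ball_vol ?n / (1 - 2 powr q)"])
    show "0 \<le> 2 powr \<bar>p\<bar> * unit_ball_vol ?n / (1 - 2 powr q)"
      using q by (auto intro!: divide_nonneg_pos simp: powr_less_one)
    fix R :: real assume R: "0 < R"
    \<comment> \<open>The k-th ball has radius \<open>R / 2 ^ k\<close>; on the shell between it and
      the next one \<open>norm c powr p\<close> varies by at most the factor
      \<open>2 powr \<bar>p\<bar>\<close>, whichever sign \<open>p\<close> has.\<close>
    have "radial_mass p ({c. norm c \<le> R} :: (real^'n) set)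
       \<le> ennreal (2 powr \<bar>p\<bar> * R powr (p + ?n) * unit_ball_vol ?n / (1 - 2 powr q))"
    proof (rule nn_integral_dyadic_balls[OF q, where \<rho> = "\<lambda>k. R / 2 ^ k" and R = R])
      fix c :: "real^'n" assume c: "c \<in> {c. norm c \<le> R}"
      show "\<exists>k. norm c powr p \<le> 2 powr \<bar>p\<bar> * R powr (p + ?n) * (2 powr q) ^ k * (R / 2 ^ k) powr - ?n
          \<and> norm c \<le> R / 2 ^ k"
      proof (cases "c = 0")
        case True
        \<comment> \<open>\<open>0 powr p\<close> is 0 for every \<open>p\<close>, so at the origin
          the index 0 will do.\<close>
        then show ?thesis using R by (intro exI[of _ 0]) auto
      next
        case False
        then obtain k :: nat where k: "2 ^ k \<le> R / norm c" "R / norm c < 2 ^ Suc k"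
          using c exists_dyadic[of "R / norm c"] by auto
        then have k': "norm c \<le> R / 2 ^ k" "R / 2 ^ k / 2 \<le> norm c"
          using False by (auto simp: field_simps)
        have "norm c powr p \<le> 2 powr \<bar>p\<bar> * (R / 2 ^ k) powr p"
        proof (cases "0 \<le> p")
          case True
          then have "norm c powr p \<le> 1 * (R / 2 ^ k) powr p"
            using k' by (simp add: powr_mono2)
          also have "\<dots> \<le> 2 powr \<bar>p\<bar> * (R / 2 ^ k) powr p"
            by (intro mult_right_mono) (auto simp: ge_one_powr_ge_zero)
          finally show ?thesis .
        next
          case False
          then have "norm c powr p \<le> (R / 2 ^ k / 2) powr p"
            using k' R by (intro powr_mono2') auto
          also have "\<dots> = 2 powr \<bar>p\<bar> * (R / 2 ^ k) powr p"
            using False R by (simp add: powr_divide powr_mult powr_minus_divide)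
          finally show ?thesis .
        qed
        also have "(R / 2 ^ k) powr p = (R / 2 ^ k) powr (p + ?n) * (R / 2 ^ k) powr - ?n"
          by (simp add: powr_add[symmetric])
        also have "(R / 2 ^ k) powr (p + ?n) = R powr (p + ?n) * (2 powr q) ^ k"
          using R unfolding q_def powr_minus
          by (simp add: powr_divide powr_powr powr_realpow[symmetric] mult.commute power_inverse field_simps)
        finally show ?thesis using k' by (intro exI[of _ k]) (simp add: mult_ac)
      qed
    qed (use R in auto)
    then show "radial_mass p ({c. norm c \<le> R} :: (real^'n) set)
      \<le> ennreal (2 powr \<bar>p\<bar> * unit_ball_vol ?n / (1 - 2 powr q) * R powr (p + ?n))"
      by (simp add: mult_ac)
  qed
qed

lemma nn_integral_norm_powr_outside:
  assumes p: "p < - real CARD('n)"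
  obtains C where "0 \<le> C" "\<And>R. 0 < R \<Longrightarrow>
    radial_mass p ({c. R \<le> norm c} :: (real^'n) set)
      \<le> ennreal (C * R powr (p + CARD('n)))"
proof -
  let ?n = "real CARD('n)"
  define q where "q = p + ?n"
  have q: "q < 0" using p by (simp add: q_def)
  show ?thesis
  proof (rule that[of "2 powr ?n * unit_ball_vol ?n / (1 - 2 powr q)"])
    show "0 \<le> 2 powr ?n * unit_ball_vol ?n / (1 - 2 powr q)"
      using q by (auto intro!: divide_nonneg_pos simp: powr_less_one)
    fix R :: real assume R: "0 < R"
    \<comment> \<open>The radii are doubled so that the k-th ball contains the shell that starts at
      \<open>R * 2 ^ k\<close>; the factor \<open>2 powr ?n\<close> pays for the larger
      volume.\<close>
    have "radial_mass p ({c. R \<le> norm c} :: (real^'n) set)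
       \<le> ennreal (2 powr ?n * R powr (p + ?n) * unit_ball_vol ?n / (1 - 2 powr q))"
    proof (rule nn_integral_dyadic_balls[OF q, where \<rho> = "\<lambda>k. 2 * (R * 2 ^ k)" and R = R])
      fix c :: "real^'n" assume c: "c \<in> {c. R \<le> norm c}"
      then obtain k :: nat where k: "2 ^ k \<le> norm c / R" "norm c / R < 2 ^ Suc k"
        using R exists_dyadic[of "norm c / R"] by auto
      then have k': "norm c \<le> 2 * (R * 2 ^ k)" "R * 2 ^ k \<le> norm c"
        using R by (auto simp: field_simps)
      have "norm c powr p \<le> (R * 2 ^ k) powr p"
        using k' R p by (intro powr_mono2') (auto intro: less_imp_le order.trans[of p])
      also have "(R * 2 ^ k) powr p = 2 powr ?n * ((R * 2 ^ k) powr (p + ?n) * (2 * (R * 2 ^ k)) powr - ?n)"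
        using R by (simp add: powr_add powr_mult powr_minus_divide)
      also have "(R * 2 ^ k) powr (p + ?n) = R powr (p + ?n) * (2 powr q) ^ k"
        using R unfolding q_def
        by (simp add: powr_mult powr_powr powr_realpow[symmetric] mult.commute)
      finally show "\<exists>k. norm c powr p \<le> 2 powr ?n * R powr (p + ?n) * (2 powr q) ^ k * (2 * (R * 2 ^ k)) powr - ?n
          \<and> norm c \<le> 2 * (R * 2 ^ k)"
        using k' by (intro exI[of _ k]) (simp add: mult_ac)
    qed (use R in auto)
    then show "radial_mass p ({c. R \<le> norm c} :: (real^'n) set)
      \<le> ennreal (2 powr ?n * unit_ball_vol ?n / (1 - 2 powr q) * R powr (p + ?n))"
      by (simp add: mult_ac)
  qed
qed

text \<open>On the annulus \<open>norm c\<close> is comparable to \<open>R\<close>, so the exponent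
  may be replaced by -n - 1, which is integrable at infinity, at the price of a power of
  \<open>R\<close>. This handles every real \<open>p\<close>.\<close>

lemma nn_integral_norm_powr_annulus:
  assumes "0 < \<alpha>"
  obtains C where "0 \<le> C" "\<And>R. 0 < R \<Longrightarrow>
    radial_mass p ({c. \<alpha> * R \<le> norm c \<and> norm c \<le> \<beta> * R} :: (real^'n) set)
      \<le> ennreal (C * R powr (p + CARD('n)))"
proof -
  let ?n = "real CARD('n)"
  obtain C where C: "0 \<le> C" "\<And>R. 0 < R \<Longrightarrow>
    radial_mass (- ?n - 1) ({c. R \<le> norm c} :: (real^'n) set)
      \<le> ennreal (C * R powr (- ?n - 1 + CARD('n)))"
    using nn_integral_norm_powr_outside[where p="- ?n - 1" and ?'n='n] by auto
  \<comment> \<open>Adding the values at both radii bounds the power on the whole annulus for either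
    sign of its exponent.\<close>
  define D where "D = \<alpha> powr (p + ?n + 1) + \<beta> powr (p + ?n + 1)"
  have D: "0 \<le> D" by (simp add: D_def)
  show ?thesis
  proof (rule that[of "D * (C * \<alpha> powr -1)"])
    show "0 \<le> D * (C * \<alpha> powr -1)" using C D by auto
    fix R :: real assume R: "0 < R"
    have pw: "norm c powr p \<le> D * R powr (p + ?n + 1) * norm c powr (- ?n - 1)"
      if "\<alpha> * R \<le> norm c" "norm c \<le> \<beta> * R" for c :: "real^'n"
    proof -
      have pos: "0 < \<alpha> * R" using R assms by simp
      have c0: "0 < norm c" "0 < \<beta> * R" using that pos by linarith+
      have "norm c powr (p + ?n + 1) \<le> (\<alpha> * R) powr (p + ?n + 1) + (\<beta> * R) powr (p + ?n + 1)"
      proof (cases "0 \<le> p + ?n + 1")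
        case True
        then have "norm c powr (p + ?n + 1) \<le> (\<beta> * R) powr (p + ?n + 1)"
          using that by (intro powr_mono2) auto
        then show ?thesis by (smt (verit) powr_ge_zero)
      next
        case False
        then have "norm c powr (p + ?n + 1) \<le> (\<alpha> * R) powr (p + ?n + 1)"
          using that pos by (intro powr_mono2') auto
        then show ?thesis by (smt (verit) powr_ge_zero)
      qed
      also have "\<dots> = D * R powr (p + ?n + 1)"
        using R by (simp add: D_def powr_mult algebra_simps)
      finally have "norm c powr (p + ?n + 1) * norm c powr (- ?n - 1) \<le> D * R powr (p + ?n + 1) * norm c powr (- ?n - 1)"
        by (intro mult_right_mono) auto
      then show ?thesis by (simp add: powr_add[symmetric])
    qed
    have "radial_mass p ({c. \<alpha> * R \<le> norm c \<and> norm c \<le> \<beta> * R} :: (real^'n) set)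
      \<le> (\<integral>\<^sup>+c. ennreal (D * R powr (p + ?n + 1)) * (ennreal (norm c powr (- ?n - 1)) * indicator {c. \<alpha> * R \<le> norm c} (c::real^'n)) \<partial>lborel)"
      using pw D by (intro nn_integral_mono) (auto simp: indicator_def ennreal_mult[symmetric] intro!: ennreal_leI)
    also have "\<dots> = ennreal (D * R powr (p + ?n + 1)) *
       (\<integral>\<^sup>+c. (ennreal (norm c powr (- ?n - 1)) * indicator {c. \<alpha> * R \<le> norm c} (c::real^'n)) \<partial>lborel)"
      by (intro nn_integral_cmult) measurable
    also have "\<dots> \<le> ennreal (D * R powr (p + ?n + 1)) * ennreal (C * (\<alpha> * R) powr (- ?n - 1 + CARD('n)))"
      using C R assms by (intro mult_left_mono) auto
    also have "\<dots> = ennreal (D * (C * \<alpha> powr -1) * (R powr (p + ?n + 1) * R powr -1))"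
      using D C R assms by (simp add: ennreal_mult[symmetric] powr_mult abs_mult mult_ac del: powr_neg_one)
    also have "R powr (p + ?n + 1) * R powr -1 = R powr (p + ?n)"
      by (subst powr_add[symmetric]) simp
    finally show "radial_mass p ({c. \<alpha> * R \<le> norm c \<and> norm c \<le> \<beta> * R} :: (real^'n) set)
      \<le> ennreal (D * (C * \<alpha> powr -1) * R powr (p + CARD('n)))" .
  qed
qed

subsection \<open>Increments, jets and the Hessian\<close>

lemma lborel_Fubini:
  fixes f :: "'a::euclidean_space \<Rightarrow> 'b::euclidean_space \<Rightarrow> 'c::{banach, second_countable_topology}"
  assumes meas: "case_prod f \<in> borel_measurable (lborel \<Otimes>\<^sub>M lborel)"
    and fin: "(\<integral>\<^sup>+x. \<integral>\<^sup>+y. ennreal (norm (f x y)) \<partial>lborel \<partial>lborel) < \<infinity>"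
  shows "(\<integral>y. \<integral>x. f x y \<partial>lborel \<partial>lborel) = (\<integral>x. \<integral>y. f x y \<partial>lborel \<partial>lborel)"
    and "integrable lborel (\<lambda>x. \<integral>y. f x y \<partial>lborel)"
    and "integrable lborel (\<lambda>y. \<integral>x. f x y \<partial>lborel)"
proof -
  have "(\<integral>\<^sup>+p. ennreal (norm (case_prod f p)) \<partial>(lborel \<Otimes>\<^sub>M lborel)) < \<infinity>"
    using fin meas by (subst lborel.nn_integral_fst[symmetric]) auto
  then have "integrable (lborel \<Otimes>\<^sub>M lborel) (case_prod f)"
    using meas by (intro integrableI_bounded)
  then show "(\<integral>y. \<integral>x. f x y \<partial>lborel \<partial>lborel) = (\<integral>x. \<integral>y. f x y \<partial>lborel \<partial>lborel)"
    "integrable lborel (\<lambda>x. \<integral>y. f x y \<partial>lborel)" "integrable lborel (\<lambda>y. \<integral>x. f x y \<partial>lborel)"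
    by (rule lborel_pair.Fubini_integral, rule lborel_pair.integrable_fst, rule lborel_pair.integrable_snd)
qed

text \<open>The path from \<open>x\<close> to \<open>h + x\<close> changes one coordinate at a time,
  because only partial derivatives are given; it stays in the ball since the displacement is
  componentwise at most \<open>h\<close> in modulus. With \<open>L\<close> zero this is a Lipschitz
  bound, with \<open>L\<close> the second derivatives at a centre it is a first-order expansion of a
  gradient component.\<close>

lemma pd_increment:
  fixes f :: "real^'n::finite \<Rightarrow> real"
  assumes pd: "\<And>i z. z \<in> cball x (norm h) \<Longrightarrow> has_pd i f z (D i z)"
    and L: "\<And>i z. z \<in> cball x (norm h) \<Longrightarrow> \<bar>D i z - L i\<bar> \<le> \<epsilon>"
  shows "\<bar>f (h + x) - f x - (\<Sum>i\<in>UNIV. h $ i * L i)\<bar> \<le> \<epsilon> * (real CARD('n) * norm h)"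
proof -
  define p where "p A = (\<Sum>i\<in>A. (h $ i) *\<^sub>R axis i (1::real))" for A :: "'n set"
  have pA: "p A $ j = (if j \<in> A then h $ j else 0)" for A j
    by (simp add: p_def axis_def if_distrib cong: if_cong)
  have eps: "0 \<le> \<epsilon>" using L[of x undefined] by (intro order_trans[OF abs_ge_zero]) auto
  have main: "\<bar>f (x + p A) - f x - (\<Sum>i\<in>A. h $ i * L i)\<bar> \<le> \<epsilon> * (\<Sum>i\<in>A. \<bar>h $ i\<bar>)" if "finite A" for A
    using that
  proof (induction A)
    case empty
    then show ?case by (simp add: p_def)
  next
    case (insert j A)
    define y where "y = x + p A"
    define g where "g s = f (y + s *\<^sub>R axis j 1) - s * L j" for s
    have mem: "y + s *\<^sub>R axis j 1 \<in> cball x (norm h)" if "s \<in> closed_segment 0 (h $ j)" for s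
    proof -
      have "\<bar>s\<bar> \<le> \<bar>h $ j\<bar>" using that by (auto simp: closed_segment_eq_real_ivl split: if_splits)
      then have "norm (p A + s *\<^sub>R axis j 1) \<le> norm h"
        using insert.hyps by (intro norm_le_componentwise_cart) (auto simp: pA axis_def)
      moreover have "x - (y + s *\<^sub>R axis j 1) = - (p A + s *\<^sub>R axis j 1)" by (simp add: y_def)
      ultimately show ?thesis by (simp only: mem_cball dist_norm norm_minus_cancel)
    qed
    have "norm (g (h $ j) - g 0) \<le> \<epsilon> * norm (h $ j - 0)"
    proof (rule differentiable_bound[of "closed_segment 0 (h $ j)"])
      fix s assume s: "s \<in> closed_segment 0 (h $ j)"
      let ?d = "D j (y + s *\<^sub>R axis j 1) - L j"
      have "((\<lambda>s. f (y + s *\<^sub>R axis j 1)) has_vector_derivative D j (y + s *\<^sub>R axis j 1)) (at s)"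
        using pd[OF mem[OF s]] by (rule has_pd_along)
      then have "(g has_vector_derivative ?d) (at s)"
        unfolding g_def by (auto intro!: derivative_eq_intros)
      then show "(g has_derivative (\<lambda>t. t *\<^sub>R ?d)) (at s within closed_segment 0 (h $ j))"
        by (auto simp: has_vector_derivative_def intro: has_derivative_at_withinI)
      show "onorm (\<lambda>t. t *\<^sub>R ?d) \<le> \<epsilon>"
        using L[OF mem[OF s], of j] eps by (intro onorm_bound)
          (auto simp: abs_mult mult.commute[of \<epsilon>] intro: mult_left_mono)
    qed auto
    then have "\<bar>f (y + (h $ j) *\<^sub>R axis j 1) - f y - h $ j * L j\<bar> \<le> \<epsilon> * \<bar>h $ j\<bar>"
      by (simp add: g_def algebra_simps)
    moreover have "x + p (insert j A) = y + (h $ j) *\<^sub>R axis j 1"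
      using insert.hyps by (simp add: p_def y_def algebra_simps)
    ultimately show ?case
      using insert.IH insert.hyps by (simp add: y_def[symmetric] algebra_simps)
  qed
  have "p UNIV = h" by (simp add: vec_eq_iff pA)
  then have "\<bar>f (h + x) - f x - (\<Sum>i\<in>UNIV. h $ i * L i)\<bar> \<le> \<epsilon> * (\<Sum>i\<in>UNIV. \<bar>h $ i\<bar>)"
    using main[of UNIV] by (simp add: add.commute)
  also have "\<dots> \<le> \<epsilon> * (real CARD('n) * norm h)"
    using eps sum_bounded_above[of UNIV "\<lambda>i. \<bar>h $ i\<bar>" "norm h"]
    by (intro mult_left_mono) (auto simp: component_le_norm_cart)
  finally show ?thesis .
qed

section \<open>Quantitative nondegeneracy of matrices\<close>

lemma exists_large_component:
  fixes v :: "real^'n::finite"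
  obtains i where "norm v \<le> real CARD('n) * \<bar>v $ i\<bar>"
proof -
  obtain i where i: "\<And>j. \<bar>v $ j\<bar> \<le> \<bar>v $ i\<bar>"
  proof -
    have "Max (range (\<lambda>i. \<bar>v $ i\<bar>)) \<in> range (\<lambda>i. \<bar>v $ i\<bar>)" by (intro Max_in) auto
    then obtain i where "Max (range (\<lambda>i. \<bar>v $ i\<bar>)) = \<bar>v $ i\<bar>" by (elim rangeE)
    then show ?thesis using that[of i] by (metis Max_ge finite finite_imageI rangeI)
  qed
  have "norm v \<le> (\<Sum>j\<in>UNIV. \<bar>v $ j\<bar>)" by (rule norm_le_l1_cart)
  also have "\<dots> \<le> real CARD('n) * \<bar>v $ i\<bar>"
    using sum_bounded_above[of UNIV "\<lambda>j. \<bar>v $ j\<bar>" "\<bar>v $ i\<bar>"] i by simp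
  finally show ?thesis using that by blast
qed

text \<open>Compactness: the matrices with entries at most \<open>K\<close> and determinant at least
  \<open>c\<close> in modulus form a compact set, on which the transpose annihilates no unit vector,
  so the norm of the image has a positive minimum. Passing to one component costs the factor n. The
  sum is written so as to be the first-order increment along \<open>h\<close> of the i-th component
  of a gradient with Hessian \<open>A\<close>.\<close>

lemma det_bound_imp_lower_bound:
  assumes "0 < c"
  obtains c' where "0 < c'" "\<And>(A::real^'n::finite^'n) h. (\<And>i j. \<bar>A $ i $ j\<bar> \<le> K) \<Longrightarrow> c \<le> \<bar>det A\<bar> \<Longrightarrow>
     \<exists>i. c' * norm h \<le> \<bar>\<Sum>l\<in>UNIV. h $ l * A $ l $ i\<bar>"
proof -
  define Z :: "(real^'n^'n) set" where "Z = {A. (\<forall>i j. \<bar>A $ i $ j\<bar> \<le> K) \<and> c \<le> \<bar>det A\<bar>}"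
  define G :: "(real^'n^'n) \<times> (real^'n) \<Rightarrow> real" where "G = (\<lambda>(A, h). norm (transpose A *v h))"
  have "closed Z"
    unfolding Z_def det_def
    by (intro closed_Collect_conj closed_Collect_all closed_Collect_le continuous_intros)
  moreover have "bounded Z"
  proof (rule boundedI)
    fix A assume A: "A \<in> Z"
    have "norm A \<le> (\<Sum>i\<in>UNIV. norm (A $ i))" by (rule norm_le_l1_cart[unfolded real_norm_def[symmetric]] | simp add: norm_vec_def L2_set_le_sum)+
    also have "\<dots> \<le> (\<Sum>i\<in>(UNIV::'n set). real CARD('n) * K)"
    proof (rule sum_mono)
      fix i
      have "norm (A $ i) \<le> (\<Sum>j\<in>UNIV. \<bar>A $ i $ j\<bar>)" by (rule norm_le_l1_cart)
      also have "\<dots> \<le> real CARD('n) * K"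
        using A sum_bounded_above[of UNIV "\<lambda>j. \<bar>A $ i $ j\<bar>" K] by (simp add: Z_def)
      finally show "norm (A $ i) \<le> real CARD('n) * K" .
    qed
    finally show "norm A \<le> (\<Sum>i\<in>(UNIV::'n set). real CARD('n) * K)" .
  qed
  ultimately have comp: "compact (Z \<times> sphere (0::real^'n) 1)"
    by (intro compact_Times compact_sphere) (simp add: compact_eq_bounded_closed)
  have cont: "continuous_on (Z \<times> sphere 0 1) G"
    unfolding G_def case_prod_beta transpose_def matrix_vector_mult_def
    by (intro continuous_intros)
  have pos: "0 < G (A, h)" if "A \<in> Z" "h \<in> sphere 0 1" for A h
  proof -
    have "det (transpose A) \<noteq> 0" using that assms by (auto simp: Z_def)
    then have "invertible (transpose A)" by (simp add: invertible_det_nz)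
    moreover have "h \<noteq> 0" using that by auto
    ultimately have "transpose A *v h \<noteq> 0"
      by (auto simp: invertible_left_inverse matrix_left_invertible_ker)
    then show ?thesis by (simp add: G_def)
  qed
  obtain \<kappa> where \<kappa>: "0 < \<kappa>" "\<And>A h. A \<in> Z \<Longrightarrow> norm h = 1 \<Longrightarrow> \<kappa> \<le> G (A, h)"
  proof (cases "Z \<times> sphere (0::real^'n) 1 = {}")
    \<comment> \<open>If no matrix satisfies both conditions, any positive constant will do.\<close>
    case True
    then show ?thesis using that[of 1] by auto
  next
    case False
    from continuous_attains_inf[OF comp False cont] obtain z
      where "z \<in> Z \<times> sphere 0 1" "\<And>w. w \<in> Z \<times> sphere 0 1 \<Longrightarrow> G z \<le> G w" by blast
    then show ?thesis using that[of "G z"] pos by (cases z) auto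
  qed
  show ?thesis
  proof (rule that[of "\<kappa> / real CARD('n)"])
    show "0 < \<kappa> / real CARD('n)" using \<kappa> by simp
    fix A :: "real^'n^'n" and h :: "real^'n"
    assume "\<And>i j. \<bar>A $ i $ j\<bar> \<le> K" "c \<le> \<bar>det A\<bar>"
    then have A: "A \<in> Z" by (simp add: Z_def)
    obtain i where i: "norm (transpose A *v h) \<le> real CARD('n) * \<bar>(transpose A *v h) $ i\<bar>"
      using exists_large_component by blast
    have "\<kappa> * norm h \<le> norm (transpose A *v h)"
    proof (cases "h = 0")
      case False
      then have "\<kappa> \<le> norm (transpose A *v (h /\<^sub>R norm h))"
        using \<kappa>(2)[OF A, of "h /\<^sub>R norm h"] by (simp add: G_def)
      also have "\<dots> = norm (transpose A *v h) / norm h"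
        by (simp add: matrix_vector_mult_scaleR divide_inverse_commute)
      finally show ?thesis using False by (simp add: field_simps)
    qed simp
    also note i
    also have "(transpose A *v h) $ i = (\<Sum>l\<in>UNIV. h $ l * A $ l $ i)"
      by (simp add: matrix_vector_mult_def transpose_def mult.commute)
    finally show "\<exists>i. \<kappa> / real CARD('n) * norm h \<le> \<bar>\<Sum>l\<in>UNIV. h $ l * A $ l $ i\<bar>"
      by (intro exI[of _ i]) (simp add: field_simps)
  qed
qed

text \<open>\<open>P is\<close> plays the role of the iterated partial derivative of \<open>P []\<close> along the list \<open>is\<close>; stating this
  abstractly avoids computing \<open>pderivs\<close> of rescaled functions.\<close>
definition jet :: "nat \<Rightarrow> real \<Rightarrow> (real^'n::finite) set \<Rightarrow> ('n list \<Rightarrow> real^'n \<Rightarrow> 'b::real_normed_vector) \<Rightarrow> bool" where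
  "jet k K U P \<longleftrightarrow> (\<forall>is. length is \<le> k \<longrightarrow> continuous_on U (P is) \<and> (\<forall>x\<in>U. norm (P is x) \<le> K)) \<and>
     (\<forall>is i. length is < k \<longrightarrow> (\<forall>x\<in>U. has_pd i (P is) x (P (i # is) x)))"

lemma jet_norm: "jet k K U P \<Longrightarrow> length is \<le> k \<Longrightarrow> x \<in> U \<Longrightarrow> norm (P is x) \<le> K"
  unfolding jet_def by blast

lemma jet_has_pd: "jet k K U P \<Longrightarrow> length is < k \<Longrightarrow> x \<in> U \<Longrightarrow> has_pd i (P is) x (P (i # is) x)"
  unfolding jet_def by blast

lemma jet_cont: "jet k K U P \<Longrightarrow> length is \<le> k \<Longrightarrow> continuous_on U (P is)"
  unfolding jet_def by blast

lemma jet_imp_pd_bd: "jet N K U P \<Longrightarrow> length is + k \<le> N \<Longrightarrow> pd_bd i k K U (P is)"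
proof (induction k arbitrary: "is")
  case 0
  then show ?case by (auto simp: jet_cont jet_norm)
next
  case (Suc k)
  then show ?case
    by (intro pd_bd_SucI[of _ _ _ _ "P (i # is)"]) (auto simp: jet_cont jet_norm jet_has_pd)
qed

lemma jet_lipschitz:
  fixes P :: "'n::finite list \<Rightarrow> real^'n \<Rightarrow> real"
  assumes "jet N K U P" "length is < N" "cball x (norm h) \<subseteq> U"
  shows "\<bar>P is (h + x) - P is x\<bar> \<le> K * (real CARD('n) * norm h)"
  using pd_increment[of x h "P is" "\<lambda>i. P (i # is)" "\<lambda>i. 0" K] assms
    jet_norm[OF assms(1)] jet_has_pd[OF assms(1)]
  by (fastforce simp: subset_iff)

text \<open>Differentiating the quotient gives the quotient of the next jet component, and each
  quotient is controlled by one more derivative; hence the strict inequality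
  \<open>length is + k < N\<close>. The bounds do not depend on \<open>h\<close>, as the
  autocorrelation argument requires.\<close>

lemma jet_diff_quotient:
  fixes P :: "'n::finite list \<Rightarrow> real^'n \<Rightarrow> real"
  assumes P: "jet N K U P" and V: "\<And>x. x \<in> V \<Longrightarrow> cball x (norm h) \<subseteq> U" and h: "h \<noteq> 0"
  shows "length is + k < N \<Longrightarrow> pd_bd i k (K * real CARD('n)) V (\<lambda>x. (P is (h + x) - P is x) / norm h)"
proof (induction k arbitrary: "is")
  have mem: "h + x \<in> U" "x \<in> U" if "x \<in> V" for x
    using V[OF that] by (auto simp: subset_iff dist_norm)
  have c: "continuous_on V (\<lambda>x. (P is (h + x) - P is x) / norm h)" if "length is \<le> N" for "is"
    by (intro continuous_intros continuous_on_compose2[OF jet_cont[OF P that]])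
       (use mem h in auto)
  have b: "norm ((P is (h + x) - P is x) / norm h) \<le> K * real CARD('n)" if "length is < N" "x \<in> V" for x "is"
    using jet_lipschitz[OF P that(1) V[OF that(2)]] h by (simp add: field_simps)
  {
    case 0
    then show ?case using b c by simp
  next
    case (Suc k)
    have "has_pd i (\<lambda>x. (P is (h + x) - P is x) / norm h) x ((P (i # is) (h + x) - P (i # is) x) / norm h)"
      if "x \<in> V" for x
    proof -
      have "has_pd i (\<lambda>x. P is (h + x)) x (P (i # is) (h + x))"
        using has_pd_affine[of i "P is" h 1 x "P (i # is) (h + x)"] jet_has_pd[OF P, of "is" "h + x" i]
          mem[OF that] Suc.prems by simp
      then have "has_pd i (\<lambda>x. P is (h + x) - P is x) x (P (i # is) (h + x) - P (i # is) x)"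
        using jet_has_pd[OF P] mem[OF that] Suc.prems by (intro has_pd_diff) auto
      from has_pd_linear[OF bounded_linear_divide this] show ?thesis .
    qed
    then show ?case
      using Suc b c by (intro pd_bd_SucI[of _ _ _ _ "\<lambda>x. (P (i # is) (h + x) - P (i # is) x) / norm h"]) auto
  }
qed

subsection \<open>Bounds for a rescaled piece\<close>

text \<open>The order of the quantifiers is the point: \<open>C\<close> is fixed by
  \<open>c\<close>, \<open>L\<close>, \<open>M\<close> and the dimension before phase, amplitude,
  direction and centre. The condition \<open>\<rho> \<le> 1\<close> bounds the volume of the support
  by that of a unit ball.\<close>

lemma nonstationary_bound:
  fixes M :: nat
  assumes "0 < c" "0 \<le> L"
  obtains C where "0 \<le> C" "\<And>i U (p::real^'n::finite) \<rho> g g' \<beta> (\<mu>::real) K.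
     open U \<Longrightarrow> cball p \<rho> \<subseteq> U \<Longrightarrow> \<rho> \<le> 1 \<Longrightarrow> continuous_on U g \<Longrightarrow>
     (\<And>x. x \<in> U \<Longrightarrow> has_pd i g x (g' x)) \<Longrightarrow> pd_bd i M L U g' \<Longrightarrow> (\<And>x. x \<in> U \<Longrightarrow> c \<le> \<bar>g' x\<bar>) \<Longrightarrow>
     pd_bd i M K UNIV \<beta> \<Longrightarrow> (\<And>x. x \<notin> cball p \<rho> \<Longrightarrow> \<beta> x = 0) \<Longrightarrow> 0 < \<mu> \<Longrightarrow>
     norm (\<integral>x. cis (\<mu> * g x) * \<beta> x \<partial>lborel) \<le> C * K / \<mu> ^ M"
proof -
  obtain L' where L': "0 \<le> L'" "\<And>i U (f::real^'n \<Rightarrow> real). pd_bd i M L U f \<Longrightarrow>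
     (\<And>x. x \<in> U \<Longrightarrow> c \<le> \<bar>f x\<bar>) \<Longrightarrow> pd_bd i M L' U (\<lambda>x. inverse (f x))"
    using pd_bd_inverse[OF assms, where k=M and ?'n='n] by blast
  define V where "V = unit_ball_vol CARD('n)"
  have V: "0 \<le> V" by (simp add: V_def)
  show ?thesis
  proof (rule that[of "V * ns_const L' M"])
    show "0 \<le> V * ns_const L' M" using V L' by (simp add: ns_const_nonneg)
    fix i U and p :: "real^'n" and \<rho> g g' K and \<mu> :: real and \<beta> :: "real^'n \<Rightarrow> complex"
    assume *: "open U" "cball p \<rho> \<subseteq> U" "\<rho> \<le> 1" "continuous_on U g"
      "\<And>x. x \<in> U \<Longrightarrow> has_pd i g x (g' x)" "pd_bd i M L U g'" "\<And>x. x \<in> U \<Longrightarrow> c \<le> \<bar>g' x\<bar>"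
      "pd_bd i M K UNIV \<beta>" "\<And>x. x \<notin> cball p \<rho> \<Longrightarrow> \<beta> x = 0" "0 < \<mu>"
    have "emeasure lborel (cball p \<rho>) \<le> emeasure lborel (cball p 1)"
      using *(3) by (intro emeasure_mono) auto
    also have "\<dots> = ennreal V" by (simp add: emeasure_lborel_cball_real_n V_def)
    finally have Vle: "measure lborel (cball p \<rho>) \<le> V"
      unfolding measure_def using V by (simp add: enn2real_leI)
    have inv: "inverse (g' x) * g' x = 1" if "x \<in> U" for x
      using *(7)[OF that] assms(1) by (intro left_inverse) auto
    have "norm (\<integral>x. cis (\<mu> * g x) * \<beta> x \<partial>lborel) \<le> V * K * ns_const L' M / \<mu> ^ M"
    proof (rule nonstationary_phase[where U=U and S="cball p \<rho>" and i=i and g'=g'])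
      show "pd_bd i M L' U (\<lambda>x. inverse (g' x))" using *(6,7) by (rule L'(2))
    qed (fact * inv Vle L'(1) compact_cball)+
    then show "norm (\<integral>x. cis (\<mu> * g x) * \<beta> x \<partial>lborel) \<le> V * ns_const L' M * K / \<mu> ^ M"
      by (simp add: mult_ac)
  qed
qed

text \<open>After division by \<open>norm y\<close> the phase is the linear form of a unit vector
  plus a small multiple of \<open>P []\<close>. In the direction of a largest component of
  \<open>y\<close> the linear form has derivative at least 1/n in modulus, and the other part
  cancels at most half of it.\<close>

lemma nonstationary_linear_dominates:
  fixes M :: nat
  assumes K: "0 \<le> K"
  obtains A C where "0 < A" "0 \<le> C" "\<And>(P::'n::finite list \<Rightarrow> real^'n \<Rightarrow> real) u \<delta> \<rho> \<beta> K\<beta> \<tau> y.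
     jet (Suc M) K (ball u \<delta>) P \<Longrightarrow> \<rho> < \<delta> \<Longrightarrow> \<rho> \<le> 1 \<Longrightarrow>
     (\<And>i. pd_bd i M K\<beta> UNIV \<beta>) \<Longrightarrow> (\<And>x. x \<notin> cball u \<rho> \<Longrightarrow> \<beta> x = 0) \<Longrightarrow>
     y \<noteq> 0 \<Longrightarrow> A * \<bar>\<tau>\<bar> \<le> norm y \<Longrightarrow>
     norm (\<integral>x. cis (\<tau> * P [] x + y \<bullet> x) * \<beta> x \<partial>lborel) \<le> C * K\<beta> / norm y ^ M"
proof -
  define n where "n = real CARD('n)"
  have n: "1 \<le> n" by (simp add: n_def Suc_leI)
  \<comment> \<open>The summand \<open>2 * n * K\<close> makes the derivative coming from
    \<open>P []\<close> at most 1 / (2 n). The summand 1 ensures that \<open>A\<close> is at least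
    1, so that the coefficient \<open>s\<close> below has modulus at most 1.\<close>
  define A where "A = 2 * n * K + 1"
  have A: "1 \<le> A" using n K by (simp add: A_def)
  define L where "L = 2 ^ M * (1 * K) + 1"
  have pos: "0 < 1 / (2 * n)" "0 \<le> L" using n K by (auto simp: L_def)
  obtain C where C: "0 \<le> C" "\<And>i U (p::real^'n) \<rho> g g' \<beta> \<mu> K.
     open U \<Longrightarrow> cball p \<rho> \<subseteq> U \<Longrightarrow> \<rho> \<le> 1 \<Longrightarrow> continuous_on U g \<Longrightarrow>
     (\<And>x. x \<in> U \<Longrightarrow> has_pd i g x (g' x)) \<Longrightarrow> pd_bd i M L U g' \<Longrightarrow> (\<And>x. x \<in> U \<Longrightarrow> 1 / (2 * n) \<le> \<bar>g' x\<bar>) \<Longrightarrow>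
     pd_bd i M K UNIV \<beta> \<Longrightarrow> (\<And>x. x \<notin> cball p \<rho> \<Longrightarrow> \<beta> x = 0) \<Longrightarrow> 0 < \<mu> \<Longrightarrow>
     norm (\<integral>x. cis (\<mu> * g x) * \<beta> x \<partial>lborel) \<le> C * K / \<mu> ^ M"
    using nonstationary_bound[OF pos, where M=M and ?'n='n] by blast
  show ?thesis
  proof (rule that[of A C])
    show "0 < A" "0 \<le> C" using A C by auto
    fix P :: "'n list \<Rightarrow> real^'n \<Rightarrow> real" and u \<delta> \<rho> K\<beta> and \<tau> :: real and y :: "real^'n" and \<beta> :: "real^'n \<Rightarrow> complex"
    assume *: "jet (Suc M) K (ball u \<delta>) P" "\<rho> < \<delta>" "\<rho> \<le> 1"
     "\<And>i. pd_bd i M K\<beta> UNIV \<beta>" "\<And>x. x \<notin> cball u \<rho> \<Longrightarrow> \<beta> x = 0" "y \<noteq> 0" "A * \<bar>\<tau>\<bar> \<le> norm y"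
    obtain i where i: "norm y \<le> n * \<bar>y $ i\<bar>" using exists_large_component n_def by blast
    define s where "s = \<tau> / norm y"
    have s: "A * \<bar>s\<bar> \<le> 1" using *(6,7) by (simp add: s_def abs_divide field_simps)
    then have s1: "\<bar>s\<bar> \<le> 1" using mult_right_mono[OF A abs_ge_zero[of s]] by simp
    define g where "g x = s * P [] x + (y /\<^sub>R norm y) \<bullet> x" for x
    define g' where "g' x = s *\<^sub>R P [i] x + y $ i / norm y" for x
    have "norm (\<integral>x. cis (norm y * g x) * \<beta> x \<partial>lborel) \<le> C * K\<beta> / norm y ^ M"
    proof (rule C(2)[of "ball u \<delta>" u \<rho> g i g'])
      show "cball u \<rho> \<subseteq> ball u \<delta>" using * by auto
      show "continuous_on (ball u \<delta>) g" unfolding g_def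
        by (intro continuous_intros jet_cont[OF *(1)]) auto
      show "pd_bd i M L (ball u \<delta>) g'" unfolding g'_def L_def
        using s1 K component_le_norm_cart[of y i]
        by (intro pd_bd_add pd_bd_scaleR pd_bd_const jet_imp_pd_bd[OF *(1)]) (auto simp: divide_le_eq_1)
      fix x assume x: "x \<in> ball u \<delta>"
      have "has_pd i (\<lambda>x. s * P [] x) x (s * P [i] x)"
        using has_pd_linear[OF bounded_linear_mult_right jet_has_pd[OF *(1) _ x]] by simp
      from has_pd_add[OF this has_pd_inner_left[of i "y /\<^sub>R norm y" x]]
      show "has_pd i g x (g' x)"
        by (simp add: g_def[abs_def] g'_def divide_inverse mult.commute)
      have "\<bar>s * P [i] x\<bar> \<le> \<bar>s\<bar> * K"
        using jet_norm[OF *(1) _ x, of "[i]"] by (simp add: abs_mult mult_left_mono)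
      also have "\<dots> \<le> 1 / (2 * n)"
      proof -
        have "2 * n * (\<bar>s\<bar> * K) \<le> A * \<bar>s\<bar>" by (simp add: A_def algebra_simps)
        then show ?thesis using s n by (simp add: field_simps)
      qed
      finally have 1: "\<bar>s * P [i] x\<bar> \<le> 1 / (2 * n)" .
      have "1 / n \<le> \<bar>y $ i / norm y\<bar>" using i *(6) n by (simp add: field_simps)
      moreover have "1 / n = 2 * (1 / (2 * n))" by simp
      ultimately show "1 / (2 * n) \<le> \<bar>g' x\<bar>" using 1 unfolding g'_def real_scaleR_def by linarith
    qed (use * in auto)
    moreover have "norm y * g x = \<tau> * P [] x + y \<bullet> x" for x
      using *(6) by (simp add: g_def s_def field_simps)
    ultimately show "norm (\<integral>x. cis (\<tau> * P [] x + y \<bullet> x) * \<beta> x \<partial>lborel) \<le> C * K\<beta> / norm y ^ M"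
      by simp
  qed
qed

text \<open>The opposite extreme: the phase is divided by \<open>\<bar>\<tau>\<bar>\<close>. Of the
  lower bound \<open>d\<close> at the centre, at most half is lost to the variation of the
  derivative over the ball and a quarter to the linear part.\<close>

lemma nonstationary_phase_dominates:
  fixes M :: nat
  assumes K: "0 \<le> K" and d: "0 < d"
  obtains C where "0 \<le> C" "\<And>(P::'n::finite list \<Rightarrow> real^'n \<Rightarrow> real) u \<delta> \<rho> \<beta> K\<beta> \<tau> y.
     jet (Suc (Suc M)) K (ball u \<delta>) P \<Longrightarrow> \<exists>i. d \<le> \<bar>P [i] u\<bar> \<Longrightarrow> 0 \<le> \<rho> \<Longrightarrow> \<rho> < \<delta> \<Longrightarrow> \<rho> \<le> 1 \<Longrightarrow>
     K * (real CARD('n) * \<delta>) \<le> d / 2 \<Longrightarrow>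
     (\<And>i. pd_bd i M K\<beta> UNIV \<beta>) \<Longrightarrow> (\<And>x. x \<notin> cball u \<rho> \<Longrightarrow> \<beta> x = 0) \<Longrightarrow>
     \<tau> \<noteq> 0 \<Longrightarrow> norm y \<le> d / 4 * \<bar>\<tau>\<bar> \<Longrightarrow>
     norm (\<integral>x. cis (\<tau> * P [] x + y \<bullet> x) * \<beta> x \<partial>lborel) \<le> C * K\<beta> / \<bar>\<tau>\<bar> ^ M"
proof -
  define L where "L = 2 ^ M * (1 * K) + d"
  have pos: "0 < d / 4" "0 \<le> L" using d K by (auto simp: L_def)
  obtain C where C: "0 \<le> C" "\<And>i U (p::real^'n) \<rho> g g' \<beta> \<mu> K.
     open U \<Longrightarrow> cball p \<rho> \<subseteq> U \<Longrightarrow> \<rho> \<le> 1 \<Longrightarrow> continuous_on U g \<Longrightarrow>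
     (\<And>x. x \<in> U \<Longrightarrow> has_pd i g x (g' x)) \<Longrightarrow> pd_bd i M L U g' \<Longrightarrow> (\<And>x. x \<in> U \<Longrightarrow> d / 4 \<le> \<bar>g' x\<bar>) \<Longrightarrow>
     pd_bd i M K UNIV \<beta> \<Longrightarrow> (\<And>x. x \<notin> cball p \<rho> \<Longrightarrow> \<beta> x = 0) \<Longrightarrow> 0 < \<mu> \<Longrightarrow>
     norm (\<integral>x. cis (\<mu> * g x) * \<beta> x \<partial>lborel) \<le> C * K / \<mu> ^ M"
    using nonstationary_bound[OF pos, where M=M and ?'n='n] by blast
  show ?thesis
  proof (rule that[of C])
    show "0 \<le> C" using C by auto
    fix P :: "'n list \<Rightarrow> real^'n \<Rightarrow> real" and u \<delta> \<rho> K\<beta> and \<tau> :: real and y :: "real^'n" and \<beta> :: "real^'n \<Rightarrow> complex"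
    assume *: "jet (Suc (Suc M)) K (ball u \<delta>) P" "\<exists>i. d \<le> \<bar>P [i] u\<bar>" "0 \<le> \<rho>" "\<rho> < \<delta>" "\<rho> \<le> 1"
     "K * (real CARD('n) * \<delta>) \<le> d / 2"
     "\<And>i. pd_bd i M K\<beta> UNIV \<beta>" "\<And>x. x \<notin> cball u \<rho> \<Longrightarrow> \<beta> x = 0" "\<tau> \<noteq> 0" "norm y \<le> d / 4 * \<bar>\<tau>\<bar>"
    obtain i where i: "d \<le> \<bar>P [i] u\<bar>" using * by blast
    define g where "g x = sgn \<tau> * P [] x + (y /\<^sub>R \<bar>\<tau>\<bar>) \<bullet> x" for x
    define g' where "g' x = sgn \<tau> *\<^sub>R P [i] x + y $ i / \<bar>\<tau>\<bar>" for x
    have yi: "\<bar>y $ i / \<bar>\<tau>\<bar>\<bar> \<le> d / 4"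
    proof -
      have "\<bar>y $ i\<bar> \<le> d / 4 * \<bar>\<tau>\<bar>" using component_le_norm_cart[of y i] *(10) by linarith
      then show ?thesis using *(9) by (simp add: abs_divide field_simps)
    qed
    have sg: "\<bar>sgn \<tau>\<bar> = 1" using *(9) by (simp add: abs_sgn_eq)
    have "norm (\<integral>x. cis (\<bar>\<tau>\<bar> * g x) * \<beta> x \<partial>lborel) \<le> C * K\<beta> / \<bar>\<tau>\<bar> ^ M"
    proof (rule C(2)[of "ball u \<delta>" u \<rho> g i g'])
      show "cball u \<rho> \<subseteq> ball u \<delta>" using * by auto
      show "continuous_on (ball u \<delta>) g" unfolding g_def
        by (intro continuous_intros jet_cont[OF *(1)]) auto
      show "pd_bd i M L (ball u \<delta>) g'" unfolding g'_def L_def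
        using sg K order_trans[OF yi, of d] d
        by (intro pd_bd_add pd_bd_scaleR pd_bd_const jet_imp_pd_bd[OF *(1)]) auto
      fix x assume x: "x \<in> ball u \<delta>"
      have "has_pd i (\<lambda>x. sgn \<tau> * P [] x) x (sgn \<tau> * P [i] x)"
        using has_pd_linear[OF bounded_linear_mult_right jet_has_pd[OF *(1) _ x]] by simp
      from has_pd_add[OF this has_pd_inner_left[of i "y /\<^sub>R \<bar>\<tau>\<bar>" x]]
      show "has_pd i g x (g' x)"
        by (simp add: g_def[abs_def] g'_def divide_inverse mult.commute)
      have "\<bar>P [i] ((x - u) + u) - P [i] u\<bar> \<le> K * (real CARD('n) * norm (x - u))"
        using x by (intro jet_lipschitz[OF *(1)]) (auto simp: subset_iff dist_norm norm_minus_commute)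
      also have "\<dots> \<le> K * (real CARD('n) * \<delta>)"
        using x K by (intro mult_left_mono) (auto simp: dist_norm norm_minus_commute)
      finally have "d / 2 \<le> \<bar>P [i] x\<bar>" using *(6) i by simp
      then have "d / 2 \<le> \<bar>sgn \<tau> *\<^sub>R P [i] x\<bar>" using sg by (simp add: abs_mult)
      then show "d / 4 \<le> \<bar>g' x\<bar>" using yi unfolding g'_def by linarith
    qed (use * in auto)
    moreover have "\<bar>\<tau>\<bar> * g x = \<tau> * P [] x + y \<bullet> x" for x
    proof -
      have "\<bar>\<tau>\<bar> * g x = (\<bar>\<tau>\<bar> * sgn \<tau>) * P [] x + (\<bar>\<tau>\<bar> * inverse \<bar>\<tau>\<bar>) * (y \<bullet> x)"
        by (simp add: g_def distrib_left mult.assoc)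
      then show ?thesis using *(9) by (simp add: abs_mult_sgn)
    qed
    ultimately show "norm (\<integral>x. cis (\<tau> * P [] x + y \<bullet> x) * \<beta> x \<partial>lborel) \<le> C * K\<beta> / \<bar>\<tau>\<bar> ^ M"
      by simp
  qed
qed

text \<open>The square is expanded as a double integral and one variable is translated by the other;
  integrability of \<open>F\<close> justifies the exchange. The gain is that a linear phase in
  \<open>F\<close> contributes to the inner integral only a constant of modulus 1.\<close>

lemma norm_integral_sq_le_autocorrelation:
  fixes F :: "real^'n::finite \<Rightarrow> complex"
  assumes F: "continuous_on UNIV F" and S: "\<And>x. x \<notin> cball u \<rho> \<Longrightarrow> F x = 0"
  shows "ennreal ((norm (\<integral>x. F x \<partial>lborel))\<^sup>2)
     \<le> (\<integral>\<^sup>+h. ennreal (norm (\<integral>x. F (h + x) * cnj (F x) \<partial>lborel)) \<partial>lborel)"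
proof -
  have intF: "integrable lborel F"
    using F S by (intro integrable_compact_support[of F "cball u \<rho>"]) auto
  have [measurable]: "F \<in> borel_measurable borel"
    using F by (rule borel_measurable_continuous_onI)
  have [measurable]: "(\<lambda>x. cnj (F x)) \<in> borel_measurable borel"
    using F by (intro borel_measurable_continuous_onI continuous_intros)
  have fin: "(\<integral>\<^sup>+x. ennreal (norm (F x)) \<partial>lborel) < \<infinity>"
    using intF by (simp add: integrable_iff_bounded)
  have tr: "(\<integral>\<^sup>+h. ennreal (norm (F (h + x))) \<partial>lborel) = (\<integral>\<^sup>+h. ennreal (norm (F h)) \<partial>lborel)" for x
  proof -
    have "(\<integral>\<^sup>+h. ennreal (norm (F h)) \<partial>lborel) = (\<integral>\<^sup>+h. ennreal (norm (F h)) \<partial>(distr lborel borel ((+) x)))"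
      by (subst lborel_distr_plus) simp
    also have "\<dots> = (\<integral>\<^sup>+h. ennreal (norm (F (x + h))) \<partial>lborel)"
      by (subst nn_integral_distr) auto
    finally show ?thesis by (simp add: add.commute)
  qed
  have fin2: "(\<integral>\<^sup>+x. \<integral>\<^sup>+h. ennreal (norm (F (h + x) * cnj (F x))) \<partial>lborel \<partial>lborel) < \<infinity>"
  proof -
    have "(\<integral>\<^sup>+x. \<integral>\<^sup>+h. ennreal (norm (F (h + x) * cnj (F x))) \<partial>lborel \<partial>lborel)
        = (\<integral>\<^sup>+x. (\<integral>\<^sup>+h. ennreal (norm (F (h + x))) \<partial>lborel) * ennreal (norm (F x)) \<partial>lborel)"
      by (intro nn_integral_cong) (simp add: norm_mult ennreal_mult nn_integral_multc)
    also have "\<dots> = (\<integral>\<^sup>+h. ennreal (norm (F h)) \<partial>lborel) * (\<integral>\<^sup>+x. ennreal (norm (F x)) \<partial>lborel)"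
      unfolding tr by (subst nn_integral_cmult) auto
    also have "\<dots> < \<infinity>" using fin by (simp add: ennreal_mult_less_top)
    finally show ?thesis .
  qed
  have "(\<lambda>(x, h). F (h + x) * cnj (F x)) \<in> borel_measurable (lborel \<Otimes>\<^sub>M lborel)" by measurable
  note fub = lborel_Fubini[OF this fin2]
  have "(\<integral>h. \<integral>x. F (h + x) * cnj (F x) \<partial>lborel \<partial>lborel) = (\<integral>x. \<integral>h. F (h + x) * cnj (F x) \<partial>lborel \<partial>lborel)"
    by (rule fub(1))
  also have "\<dots> = (\<integral>x. (\<integral>h. F h \<partial>lborel) * cnj (F x) \<partial>lborel)"
    using lborel_integral_translate[of F] by (simp add: add.commute)
  also have "\<dots> = (\<integral>h. F h \<partial>lborel) * cnj (\<integral>x. F x \<partial>lborel)"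
    by simp
  finally have "norm (\<integral>h. \<integral>x. F (h + x) * cnj (F x) \<partial>lborel \<partial>lborel) = (norm (\<integral>x. F x \<partial>lborel))\<^sup>2"
    by (simp add: norm_mult power2_eq_square)
  with integral_norm_bound_ennreal[OF fub(3)] show ?thesis by simp
qed

lemma norm_integral_le_cball:
  fixes f :: "real^'n::finite \<Rightarrow> complex"
  assumes "\<And>x. x \<notin> cball u \<rho> \<Longrightarrow> f x = 0" "\<And>x. norm (f x) \<le> B" "\<rho> \<le> 1"
  shows "norm (\<integral>x. f x \<partial>lborel) \<le> unit_ball_vol CARD('n) * B"
proof (cases "integrable lborel f")
  case True
  have B: "0 \<le> B" using assms(2)[of 0] norm_ge_zero order_trans by blast
  have "ennreal (norm (\<integral>x. f x \<partial>lborel)) \<le> (\<integral>\<^sup>+x. ennreal (norm (f x)) \<partial>lborel)"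
    using True by (rule integral_norm_bound_ennreal)
  also have "\<dots> \<le> (\<integral>\<^sup>+x. ennreal B * indicator (cball u 1) x \<partial>lborel)"
  proof (rule nn_integral_mono)
    fix x
    show "ennreal (norm (f x)) \<le> ennreal B * indicator (cball u 1) x"
      using assms by (cases "x \<in> cball u 1") (auto intro!: ennreal_leI)
  qed
  also have "\<dots> = ennreal B * ennreal (unit_ball_vol CARD('n))"
    by (subst nn_integral_cmult_indicator) (auto simp: emeasure_lborel_cball_real_n)
  also have "\<dots> = ennreal (unit_ball_vol CARD('n) * B)"
    using B by (simp add: ennreal_mult'[symmetric] mult.commute)
  finally show ?thesis using B by (simp add: ennreal_le_iff)
next
  \<comment> \<open>A non-integrable function has integral 0 by default.\<close>
  case False
  have "0 \<le> B" using assms(2)[of 0] norm_ge_zero order_trans by blast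
  with False show ?thesis by (simp add: not_integrable_integral_eq)
qed

text \<open>The linear form \<open>y\<close> enters no constant, since the autocorrelation keeps of
  it only the factor \<open>cis (y \<bullet> h)\<close>. The remaining phase has a derivative of
  size at least a multiple of |tau| |h|, because the Hessian is nondegenerate at the centre and
  varies little over the ball of radius \<open>8 * r\<close>.\<close>

lemma stationary_bound:
  assumes K: "0 \<le> K" and c: "0 < c"
  obtains C where "0 \<le> C" "\<And>(P::'n::finite list \<Rightarrow> real^'n \<Rightarrow> real) u r \<beta> K\<beta> \<tau> y.
     jet (CARD('n) + 3) K (ball u (8 * r)) P \<Longrightarrow> (\<And>h. \<exists>i. c * norm h \<le> \<bar>\<Sum>l\<in>UNIV. h $ l * P [l, i] u\<bar>) \<Longrightarrow>
     0 < r \<Longrightarrow> 8 * r \<le> 1 \<Longrightarrow> K * (real CARD('n) * (8 * r)) * real CARD('n) \<le> c / 2 \<Longrightarrow>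
     (\<And>i. pd_bd i (Suc CARD('n)) K\<beta> UNIV \<beta>) \<Longrightarrow> (\<And>x. x \<notin> cball u (2 * r) \<Longrightarrow> \<beta> x = 0) \<Longrightarrow> \<tau> \<noteq> 0 \<Longrightarrow>
     norm (\<integral>x. cis (\<tau> * P [] x + y \<bullet> x) * \<beta> x \<partial>lborel) \<le> C * K\<beta> * \<bar>\<tau>\<bar> powr (- real CARD('n) / 2)"
proof -
  define n where "n = real CARD('n)"
  have n: "1 \<le> n" by (simp add: n_def Suc_leI)
  \<comment> \<open>n + 1 is the first integer order of decay in \<open>h\<close> that is integrable
    at infinity.\<close>
  define M where "M = Suc CARD('n)"
  have Mn: "real M = n + 1" by (simp add: M_def n_def)
  define V where "V = unit_ball_vol n"
  have V: "0 \<le> V" by (simp add: V_def n_def)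
  have pos: "0 < c / 2" "0 \<le> K * n" using c K n by auto
  obtain C where C: "0 \<le> C" "\<And>i U (p::real^'n) \<rho> g g' \<beta> (\<mu>::real) K'.
     open U \<Longrightarrow> cball p \<rho> \<subseteq> U \<Longrightarrow> \<rho> \<le> 1 \<Longrightarrow> continuous_on U g \<Longrightarrow>
     (\<And>x. x \<in> U \<Longrightarrow> has_pd i g x (g' x)) \<Longrightarrow> pd_bd i M (K * n) U g' \<Longrightarrow> (\<And>x. x \<in> U \<Longrightarrow> c / 2 \<le> \<bar>g' x\<bar>) \<Longrightarrow>
     pd_bd i M K' UNIV \<beta> \<Longrightarrow> (\<And>x. x \<notin> cball p \<rho> \<Longrightarrow> \<beta> x = 0) \<Longrightarrow> 0 < \<mu> \<Longrightarrow>
     norm (\<integral>x. cis (\<mu> * g x) * \<beta> x \<partial>lborel) \<le> C * K' / \<mu> ^ M"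
    using nonstationary_bound[OF pos, where M=M and ?'n='n] by blast
  have "- n - 1 < - real CARD('n)" by (simp add: n_def)
  then obtain C3 where C3: "0 \<le> C3" "\<And>R. 0 < R \<Longrightarrow>
    radial_mass (- n - 1) ({c. R \<le> norm c} :: (real^'n) set)
      \<le> ennreal (C3 * R powr (- n - 1 + CARD('n)))"
    using nn_integral_norm_powr_outside by blast
  \<comment> \<open>The two terms come from the ball |h| <= 1 / |tau|, estimated trivially, and from
    its exterior, estimated by non-stationary phase.\<close>
  define Q where "Q = V * V + C * 2 ^ M * C3"
  have Q: "0 \<le> Q" using V C C3 by (auto simp: Q_def)
  show ?thesis
  proof (rule that[of "sqrt Q"])
    show "0 \<le> sqrt Q" using Q by simp
    fix P :: "'n list \<Rightarrow> real^'n \<Rightarrow> real" and u r K\<beta> and \<tau> :: real and y :: "real^'n" and \<beta> :: "real^'n \<Rightarrow> complex"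
    assume *: "jet (CARD('n) + 3) K (ball u (8 * r)) P"
      "\<And>h. \<exists>i. c * norm h \<le> \<bar>\<Sum>l\<in>UNIV. h $ l * P [l, i] u\<bar>"
      "0 < r" "8 * r \<le> 1" "K * (real CARD('n) * (8 * r)) * real CARD('n) \<le> c / 2"
      "\<And>i. pd_bd i (Suc CARD('n)) K\<beta> UNIV \<beta>" "\<And>x. x \<notin> cball u (2 * r) \<Longrightarrow> \<beta> x = 0" "\<tau> \<noteq> 0"
    let ?S = "cball u (2 * r)"
    have K\<beta>: "norm (\<beta> x) \<le> K\<beta>" for x using pd_bd_norm[OF *(6)] by auto
    then have K\<beta>0: "0 \<le> K\<beta>" using norm_ge_zero order_trans by blast
    define F where "F x = cis (\<tau> * P [] x + y \<bullet> x) * \<beta> x" for x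
    have F0: "F x = 0" if "x \<notin> ?S" for x using *(7)[OF that] by (simp add: F_def)
    have Fcont: "continuous_on UNIV F"
    proof (rule continuous_on_zero_extend[of "ball u (8 * r)" F ?S])
      show "continuous_on (ball u (8 * r)) F" unfolding F_def
        using pd_bd_cont[OF *(6)] by (intro continuous_intros jet_cont[OF *(1)])
          (auto intro: continuous_on_subset)
      show "?S \<subseteq> ball u (8 * r)" using *(3) by auto
    qed (use F0 in auto)
    define G where "G h = (\<integral>x. F (h + x) * cnj (F x) \<partial>lborel)" for h
    have triv: "norm (G h) \<le> V * (K\<beta> * K\<beta>)" for h
      unfolding G_def V_def n_def
    proof (rule norm_integral_le_cball[of u "2 * r"])
      fix x
      show "norm (F (h + x) * cnj (F x)) \<le> K\<beta> * K\<beta>"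
        using K\<beta> K\<beta>0 by (auto simp: norm_mult F_def intro: mult_mono)
    qed (use * F0 in auto)
    have decay: "norm (G h) \<le> C * (2 ^ M * (K\<beta> * K\<beta>)) / (\<bar>\<tau>\<bar> * norm h) ^ M" if h: "h \<noteq> 0" for h
    proof (cases "norm h \<le> 4 * r")
      \<comment> \<open>For |h| > 4 r the supports of \<open>F\<close> and of its translate are
        disjoint.\<close>
      case False
      have "F (h + x) * cnj (F x) = 0" for x
      proof (cases "x \<in> ?S")
        case True
        have "norm h \<le> norm (h + x - u) + norm (u - x)"
          using norm_triangle_ineq[of "h + x - u" "u - x"] by simp
        then have "h + x \<notin> ?S"
          using False True by (auto simp: dist_norm norm_minus_commute)
        then show ?thesis by (simp add: F0)
      qed (simp add: F0)
      then have "(\<lambda>x. F (h + x) * cnj (F x)) = (\<lambda>x. 0)" by (rule ext)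
      then have "G h = 0" by (simp only: G_def integral_zero)
      then show ?thesis using C K\<beta>0 by simp
    next
      case True
      \<comment> \<open>Around a point of \<open>?U\<close> the ball of radius |h| <= 4 r stays
        within distance \<open>7 * r\<close> of \<open>u\<close>, hence inside the domain of the
        jet.\<close>
      let ?U = "ball u (3 * r)"
      have sub: "cball x (norm h) \<subseteq> ball u (7 * r)" if "x \<in> ?U" for x
      proof
        fix z assume "z \<in> cball x (norm h)"
        then show "z \<in> ball u (7 * r)"
          using that True dist_triangle[of u z x] by auto
      qed
      have sub8: "cball x (norm h) \<subseteq> ball u (8 * r)" if "x \<in> ?U" for x
        using sub[OF that] *(3) by (auto simp: subset_iff)
      obtain i where i: "c * norm h \<le> \<bar>\<Sum>l\<in>UNIV. h $ l * P [l, i] u\<bar>" using *(2) by blast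
      \<comment> \<open>The phase of \<open>F (h + x) * cnj (F x)\<close> divided by |tau| |h|; the
        contribution of \<open>y\<close> is constant in \<open>x\<close> and goes into the amplitude
        \<open>b\<close>.\<close>
      define g where "g x = sgn \<tau> * ((P [] (h + x) - P [] x) / norm h)" for x
      define g' where "g' x = sgn \<tau> * ((P [i] (h + x) - P [i] x) / norm h)" for x
      define b where "b x = (cis (y \<bullet> h) * \<beta> (h + x)) * cnj (\<beta> x)" for x
      have sg: "\<bar>sgn \<tau>\<bar> = 1" using *(8) by (simp add: abs_sgn_eq)
      have mem: "h + x \<in> ball u (8 * r)" "x \<in> ball u (8 * r)" if "x \<in> ?U" for x
        using sub8[OF that] by (auto simp: subset_iff dist_norm)
      have "norm (\<integral>x. cis (\<bar>\<tau>\<bar> * norm h * g x) * b x \<partial>lborel) \<le> C * (2 ^ M * (K\<beta> * K\<beta>)) / (\<bar>\<tau>\<bar> * norm h) ^ M"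
      proof (rule C(2)[of ?U u "2 * r" g i g'])
        have "continuous_on ?U (\<lambda>x. P [] (h + x))"
        proof (rule continuous_on_compose2[OF jet_cont[OF *(1)]])
          show "(\<lambda>x. h + x) ` ?U \<subseteq> ball u (8 * r)" by (intro image_subsetI mem(1))
        qed (auto intro!: continuous_intros)
        moreover have "continuous_on ?U (P [])"
          using jet_cont[OF *(1), of "[]"] mem(2) by (auto intro: continuous_on_subset)
        ultimately show "continuous_on ?U g" unfolding g_def
          using h by (intro continuous_intros) auto
        \<comment> \<open>One order for the component \<open>[i]\<close>, n + 1 for the integrations
          by parts and one for the difference quotient exhaust the order n + 3 of the jet.\<close>
        show "pd_bd i M (K * n) ?U g'" unfolding g'_def n_def
          using sg by (intro pd_bd_linear[OF bounded_linear_mult_right] jet_diff_quotient[OF *(1) sub8 h])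
            (auto simp: abs_mult M_def)
        show "pd_bd i M (2 ^ M * (K\<beta> * K\<beta>)) UNIV b" unfolding b_def
        proof (rule pd_bd_mult[OF K\<beta>0 K\<beta>0])
          show "pd_bd i M K\<beta> UNIV (\<lambda>x. cnj (\<beta> x))"
            using *(6) unfolding M_def by (intro pd_bd_linear[OF bounded_linear_cnj]) auto
          show "pd_bd i M K\<beta> UNIV (\<lambda>x. cis (y \<bullet> h) * \<beta> (h + x))"
            using *(6) unfolding M_def by (intro pd_bd_linear[OF bounded_linear_mult_right]
                pd_bd_translate[of i _ K\<beta> UNIV]) (auto simp: norm_mult)
        qed
        fix x assume x: "x \<in> ?U"
        have "has_pd i (\<lambda>x. P [] (h + x)) x (P [i] (h + x))"
          using has_pd_affine[of i "P []" h 1 x "P [i] (h + x)"]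
            jet_has_pd[OF *(1), of "[]" "h + x" i] mem[OF x] by simp
        then have "has_pd i (\<lambda>x. P [] (h + x) - P [] x) x (P [i] (h + x) - P [i] x)"
          using jet_has_pd[OF *(1)] mem[OF x] by (intro has_pd_diff) auto
        from has_pd_linear[OF bounded_linear_mult_right has_pd_linear[OF bounded_linear_divide this]]
        show "has_pd i g x (g' x)" by (simp add: g_def[abs_def] g'_def)
        \<comment> \<open>First-order expansion along \<open>h\<close> with the second derivatives
          frozen at \<open>u\<close>. By the smallness of \<open>r\<close> the error is at most half
          of the lower bound supplied by the Hessian.\<close>
        have "\<bar>P [i] (h + x) - P [i] x - (\<Sum>l\<in>UNIV. h $ l * P [l, i] u)\<bar>
            \<le> (K * (real CARD('n) * (8 * r))) * (real CARD('n) * norm h)"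
        proof (rule pd_increment[where D="\<lambda>l. P [l, i]"])
          fix l z assume z: "z \<in> cball x (norm h)"
          then show "has_pd l (P [i]) z (P [l, i] z)"
            using sub8[OF x] by (intro jet_has_pd[OF *(1)]) auto
          have z7: "z \<in> ball u (7 * r)" using sub[OF x] z by auto
          have "\<bar>P [l, i] ((z - u) + u) - P [l, i] u\<bar> \<le> K * (real CARD('n) * norm (z - u))"
          proof (rule jet_lipschitz[OF *(1)])
            show "cball u (norm (z - u)) \<subseteq> ball u (8 * r)"
              using z7 *(3) by (auto simp: dist_norm norm_minus_commute)
          qed auto
          also have "\<dots> \<le> K * (real CARD('n) * (8 * r))"
            using z7 K *(3) by (intro mult_left_mono) (auto simp: dist_norm norm_minus_commute)
          finally show "\<bar>P [l, i] z - P [l, i] u\<bar> \<le> K * (real CARD('n) * (8 * r))" by simp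
        qed
        also have "\<dots> = (K * (real CARD('n) * (8 * r)) * real CARD('n)) * norm h" by simp
        also have "\<dots> \<le> c / 2 * norm h" using *(5) by (intro mult_right_mono) auto
        finally have "\<bar>P [i] (h + x) - P [i] x - (\<Sum>l\<in>UNIV. h $ l * P [l, i] u)\<bar> \<le> (c * norm h) / 2"
          by simp
        moreover have "e / 2 \<le> \<bar>a\<bar>" if "\<bar>a - b\<bar> \<le> e / 2" "e \<le> \<bar>b\<bar>" for a b e :: real
          using that by linarith
        ultimately have "(c * norm h) / 2 \<le> \<bar>P [i] (h + x) - P [i] x\<bar>" using i by blast
        moreover have "\<bar>g' x\<bar> = \<bar>P [i] (h + x) - P [i] x\<bar> / norm h"
          unfolding g'_def abs_mult sg by simp
        ultimately show "c / 2 \<le> \<bar>g' x\<bar>" using h by (simp add: pos_le_divide_eq)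
      next
        fix x assume "x \<notin> ?S"
        then show "b x = 0" using *(7) by (simp add: b_def)
      qed (use * h in auto)
      also have "(\<lambda>x. cis (\<bar>\<tau>\<bar> * norm h * g x) * b x) = (\<lambda>x. F (h + x) * cnj (F x))"
      proof
        fix x
        have "\<bar>\<tau>\<bar> * norm h * g x = \<tau> * (P [] (h + x) - P [] x)"
          using h by (simp add: g_def) (simp add: abs_mult_sgn mult.assoc[symmetric])
        moreover have "cis (\<tau> * (P [] (h + x) - P [] x)) * cis (y \<bullet> h)
            = cis (\<tau> * P [] (h + x) + y \<bullet> (h + x)) * cnj (cis (\<tau> * P [] x + y \<bullet> x))"
          by (simp add: cis_cnj cis_mult inner_add_right algebra_simps)
        ultimately show "cis (\<bar>\<tau>\<bar> * norm h * g x) * b x = F (h + x) * cnj (F x)"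
          by (simp add: b_def F_def)
      qed
      finally show ?thesis by (simp add: G_def)
    qed
    \<comment> \<open>At |h| = 1 / |tau| the trivial bound and the decaying one have the same
      order.\<close>
    define R where "R = 1 / \<bar>\<tau>\<bar>"
    have R: "0 < R" using *(8) by (simp add: R_def)
    define D where "D = C * (2 ^ M * (K\<beta> * K\<beta>)) * R powr (n + 1)"
    have D: "0 \<le> D" using C K\<beta>0 by (simp add: D_def)
    have "ennreal ((norm (\<integral>x. F x \<partial>lborel))\<^sup>2) \<le> (\<integral>\<^sup>+h. ennreal (norm (G h)) \<partial>lborel)"
      unfolding G_def using Fcont F0 by (rule norm_integral_sq_le_autocorrelation)
    also have "\<dots> \<le> (\<integral>\<^sup>+h. ennreal (V * (K\<beta> * K\<beta>)) * indicator (cball 0 R) (h::real^'n)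
        + ennreal D * (ennreal (norm h powr (- n - 1)) * indicator {h. R \<le> norm h} h) \<partial>lborel)"
    proof (rule nn_integral_mono)
      fix h :: "real^'n"
      show "ennreal (norm (G h)) \<le> ennreal (V * (K\<beta> * K\<beta>)) * indicator (cball 0 R) h
        + ennreal D * (ennreal (norm h powr (- n - 1)) * indicator {h. R \<le> norm h} h)"
      proof (cases "norm h \<le> R")
        case True
        then show ?thesis using triv[of h] by (intro order_trans[OF _ add_increasing2[OF _ order_refl]])
          (auto intro: ennreal_leI)
      next
        case False
        then have h: "h \<noteq> 0" "R \<le> norm h" using R by auto
        have "norm (G h) \<le> D * norm h powr (- n - 1)"
        proof -
          have "(\<bar>\<tau>\<bar> * norm h) ^ M = \<bar>\<tau>\<bar> powr (n + 1) * norm h powr (n + 1)"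
            using h *(8) by (simp add: power_mult_distrib powr_realpow[symmetric] Mn)
          then show ?thesis
            using decay[OF h(1)] h *(8)
            by (simp add: D_def R_def powr_divide powr_minus_divide powr_diff powr_add field_simps)
        qed
        then show ?thesis using h D False
          by (simp add: ennreal_mult[symmetric] ennreal_leI)
      qed
    qed
    also have "\<dots> = ennreal (V * (K\<beta> * K\<beta>)) * emeasure lborel (cball (0::real^'n) R)
        + ennreal D * (\<integral>\<^sup>+h. ennreal (norm h powr (- n - 1)) * indicator {h. R \<le> norm h} (h::real^'n) \<partial>lborel)"
    proof -
      have m1: "(\<lambda>h::real^'n. ennreal (norm h powr (- n - 1)) * indicator {h. R \<le> norm h} h) \<in> borel_measurable lborel"
        by measurable
      have m2: "(\<lambda>h::real^'n. ennreal (V * (K\<beta> * K\<beta>)) * indicator (cball 0 R) h) \<in> borel_measurable lborel"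
        by (rule borel_measurable_times_ennreal[OF borel_measurable_const borel_measurable_indicator]) simp
      show ?thesis
        using m1 m2 by (simp add: nn_integral_add nn_integral_cmult nn_integral_cmult_indicator)
    qed
    also have "\<dots> \<le> ennreal (V * (K\<beta> * K\<beta>)) * ennreal (V * R powr n) + ennreal D * ennreal (C3 * R powr -1)"
      using R C3(2)[OF R] by (intro add_mono mult_left_mono)
        (auto simp: emeasure_lborel_cball_real_n V_def n_def)
    also have "\<dots> = ennreal (V * (K\<beta> * K\<beta>) * (V * R powr n) + D * (C3 * R powr -1))"
      using V K\<beta>0 D C3(1) by (simp add: ennreal_mult[symmetric] ennreal_plus[symmetric] del: ennreal_plus powr_neg_one)
    also have "V * (K\<beta> * K\<beta>) * (V * R powr n) + D * (C3 * R powr -1) = (sqrt Q * K\<beta> * \<bar>\<tau>\<bar> powr (- n / 2))\<^sup>2"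
    proof -
      have a: "R powr (n + 1) * R powr -1 = R powr n"
        by (subst powr_add[symmetric]) simp
      have "(\<bar>\<tau>\<bar> powr (- n / 2))\<^sup>2 = R powr n"
        using *(8) by (simp add: power2_eq_square powr_add[symmetric] R_def powr_divide powr_minus_divide)
      then have "(sqrt Q * K\<beta> * \<bar>\<tau>\<bar> powr (- n / 2))\<^sup>2 = Q * (K\<beta> * K\<beta>) * R powr n"
        using Q by (simp add: power_mult_distrib) (simp add: power2_eq_square)
      moreover have "Q * (K\<beta> * K\<beta>) * R powr n = V * (K\<beta> * K\<beta>) * (V * R powr n) + C * (2 ^ M * (K\<beta> * K\<beta>)) * C3 * R powr n"
        by (simp add: Q_def algebra_simps)
      moreover have "D * (C3 * R powr -1) = C * (2 ^ M * (K\<beta> * K\<beta>)) * C3 * (R powr (n + 1) * R powr -1)"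
        by (simp only: D_def mult_ac)
      ultimately show ?thesis unfolding a by presburger
    qed
    finally have "(norm (\<integral>x. F x \<partial>lborel))\<^sup>2 \<le> (sqrt Q * K\<beta> * \<bar>\<tau>\<bar> powr (- n / 2))\<^sup>2"
      by (simp add: ennreal_le_iff)
    then have "norm (\<integral>x. F x \<partial>lborel) \<le> sqrt Q * K\<beta> * \<bar>\<tau>\<bar> powr (- n / 2)"
      by (rule power2_le_imp_le) (use Q K\<beta>0 in simp)
    then show "norm (\<integral>x. cis (\<tau> * P [] x + y \<bullet> x) * \<beta> x \<partial>lborel) \<le> sqrt Q * K\<beta> * \<bar>\<tau>\<bar> powr (- real CARD('n) / 2)"
      by (simp add: F_def n_def)
  qed
qed

subsection \<open>Integrating the bounds over all frequencies\<close>

text \<open>The trivial, stationary and two non-stationary bounds (linear part or \<open>a\<close> dominating) for the piece at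
  frequency \<open>\<rho>\<close>, where \<open>T = \<bar>t\<bar>\<close> and \<open>X = norm x\<close>.\<close>
definition piece_bd :: "real \<Rightarrow> real \<Rightarrow> real \<Rightarrow> real \<Rightarrow> real \<Rightarrow> real \<Rightarrow> real \<Rightarrow> real \<Rightarrow> real \<Rightarrow> real \<Rightarrow> real \<Rightarrow> bool" where
  "piece_bd n m b M C A a0 T X \<rho> v \<longleftrightarrow> v \<le> C * \<rho> powr b \<and>
     v \<le> C * \<rho> powr b * (T * \<rho> powr m) powr (- n / 2) \<and>
     (A * (T * \<rho> powr m) \<le> X * \<rho> \<longrightarrow> v \<le> C * \<rho> powr b * (X * \<rho>) powr (- M)) \<and>
     (X * \<rho> \<le> a0 * (T * \<rho> powr m) \<longrightarrow> v \<le> C * \<rho> powr b * (T * \<rho> powr m) powr (- M))"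

section \<open>Balance frequencies and splittings of radial integrals\<close>

lemma powr_threshold:
  fixes x a m :: real
  assumes "1 < m" "0 < x" "0 \<le> a" "a powr (1 / (m - 1)) \<le> x"
  shows "a * x \<le> x powr m"
proof -
  have "(a powr (1 / (m - 1))) powr (m - 1) \<le> x powr (m - 1)"
    using assms by (intro powr_mono2) auto
  then have "a \<le> x powr (m - 1)" using assms by (simp add: powr_powr)
  then have "a * x \<le> x powr (m - 1) * x" using assms by (intro mult_right_mono) auto
  also have "\<dots> = x powr m" using assms by (simp add: powr_diff)
  finally show ?thesis .
qed

lemma powr_threshold':
  fixes x a m :: real
  assumes "1 < m" "0 < x" "0 \<le> a" "x \<le> a powr (1 / (m - 1))"
  shows "x powr m \<le> a * x"
proof -
  have "x powr (m - 1) \<le> (a powr (1 / (m - 1))) powr (m - 1)"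
    using assms by (intro powr_mono2) auto
  then have "x powr (m - 1) \<le> a" using assms by (simp add: powr_powr)
  then have "x powr (m - 1) * x \<le> a * x" using assms by (intro mult_right_mono) auto
  also have "x powr (m - 1) * x = x powr m" using assms by (simp add: powr_diff)
  finally show ?thesis .
qed

text \<open>The origin, about which the bounds for the pieces say nothing, is a null set.\<close>

lemma nn_integral_radial_split:
  fixes Y :: "real^'n::finite \<Rightarrow> real"
  assumes "\<And>c. c \<noteq> 0 \<Longrightarrow> Y c \<le> K1 * norm c powr p1 * indicator S1 c + K2 * norm c powr p2 * indicator S2 c"
    and "S1 \<in> sets borel" "S2 \<in> sets borel" "0 \<le> K1" "0 \<le> K2" "0 \<le> B1" "0 \<le> B2"
    and "radial_mass p1 (S1 :: (real^'n) set) \<le> ennreal B1"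
    and "radial_mass p2 (S2 :: (real^'n) set) \<le> ennreal B2"
  shows "nnint Y \<le> ennreal (K1 * B1 + K2 * B2)"
proof -
  have [measurable]: "S1 \<in> sets lborel" "S2 \<in> sets lborel" using assms by auto
  have AE: "AE c in lborel. ennreal (Y c) \<le> ennreal K1 * (ennreal (norm c powr p1) * indicator S1 c)
      + ennreal K2 * (ennreal (norm c powr p2) * indicator S2 c)"
    using AE_lborel_singleton[of "0::real^'n"]
  proof eventually_elim
    case (elim c)
    have "ennreal (Y c) \<le> ennreal (K1 * norm c powr p1 * indicator S1 c + K2 * norm c powr p2 * indicator S2 c)"
      using assms(1)[OF elim] by (rule ennreal_leI)
    also have "\<dots> = ennreal K1 * (ennreal (norm c powr p1) * indicator S1 c)
      + ennreal K2 * (ennreal (norm c powr p2) * indicator S2 c)"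
      using assms by (auto simp: indicator_def ennreal_mult)
    finally show ?case .
  qed
  have "nnint Y \<le> (\<integral>\<^sup>+c. ennreal K1 * (ennreal (norm c powr p1) * indicator S1 c)
      + ennreal K2 * (ennreal (norm c powr p2) * indicator S2 c) \<partial>(lborel :: (real^'n) measure))"
    using AE by (rule nn_integral_mono_AE)
  also have "\<dots> = ennreal K1 * radial_mass p1 (S1 :: (real^'n) set)
      + ennreal K2 * radial_mass p2 (S2 :: (real^'n) set)"
    by (simp add: nn_integral_add nn_integral_cmult)
  also have "\<dots> \<le> ennreal K1 * ennreal B1 + ennreal K2 * ennreal B2"
    using assms by (intro add_mono mult_left_mono) auto
  also have "\<dots> = ennreal (K1 * B1 + K2 * B2)"
    using assms by (simp add: ennreal_mult)
  finally show ?thesis .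
qed

text \<open>The integral is split at |c| = 1 / X, where the two hypotheses agree. The trivial bound
  is integrable at the origin because b > -n, the other one at infinity because M > n + b.\<close>

lemma nn_integral_linear_dominated:
  assumes "- real CARD('n) < b" "real CARD('n) + b < M" "0 \<le> K"
  obtains C where "0 \<le> C" "\<And>X (Y::real^'n::finite \<Rightarrow> real). 0 < X \<Longrightarrow>
     (\<And>c. c \<noteq> 0 \<Longrightarrow> Y c \<le> K * norm c powr b) \<Longrightarrow>
     (\<And>c. c \<noteq> 0 \<Longrightarrow> Y c \<le> K * norm c powr b * (X * norm c) powr (- M)) \<Longrightarrow>
     nnint Y \<le> ennreal (C * X powr (- (real CARD('n) + b)))"
proof -
  let ?n = "real CARD('n)"
  obtain C1 where C1: "0 \<le> C1" "\<And>R. 0 < R \<Longrightarrow>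
    radial_mass b ({c. norm c \<le> R} :: (real^'n) set) \<le> ennreal (C1 * R powr (b + ?n))"
    using nn_integral_norm_powr_cball[OF assms(1)] by blast
  have "b - M < - ?n" using assms by simp
  then obtain C2 where C2: "0 \<le> C2" "\<And>R. 0 < R \<Longrightarrow>
    radial_mass (b - M) ({c. R \<le> norm c} :: (real^'n) set) \<le> ennreal (C2 * R powr (b - M + ?n))"
    using nn_integral_norm_powr_outside by blast
  show ?thesis
  proof (rule that[of "K * C1 + K * C2"])
    show "0 \<le> K * C1 + K * C2" using assms C1 C2 by simp
    fix X and Y :: "real^'n \<Rightarrow> real"
    assume X: "0 < X" and Y: "\<And>c. c \<noteq> 0 \<Longrightarrow> Y c \<le> K * norm c powr b"
      "\<And>c. c \<noteq> 0 \<Longrightarrow> Y c \<le> K * norm c powr b * (X * norm c) powr (- M)"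
    have "nnint Y \<le> ennreal (K * (C1 * (1 / X) powr (b + ?n))
       + (K * X powr (- M)) * (C2 * (1 / X) powr (b - M + ?n)))"
    proof (rule nn_integral_radial_split[where ?p1.0=b and ?p2.0="b - M" and ?S1.0="{c. norm c \<le> 1 / X}" and ?S2.0="{c. 1 / X \<le> norm c}"])
      fix c :: "real^'n" assume c: "c \<noteq> 0"
      have e: "K * norm c powr b * (X * norm c) powr (- M) = K * X powr (- M) * norm c powr (b - M)"
        using X c by (simp add: powr_mult powr_diff powr_minus_divide)
      show "Y c \<le> K * norm c powr b * indicator {c. norm c \<le> 1 / X} c
          + K * X powr (- M) * norm c powr (b - M) * indicator {c. 1 / X \<le> norm c} c"
      proof (cases "norm c \<le> 1 / X")
        case True
        then show ?thesis using assms(3) by (intro order_trans[OF Y(1)[OF c]]) simp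
      next
        case False
        then show ?thesis by (intro order_trans[OF Y(2)[OF c]]) (simp add: e)
      qed
    qed (use X C1 C2 assms in auto)
    also have "K * (C1 * (1 / X) powr (b + ?n)) + (K * X powr (- M)) * (C2 * (1 / X) powr (b - M + ?n))
        = (K * C1 + K * C2) * X powr (- (?n + b))"
      using X by (simp add: powr_divide powr_minus_divide powr_add powr_diff field_simps)
    finally show "nnint Y \<le> ennreal ((K * C1 + K * C2) * X powr (- (?n + b)))" .
  qed
qed

lemma nn_integral_split_set:
  fixes Y :: "real^'n::finite \<Rightarrow> real"
  assumes [measurable]: "Y \<in> borel_measurable borel" "L \<in> sets borel"
  shows "nnint Y = (\<integral>\<^sup>+c. ennreal (if c \<in> L then Y c else 0) \<partial>lborel)
     + (\<integral>\<^sup>+c. ennreal (if c \<in> L then 0 else Y c) \<partial>lborel)"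
  by (subst nn_integral_add[symmetric]) (auto intro!: nn_integral_cong)

text \<open>The exponent may have either sign, hence the modulus in the constants.\<close>

lemma one_plus_powr_bounds:
  fixes s \<nu> :: real
  shows "0 \<le> s \<Longrightarrow> s \<le> 1 \<Longrightarrow> 1 \<le> 2 powr \<bar>\<nu>\<bar> * (1 + s) powr (- \<nu>)"
    and "1 \<le> s \<Longrightarrow> s powr (- \<nu>) \<le> 2 powr \<bar>\<nu>\<bar> * (1 + s) powr (- \<nu>)"
proof -
  assume s: "0 \<le> s" "s \<le> 1"
  have "(1 + s) powr \<nu> \<le> (1 + s) powr \<bar>\<nu>\<bar>" using s by (intro powr_mono) auto
  also have "\<dots> \<le> 2 powr \<bar>\<nu>\<bar>" using s by (intro powr_mono2) auto
  finally show "1 \<le> 2 powr \<bar>\<nu>\<bar> * (1 + s) powr (- \<nu>)"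
    using s by (simp add: powr_minus_divide field_simps)
next
  assume s: "1 \<le> s"
  have "((1 + s) / s) powr \<nu> \<le> ((1 + s) / s) powr \<bar>\<nu>\<bar>" using s by (intro powr_mono) (auto simp: field_simps)
  also have "\<dots> \<le> 2 powr \<bar>\<nu>\<bar>" using s by (intro powr_mono2) (auto simp: field_simps)
  finally show "s powr (- \<nu>) \<le> 2 powr \<bar>\<nu>\<bar> * (1 + s) powr (- \<nu>)"
    using s by (simp add: powr_minus_divide powr_divide field_simps)
qed

text \<open>The case T = 1. For s >= 1 put \<open>R = s powr (1 / (m - 1))\<close>: frequencies
  below \<open>\<alpha> * R\<close> are dominated by the linear phase, those above
  \<open>\<beta> * R\<close> by \<open>a\<close>. The shell between them has volume of order R^n and
  carries pieces of size R^(b - mn/2); the product is s^(-nu), which is the origin of the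
  exponent.\<close>

lemma pieces_integral_unit:
  fixes m b M :: real
  defines "n \<equiv> real CARD('n::finite)"
  defines "\<nu> \<equiv> (n * (m - 2) - 2 * b) / (2 * (m - 1))"
  assumes m: "1 < m" and b: "- n / 2 \<le> b" and M: "n + b < M" and C: "0 \<le> C" and A: "0 < A" and a0: "0 < a0"
  obtains C' where "0 \<le> C'" "\<And>s (Y::real^'n \<Rightarrow> real). Y \<in> borel_measurable borel \<Longrightarrow> 0 \<le> s \<Longrightarrow>
     (\<And>c. c \<noteq> 0 \<Longrightarrow> piece_bd n m b M C A a0 1 s (norm c) (Y c)) \<Longrightarrow>
     nnint Y \<le> ennreal (C' * (1 + s) powr (- \<nu>))"
proof -
  have n: "1 \<le> n" by (simp add: n_def Suc_leI)
  have bn: "- n < b" using b n by simp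
  have Mn: "n / 2 < M" using b M by simp
  define p3 where "p3 = b - m * M"
  have p3: "p3 < - n"
  proof -
    have "1 * M < m * M" using m Mn n by (intro mult_strict_right_mono) auto
    then show ?thesis using M by (simp add: p3_def)
  qed
  define p2 where "p2 = b - m * n / 2"
  \<comment> \<open>The positive solutions of \<open>A * x powr m = x\<close> and of
    \<open>x = a0 * x powr m\<close>: the thresholds of the two non-stationary bounds at s = 1, to
    be multiplied by \<open>R\<close> below.\<close>
  define \<alpha> where "\<alpha> = (1 / A) powr (1 / (m - 1))"
  define \<beta> where "\<beta> = (1 / a0) powr (1 / (m - 1))"
  have \<alpha>\<beta>: "0 < \<alpha>" "0 < \<beta>" using A a0 by (auto simp: \<alpha>_def \<beta>_def)
  obtain C1 where C1: "0 \<le> C1" "\<And>R. 0 < R \<Longrightarrow>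
    radial_mass b ({c. norm c \<le> R} :: (real^'n) set) \<le> ennreal (C1 * R powr (b + n))"
    using nn_integral_norm_powr_cball[where p=b and ?'n='n] bn unfolding n_def by blast
  obtain C2 where C2: "0 \<le> C2" "\<And>R. 0 < R \<Longrightarrow>
    radial_mass p2 ({c. \<alpha> * R \<le> norm c \<and> norm c \<le> \<beta> * R} :: (real^'n) set)
      \<le> ennreal (C2 * R powr (p2 + n))"
    using nn_integral_norm_powr_annulus[OF \<alpha>\<beta>(1), where p=p2 and \<beta>=\<beta> and ?'n='n] unfolding n_def by blast
  obtain C3 where C3: "0 \<le> C3" "\<And>R. 0 < R \<Longrightarrow>
    radial_mass p3 ({c. R \<le> norm c} :: (real^'n) set) \<le> ennreal (C3 * R powr (p3 + n))"
    using nn_integral_norm_powr_outside[where p=p3 and ?'n='n] p3 unfolding n_def by blast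
  obtain C4 where C4: "0 \<le> C4" "\<And>X (Y::real^'n::finite \<Rightarrow> real). 0 < X \<Longrightarrow>
     (\<And>c. c \<noteq> 0 \<Longrightarrow> Y c \<le> C * norm c powr b) \<Longrightarrow>
     (\<And>c. c \<noteq> 0 \<Longrightarrow> Y c \<le> C * norm c powr b * (X * norm c) powr (- M)) \<Longrightarrow>
     nnint Y \<le> ennreal (C4 * X powr (- (n + b)))"
    using nn_integral_linear_dominated[where b=b and M=M and K=C and ?'n='n] bn M C unfolding n_def by blast
  define B1 where "B1 = C * (C1 * \<beta> powr (b + n)) + C * (C3 * \<beta> powr (p3 + n))"
  define B2 where "B2 = C4 + (C * C2 + C * (C3 * \<beta> powr (p3 + n)))"
  have B: "0 \<le> B1" "0 \<le> B2" using C C1 C2 C3 C4 by (auto simp: B1_def B2_def)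
  show ?thesis
  proof (rule that[of "(B1 + B2) * 2 powr \<bar>\<nu>\<bar>"])
    show "0 \<le> (B1 + B2) * 2 powr \<bar>\<nu>\<bar>" using B by simp
    fix s and Y :: "real^'n \<Rightarrow> real"
    assume [measurable]: "Y \<in> borel_measurable borel" and s: "0 \<le> s" and Y: "\<And>c. c \<noteq> 0 \<Longrightarrow> piece_bd n m b M C A a0 1 s (norm c) (Y c)"
    have Y1: "Y c \<le> C * norm c powr b" if "c \<noteq> 0" for c using Y[OF that] by (simp add: piece_bd_def)
    have Y2: "Y c \<le> C * norm c powr p2" if "c \<noteq> 0" for c
      using Y[OF that] by (simp add: piece_bd_def p2_def powr_powr mult.assoc powr_add[symmetric])
    have Y3: "Y c \<le> C * norm c powr b * (s * norm c) powr (- M)" if "c \<noteq> 0" "A * norm c powr m \<le> s * norm c" for c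
      using Y[OF that(1)] that(2) by (simp add: piece_bd_def)
    have Y4: "Y c \<le> C * norm c powr p3" if "c \<noteq> 0" "s * norm c \<le> a0 * norm c powr m" for c
      using Y[OF that(1)] that(2) by (simp add: piece_bd_def p3_def powr_powr mult.assoc powr_add[symmetric])
    show "nnint Y \<le> ennreal ((B1 + B2) * 2 powr \<bar>\<nu>\<bar> * (1 + s) powr (- \<nu>))"
    proof (cases "s \<le> 1")
      \<comment> \<open>For s <= 1 two regions suffice: above \<open>\<beta>\<close> the phase
        \<open>a\<close> dominates for every such s.\<close>
      case True
      have "nnint Y \<le> ennreal B1" unfolding B1_def
      proof (rule nn_integral_radial_split[where ?p1.0=b and ?p2.0=p3 and ?S1.0="{c. norm c \<le> \<beta>}" and ?S2.0="{c. \<beta> \<le> norm c}"])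
        fix c :: "real^'n" assume c: "c \<noteq> 0"
        show "Y c \<le> C * norm c powr b * indicator {c. norm c \<le> \<beta>} c + C * norm c powr p3 * indicator {c. \<beta> \<le> norm c} c"
        proof (cases "norm c \<le> \<beta>")
          case True
          then show ?thesis using C by (intro order_trans[OF Y1[OF c]]) simp
        next
          case False
          have "1 / a0 * norm c \<le> norm c powr m"
            using False c m a0 by (intro powr_threshold) (auto simp: \<beta>_def)
          then have "norm c \<le> a0 * norm c powr m" using a0 by (simp add: field_simps)
          then have "s * norm c \<le> a0 * norm c powr m"
            using mult_right_mono[OF \<open>s \<le> 1\<close> norm_ge_zero[of c]] by simp
          then show ?thesis using Y4[OF c] False by (simp add: indicator_def)
        qed
      qed (use C C1 C3 \<alpha>\<beta> in auto)
      also have "\<dots> \<le> ennreal ((B1 + B2) * 2 powr \<bar>\<nu>\<bar> * (1 + s) powr (- \<nu>))"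
      proof (rule ennreal_leI)
        have "B1 * 1 \<le> (B1 + B2) * (2 powr \<bar>\<nu>\<bar> * (1 + s) powr (- \<nu>))"
          using B one_plus_powr_bounds(1)[OF s True] by (intro mult_mono) auto
        then show "B1 \<le> (B1 + B2) * 2 powr \<bar>\<nu>\<bar> * (1 + s) powr (- \<nu>)" by (simp add: mult_ac)
      qed
      finally show ?thesis .
    next
      case False
      then have s1: "1 \<le> s" by simp
      define R where "R = s powr (1 / (m - 1))"
      have R: "0 < R" using s1 by (simp add: R_def)
      have \<alpha>R: "\<alpha> * R = (s / A) powr (1 / (m - 1))" using A s by (simp add: \<alpha>_def R_def powr_divide)
      have \<beta>R: "\<beta> * R = (s / a0) powr (1 / (m - 1))" using a0 s by (simp add: \<beta>_def R_def powr_divide)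
      define L where "L = {c::real^'n. norm c \<le> \<alpha> * R}"
      define Y' where "Y' c = (if c \<in> L then Y c else 0)" for c
      define Y'' where "Y'' c = (if c \<in> L then 0 else Y c)" for c
      have "L \<in> sets borel" unfolding L_def by measurable
      then have I0: "nnint Y = nnint Y' + nnint Y''"
        unfolding Y'_def Y''_def by (intro nn_integral_split_set) auto
      have I1: "nnint Y' \<le> ennreal (C4 * s powr (- (n + b)))"
      proof (rule C4(2))
        show "0 < s" using s1 by simp
        fix c :: "real^'n" assume c: "c \<noteq> 0"
        show "Y' c \<le> C * norm c powr b" using Y1[OF c] C by (auto simp: Y'_def)
        have "A * norm c powr m \<le> s * norm c" if "c \<in> L"
        proof -
          have "norm c powr m \<le> s / A * norm c"
            using that c m A s1 \<alpha>R by (intro powr_threshold') (auto simp: L_def)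
          then show ?thesis using A by (simp add: field_simps)
        qed
        then show "Y' c \<le> C * norm c powr b * (s * norm c) powr (- M)"
          using Y3[OF c] C by (auto simp: Y'_def)
      qed
      have I2: "nnint Y'' \<le> ennreal (C * (C2 * R powr (p2 + n)) + C * (C3 * (\<beta> * R) powr (p3 + n)))"
      proof (rule nn_integral_radial_split[where ?p1.0=p2 and ?p2.0=p3
            and ?S1.0="{c. \<alpha> * R \<le> norm c \<and> norm c \<le> \<beta> * R}" and ?S2.0="{c. \<beta> * R \<le> norm c}"])
        fix c :: "real^'n" assume c: "c \<noteq> 0"
        show "Y'' c \<le> C * norm c powr p2 * indicator {c. \<alpha> * R \<le> norm c \<and> norm c \<le> \<beta> * R} c
            + C * norm c powr p3 * indicator {c. \<beta> * R \<le> norm c} c"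
        proof (cases "\<beta> * R \<le> norm c")
          case True
          have "s / a0 * norm c \<le> norm c powr m"
            using True c m a0 s1 \<beta>R by (intro powr_threshold) auto
          then have "s * norm c \<le> a0 * norm c powr m" using a0 by (simp add: field_simps)
          then show ?thesis using Y4[OF c] True C by (auto simp: indicator_def Y''_def intro: add_increasing)
        next
          case False
          then show ?thesis using Y2[OF c] C by (auto simp: indicator_def Y''_def L_def)
        qed
      next
        show "{c::real^'n. \<alpha> * R \<le> norm c \<and> norm c \<le> \<beta> * R} \<in> sets borel" by measurable
      qed (use C C2 C3 R \<alpha>\<beta> in auto)
      have "nnint Y \<le> ennreal (C4 * s powr (- (n + b)))
          + ennreal (C * (C2 * R powr (p2 + n)) + C * (C3 * (\<beta> * R) powr (p3 + n)))"
        unfolding I0 using I1 I2 by (rule add_mono)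
      also have "\<dots> \<le> ennreal (B2 * s powr (- \<nu>))"
      proof -
        have \<nu>: "(p2 + n) / (m - 1) = - \<nu>" using m by (simp add: \<nu>_def p2_def field_simps)
        \<comment> \<open>The region dominated by the linear phase contributes s^(-(n+b)). This is
          where b >= -n/2 enters, being equivalent to nu <= n + b.\<close>
        have e1: "s powr (- (n + b)) \<le> s powr (- \<nu>)"
        proof (rule powr_mono)
          have "n * (m - 2) - 2 * b \<le> (n + b) * (2 * (m - 1))"
          proof -
            have "0 \<le> m * (n + 2 * b)" using m b by (intro mult_nonneg_nonneg) auto
            then show ?thesis by (simp add: algebra_simps)
          qed
          then have "\<nu> \<le> n + b" using m unfolding \<nu>_def by (subst pos_divide_le_eq) auto
          then show "- (n + b) \<le> - \<nu>" by simp
        qed (use s1 in auto)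
        have e2: "R powr (p2 + n) = s powr (- \<nu>)"
          using s1 \<nu> by (simp add: R_def powr_powr)
        have e3: "R powr (p3 + n) \<le> s powr (- \<nu>)"
        proof -
          have "m * (n / 2) \<le> m * M" using m Mn by (intro mult_left_mono) auto
          then have "R powr (p3 + n) \<le> R powr (p2 + n)"
            using s1 m by (intro powr_mono) (auto simp: p3_def p2_def R_def ge_one_powr_ge_zero)
          then show ?thesis using e2 by simp
        qed
        have "C4 * s powr (- (n + b)) + (C * (C2 * R powr (p2 + n)) + C * (C3 * (\<beta> * R) powr (p3 + n)))
            = C4 * s powr (- (n + b)) + (C * C2 * R powr (p2 + n) + C * (C3 * \<beta> powr (p3 + n)) * R powr (p3 + n))"
          using R \<alpha>\<beta> by (simp add: powr_mult mult_ac)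
        also have "\<dots> \<le> C4 * s powr (- \<nu>) + (C * C2 * s powr (- \<nu>) + C * (C3 * \<beta> powr (p3 + n)) * s powr (- \<nu>))"
          unfolding e2 using e1 e3 C C2 C3 C4 by (intro add_mono mult_left_mono order_refl) auto
        also have "\<dots> = B2 * s powr (- \<nu>)" by (simp add: B2_def algebra_simps)
        finally have "C4 * s powr (- (n + b)) + (C * (C2 * R powr (p2 + n)) + C * (C3 * (\<beta> * R) powr (p3 + n)))
            \<le> B2 * s powr (- \<nu>)" .
        then have "ennreal (C4 * s powr (- (n + b)) + (C * (C2 * R powr (p2 + n)) + C * (C3 * (\<beta> * R) powr (p3 + n))))
            \<le> ennreal (B2 * s powr (- \<nu>))" by (rule ennreal_leI)
        moreover have "0 \<le> C4 * s powr (- (n + b))"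
          "0 \<le> C * (C2 * R powr (p2 + n)) + C * (C3 * (\<beta> * R) powr (p3 + n))"
          using C C2(1) C3(1) C4(1) by auto
        ultimately show ?thesis by (simp only: ennreal_plus)
      qed
      also have "\<dots> \<le> ennreal ((B1 + B2) * 2 powr \<bar>\<nu>\<bar> * (1 + s) powr (- \<nu>))"
      proof (rule ennreal_leI)
        have "B2 * s powr (- \<nu>) \<le> (B1 + B2) * (2 powr \<bar>\<nu>\<bar> * (1 + s) powr (- \<nu>))"
          using B one_plus_powr_bounds(2)[OF s1] by (intro mult_mono) auto
        then show "B2 * s powr (- \<nu>) \<le> (B1 + B2) * 2 powr \<bar>\<nu>\<bar> * (1 + s) powr (- \<nu>)" by (simp add: mult_ac)
      qed
      finally show ?thesis .
    qed
  qed
qed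

section \<open>Scaling in time\<close>

lemma nn_integral_lborel_scale:
  fixes f :: "real^'n::finite \<Rightarrow> ennreal"
  assumes f: "f \<in> borel_measurable borel" and \<rho>: "0 < \<rho>"
  shows "(\<integral>\<^sup>+x. f x \<partial>lborel) = ennreal (\<rho> powr CARD('n)) * (\<integral>\<^sup>+x. f (\<rho> *\<^sub>R x) \<partial>lborel)"
proof -
  have "(\<integral>\<^sup>+x. f x \<partial>lborel)
      = (\<integral>\<^sup>+x. f x \<partial>(density (distr lborel borel (\<lambda>x. 0 + \<rho> *\<^sub>R x)) (\<lambda>_. ennreal (\<bar>\<rho>\<bar> ^ DIM(real^'n)))))"
    using \<rho> by (subst lborel_affine[of \<rho> 0]) auto
  also have "\<dots> = (\<integral>\<^sup>+x. ennreal (\<rho> powr CARD('n)) * f (\<rho> *\<^sub>R x) \<partial>lborel)"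
    using f \<rho> by (simp add: nn_integral_density nn_integral_distr powr_realpow)
  also have "\<dots> = ennreal (\<rho> powr CARD('n)) * (\<integral>\<^sup>+x. f (\<rho> *\<^sub>R x) \<partial>lborel)"
    by (rule nn_integral_cmult) (use f in measurable)
  finally show ?thesis .
qed

lemma lborel_integral_scale:
  fixes f :: "real^'n::finite \<Rightarrow> complex"
  assumes f: "f \<in> borel_measurable borel" and \<rho>: "0 < \<rho>"
  shows "(\<integral>x. f x \<partial>lborel) = (\<rho> powr CARD('n)) *\<^sub>R (\<integral>x. f (\<rho> *\<^sub>R x) \<partial>lborel)"
proof -
  have "(\<integral>x. f x \<partial>lborel)
      = (\<integral>x. f x \<partial>(density (distr lborel borel (\<lambda>x. 0 + \<rho> *\<^sub>R x)) (\<lambda>_. ennreal (\<bar>\<rho>\<bar> ^ DIM(real^'n)))))"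
    using \<rho> by (subst lborel_affine[of \<rho> 0]) auto
  also have "\<dots> = (\<integral>x. (\<rho> powr CARD('n)) *\<^sub>R f (\<rho> *\<^sub>R x) \<partial>lborel)"
    using f \<rho> by (subst integral_density) (auto simp: integral_distr powr_realpow)
  finally show ?thesis by simp
qed

text \<open>Replacing c by sigma c with sigma = T^(-1/m) turns T sigma^m into 1 and reduces to
  \<open>pieces_integral_unit\<close> with s = sigma X. The Jacobian sigma^n and the homogeneity
  sigma^b of the bounds produce the factor T^(-(n+b)/m).\<close>

lemma pieces_integral:
  fixes m b M :: real
  defines "n \<equiv> real CARD('n::finite)"
  defines "\<nu> \<equiv> (n * (m - 2) - 2 * b) / (2 * (m - 1))"
  assumes m: "1 < m" and b: "- n / 2 \<le> b" and M: "n + b < M" and C: "0 \<le> C" and A: "0 < A" and a0: "0 < a0"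
  obtains C' where "0 \<le> C'" "\<And>T X (Y::real^'n \<Rightarrow> real). Y \<in> borel_measurable borel \<Longrightarrow> 0 < T \<Longrightarrow> 0 \<le> X \<Longrightarrow>
     (\<And>c. c \<noteq> 0 \<Longrightarrow> piece_bd n m b M C A a0 T X (norm c) (Y c)) \<Longrightarrow>
     nnint Y \<le> ennreal (C' * T powr (- (n + b) / m) * (1 + T powr (- 1 / m) * X) powr (- \<nu>))"
proof -
  obtain C' where C': "0 \<le> C'" "\<And>s (Y::real^'n \<Rightarrow> real). Y \<in> borel_measurable borel \<Longrightarrow> 0 \<le> s \<Longrightarrow>
     (\<And>c. c \<noteq> 0 \<Longrightarrow> piece_bd n m b M C A a0 1 s (norm c) (Y c)) \<Longrightarrow>
     nnint Y \<le> ennreal (C' * (1 + s) powr (- \<nu>))"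
    using pieces_integral_unit[where ?'n='n and m=m and b=b and M=M and C=C and A=A and ?a0.0=a0] assms
    unfolding n_def \<nu>_def by blast
  show ?thesis
  proof (rule that[of C'])
    show "0 \<le> C'" by (rule C')
    fix T X and Y :: "real^'n \<Rightarrow> real"
    assume [measurable]: "Y \<in> borel_measurable borel" and T: "0 < T" and X: "0 \<le> X"
      and Y: "\<And>c. c \<noteq> 0 \<Longrightarrow> piece_bd n m b M C A a0 T X (norm c) (Y c)"
    define \<sigma> where "\<sigma> = T powr (- 1 / m)"
    have \<sigma>: "0 < \<sigma>" using T by (simp add: \<sigma>_def)
    have "\<sigma> powr m = T powr (-1)" unfolding \<sigma>_def powr_powr using m by simp
    then have T\<sigma>: "T * \<sigma> powr m = 1" using T by simp
    define Y' where "Y' c = \<sigma> powr (- b) * Y (\<sigma> *\<^sub>R c)" for c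
    have [measurable]: "Y' \<in> borel_measurable borel" unfolding Y'_def by measurable
    have "nnint Y' \<le> ennreal (C' * (1 + \<sigma> * X) powr (- \<nu>))"
    proof (rule C'(2))
      fix c :: "real^'n" assume c: "c \<noteq> 0"
      have t: "T * (\<sigma> * norm c) powr m = norm c powr m"
        using T\<sigma> \<sigma> by (simp add: powr_mult mult.assoc[symmetric])
      have u: "\<sigma> powr (- b) * (C * (\<sigma> * norm c) powr b) = C * norm c powr b"
        using \<sigma> by (simp add: powr_mult powr_minus_divide)
      have le: "Y' c \<le> C * norm c powr b * z" if "Y (\<sigma> *\<^sub>R c) \<le> C * (\<sigma> * norm c) powr b * z" for z
      proof -
        have "Y' c \<le> \<sigma> powr (- b) * (C * (\<sigma> * norm c) powr b * z)"
          unfolding Y'_def using that by (intro mult_left_mono) auto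
        also have "\<dots> = (\<sigma> powr (- b) * (C * (\<sigma> * norm c) powr b)) * z" by simp
        finally show ?thesis unfolding u .
      qed
      have p: "piece_bd n m b M C A a0 T X (\<sigma> * norm c) (Y (\<sigma> *\<^sub>R c))"
        using Y[of "\<sigma> *\<^sub>R c"] c \<sigma> by simp
      show "piece_bd n m b M C A a0 1 (\<sigma> * X) (norm c) (Y' c)"
        unfolding piece_bd_def
      proof (intro conjI impI)
        show "Y' c \<le> C * norm c powr b" using p le[of 1] by (simp add: piece_bd_def)
        show "Y' c \<le> C * norm c powr b * (1 * norm c powr m) powr (- n / 2)"
          using p by (intro le) (simp add: piece_bd_def t)
        show "Y' c \<le> C * norm c powr b * (\<sigma> * X * norm c) powr (- M)"
          if "A * (1 * norm c powr m) \<le> \<sigma> * X * norm c"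
          using p that by (intro le) (simp add: piece_bd_def t mult_ac)
        show "Y' c \<le> C * norm c powr b * (1 * norm c powr m) powr (- M)"
          if "\<sigma> * X * norm c \<le> a0 * (1 * norm c powr m)"
          using p that by (intro le) (simp add: piece_bd_def t mult_ac)
      qed
    qed (use \<sigma> X in auto)
    then have "ennreal (\<sigma> powr b * \<sigma> powr n) * nnint Y'
        \<le> ennreal (\<sigma> powr b * \<sigma> powr n) * ennreal (C' * (1 + \<sigma> * X) powr (- \<nu>))"
      by (intro mult_left_mono) auto
    also have "ennreal (\<sigma> powr b * \<sigma> powr n) * nnint Y'
        = ennreal (\<sigma> powr n) * (\<integral>\<^sup>+c. ennreal (\<sigma> powr b) * ennreal (Y' c) \<partial>lborel)"
      by (subst nn_integral_cmult) (auto simp: ennreal_mult mult_ac)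
    also have "(\<integral>\<^sup>+c. ennreal (\<sigma> powr b) * ennreal (Y' c) \<partial>lborel) = (\<integral>\<^sup>+c. ennreal (Y (\<sigma> *\<^sub>R c)) \<partial>lborel)"
      using \<sigma> by (intro nn_integral_cong)
        (simp add: Y'_def ennreal_mult'[symmetric] mult.assoc[symmetric] powr_minus_divide)
    also have "ennreal (\<sigma> powr n) * \<dots> = nnint Y"
      unfolding n_def using \<sigma> by (intro nn_integral_lborel_scale[symmetric]) auto
    also have "ennreal (\<sigma> powr b * \<sigma> powr n) * ennreal (C' * (1 + \<sigma> * X) powr (- \<nu>))
        = ennreal (C' * T powr (- (n + b) / m) * (1 + T powr (- 1 / m) * X) powr (- \<nu>))"
    proof -
      have "\<sigma> powr b * \<sigma> powr n = T powr (- (n + b) / m)"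
      proof -
        have "- 1 / m * b + - 1 / m * n = - (n + b) / m" using m by (simp add: field_simps)
        then show ?thesis unfolding \<sigma>_def powr_powr powr_add[symmetric] by simp
      qed
      then show ?thesis using C' by (simp add: ennreal_mult'[symmetric] \<sigma>_def mult_ac)
    qed
    finally show "nnint Y
        \<le> ennreal (C' * T powr (- (n + b) / m) * (1 + T powr (- 1 / m) * X) powr (- \<nu>))" .
  qed
qed

text \<open>Three bounds for frequencies below \<open>\<kappa>\<close>, for comparison with the rate
  of the other scale. If X >= A kappa^(m-1) T, the linear phase dominates on the whole range. If
  only X >= eta T, the frequencies where it does not dominate lie in a fixed shell away from 0, and
  there the stationary bound gives T^(-n/2).\<close>

lemma low_pieces_integral:
  fixes m b M \<kappa> \<eta> :: real
  defines "n \<equiv> real CARD('n::finite)"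
  assumes m: "1 < m" and b: "- n / 2 \<le> b" and M: "n + b < M" and C: "0 \<le> C" and A: "0 < A" and \<kappa>: "0 < \<kappa>" "0 < \<eta>"
  obtains C' where "0 \<le> C'" "\<And>T X (Y::real^'n \<Rightarrow> real). Y \<in> borel_measurable borel \<Longrightarrow> 0 < T \<Longrightarrow> 0 \<le> X \<Longrightarrow>
     (\<And>c. c \<noteq> 0 \<Longrightarrow> norm c < \<kappa> \<Longrightarrow> piece_bd n m b M C A a0 T X (norm c) (Y c)) \<Longrightarrow>
     (\<And>c. \<kappa> \<le> norm c \<Longrightarrow> Y c = 0) \<Longrightarrow>
     nnint Y \<le> ennreal C' \<and>
     (0 < X \<longrightarrow> A * \<kappa> powr (m - 1) * T \<le> X \<longrightarrow> nnint Y \<le> ennreal (C' * X powr (- (n + b)))) \<and>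
     (0 < X \<longrightarrow> \<eta> * T \<le> X \<longrightarrow> nnint Y \<le> ennreal (C' * (X powr (- (n + b)) + T powr (- n / 2))))"
proof -
  have n: "1 \<le> n" by (simp add: n_def Suc_leI)
  have bn: "- n < b" using b n by simp
  define p2 where "p2 = b - m * n / 2"
  define \<alpha> where "\<alpha> = (\<eta> / A) powr (1 / (m - 1))"
  have \<alpha>: "0 < \<alpha>" using A \<kappa> by (auto simp: \<alpha>_def)
  obtain C1 where C1: "0 \<le> C1" "\<And>R. 0 < R \<Longrightarrow>
    radial_mass b ({c. norm c \<le> R} :: (real^'n) set) \<le> ennreal (C1 * R powr (b + n))"
    using nn_integral_norm_powr_cball[where p=b and ?'n='n] bn unfolding n_def by blast
  obtain C2 where C2: "0 \<le> C2" "\<And>R. 0 < R \<Longrightarrow>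
    radial_mass p2 ({c. \<alpha> * R \<le> norm c \<and> norm c \<le> \<kappa> * R} :: (real^'n) set)
      \<le> ennreal (C2 * R powr (p2 + n))"
    using nn_integral_norm_powr_annulus[OF \<alpha>, where p=p2 and \<beta>=\<kappa> and ?'n='n] unfolding n_def by blast
  obtain C4 where C4: "0 \<le> C4" "\<And>X (Y::real^'n::finite \<Rightarrow> real). 0 < X \<Longrightarrow>
     (\<And>c. c \<noteq> 0 \<Longrightarrow> Y c \<le> C * norm c powr b) \<Longrightarrow>
     (\<And>c. c \<noteq> 0 \<Longrightarrow> Y c \<le> C * norm c powr b * (X * norm c) powr (- M)) \<Longrightarrow>
     nnint Y \<le> ennreal (C4 * X powr (- (n + b)))"
    using nn_integral_linear_dominated[where b=b and M=M and K=C and ?'n='n] bn M C unfolding n_def by blast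
  define B where "B = C * (C1 * \<kappa> powr (b + n)) + C4 + C * C2"
  have B0: "0 \<le> C * (C1 * \<kappa> powr (b + n))" "0 \<le> C * C2" using C C1 C2 by auto
  show ?thesis
  proof (rule that[of B])
    show "0 \<le> B" using B0 C4 by (simp add: B_def)
    fix T X and Y :: "real^'n \<Rightarrow> real"
    assume Ym[measurable]: "Y \<in> borel_measurable borel" and T: "0 < T" and X: "0 \<le> X"
      and Y: "\<And>c. c \<noteq> 0 \<Longrightarrow> norm c < \<kappa> \<Longrightarrow> piece_bd n m b M C A a0 T X (norm c) (Y c)"
      and Y0: "\<And>c. \<kappa> \<le> norm c \<Longrightarrow> Y c = 0"
    have Y1: "Y c \<le> C * norm c powr b" if "c \<noteq> 0" for c
      using Y[OF that] Y0[of c] C by (cases "norm c < \<kappa>") (auto simp: piece_bd_def)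
    have Y3: "Y c \<le> C * norm c powr b * (X * norm c) powr (- M)"
      if "c \<noteq> 0" "A * (T * norm c powr m) \<le> X * norm c" for c
      using Y[OF that(1)] Y0[of c] that(2) C by (cases "norm c < \<kappa>") (auto simp: piece_bd_def)
    have Y2: "Y c \<le> C * T powr (- n / 2) * norm c powr p2" if "c \<noteq> 0" for c
    proof (cases "norm c < \<kappa>")
      case True
      have e: "C * norm c powr b * (T * norm c powr m) powr (- n / 2) = C * T powr (- n / 2) * norm c powr p2"
        using that T by (simp add: p2_def powr_mult powr_powr powr_diff powr_minus_divide)
      show ?thesis using Y[OF that True] unfolding piece_bd_def e by blast
    next
      case False
      then show ?thesis using Y0[of c] C by simp
    qed
    \<comment> \<open>The splitting lemma expects two regions; here the second is empty.\<close>
    have I1: "nnint Y \<le> ennreal (C * (C1 * \<kappa> powr (b + n)) + 0 * 0)"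
    proof (rule nn_integral_radial_split[where ?p1.0=b and ?p2.0=b and ?S1.0="{c. norm c \<le> \<kappa>}" and ?S2.0="{}"])
      fix c :: "real^'n" assume c: "c \<noteq> 0"
      show "Y c \<le> C * norm c powr b * indicator {c. norm c \<le> \<kappa>} c + 0 * norm c powr b * indicator {} c"
        using Y1[OF c] Y0[of c] by (cases "norm c \<le> \<kappa>") auto
    qed (use C C1 \<kappa> in auto)
    have I2: "nnint Y \<le> ennreal (C4 * X powr (- (n + b)))"
      if "0 < X" and X2: "A * \<kappa> powr (m - 1) * T \<le> X"
    proof (rule C4(2)[OF \<open>0 < X\<close> Y1])
      fix c :: "real^'n" assume c: "c \<noteq> 0"
      show "Y c \<le> C * norm c powr b * (X * norm c) powr (- M)"
      proof (cases "norm c < \<kappa>")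
        case True
        have "norm c powr (m - 1) \<le> \<kappa> powr (m - 1)" using True m by (intro powr_mono2) auto
        then have "A * T * norm c powr (m - 1) * norm c \<le> A * T * \<kappa> powr (m - 1) * norm c"
          using A T by (intro mult_right_mono mult_left_mono) auto
        also have "\<dots> \<le> X * norm c" using X2 by (intro mult_right_mono) (auto simp: mult_ac)
        also have "A * T * norm c powr (m - 1) * norm c = A * (T * norm c powr m)"
          using c by (simp add: powr_diff)
        finally show ?thesis by (intro Y3[OF c])
      next
        case False
        then show ?thesis using Y0[of c] C by simp
      qed
    qed
    have I3: "nnint Y \<le> ennreal (C4 * X powr (- (n + b)) + C * C2 * T powr (- n / 2))"
      if "0 < X" and X2: "\<eta> * T \<le> X"
    proof -
      define L where "L = {c::real^'n. A * (T * norm c powr m) \<le> X * norm c}"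
      define Y' where "Y' c = (if c \<in> L then Y c else 0)" for c
      define Y'' where "Y'' c = (if c \<in> L then 0 else Y c)" for c
      have "L \<in> sets borel" unfolding L_def by measurable
      then have J0: "nnint Y = nnint Y' + nnint Y''"
        unfolding Y'_def Y''_def by (intro nn_integral_split_set) auto
      have J1: "nnint Y' \<le> ennreal (C4 * X powr (- (n + b)))"
        using Y1 Y3 C by (intro C4(2)[OF \<open>0 < X\<close>]) (auto simp: Y'_def L_def)
      have J2: "nnint Y'' \<le> ennreal ((C * T powr (- n / 2)) * (C2 * 1 powr (p2 + n)) + 0 * 0)"
      proof (rule nn_integral_radial_split[where ?p1.0=p2 and ?p2.0=b
            and ?S1.0="{c. \<alpha> * 1 \<le> norm c \<and> norm c \<le> \<kappa> * 1}" and ?S2.0="{}"])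
        fix c :: "real^'n" assume c: "c \<noteq> 0"
        have "\<alpha> \<le> norm c" if "c \<notin> L"
        proof (rule ccontr)
          assume "\<not> \<alpha> \<le> norm c"
          then have "norm c powr m \<le> \<eta> / A * norm c"
            using c m A \<kappa> by (intro powr_threshold') (auto simp: \<alpha>_def)
          then have "A * norm c powr m \<le> \<eta> * norm c" using A by (simp add: field_simps)
          then have "T * (A * norm c powr m) \<le> T * (\<eta> * norm c)" using T by (intro mult_left_mono) auto
          also have "\<dots> = \<eta> * T * norm c" by simp
          also have "\<dots> \<le> X * norm c" using X2 by (intro mult_right_mono) auto
          finally show False using that by (simp add: L_def mult_ac)
        qed
        then show "Y'' c \<le> C * T powr (- n / 2) * norm c powr p2 * indicator {c. \<alpha> * 1 \<le> norm c \<and> norm c \<le> \<kappa> * 1} c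
            + 0 * norm c powr b * indicator {} c"
          using Y2[OF c] Y0[of c] C by (cases "norm c \<le> \<kappa>") (auto simp: Y''_def indicator_def)
      next
        show "{c::real^'n. \<alpha> * 1 \<le> norm c \<and> norm c \<le> \<kappa> * 1} \<in> sets borel" by measurable
      qed (use C C2 C2(2)[of 1] in auto)
      show ?thesis unfolding J0
        using add_mono[OF J1 J2] C C2 C4 by (simp add: mult_ac)
    qed
    have "C4 * x + C * C2 * y \<le> B * (x + y)" if "0 \<le> x" "0 \<le> y" for x y
    proof -
      have "0 \<le> C * (C1 * \<kappa> powr (b + n)) * (x + y) + C4 * y + C * C2 * x"
        using that C C1(1) C2(1) C4(1) by (intro add_nonneg_nonneg mult_nonneg_nonneg) auto
      then show ?thesis by (simp add: B_def algebra_simps)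
    qed
    moreover have "C4 \<le> B" "C * (C1 * \<kappa> powr (b + n)) \<le> B" using B0 C4(1) by (auto simp: B_def)
    ultimately show "nnint Y \<le> ennreal B \<and>
     (0 < X \<longrightarrow> A * \<kappa> powr (m - 1) * T \<le> X \<longrightarrow> nnint Y \<le> ennreal (B * X powr (- (n + b)))) \<and>
     (0 < X \<longrightarrow> \<eta> * T \<le> X \<longrightarrow> nnint Y \<le> ennreal (B * (X powr (- (n + b)) + T powr (- n / 2))))"
      using I1 I2 I3
      by (intro conjI impI order_trans[OF I1] order_trans[OF I2] order_trans[OF I3] ennreal_leI mult_right_mono) auto
  qed
qed

text \<open>For X <= N T the phase \<open>a\<close> dominates beyond the fixed radius
  \<open>\<beta>\<close>, whatever T is. Between \<open>\<kappa>\<close> and \<open>\<beta>\<close>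
  it can fail to dominate only if X > a0 kappa^(m-1) T, that is, if X and T are comparable;
  otherwise only T^(-M) remains.\<close>

lemma high_pieces_integral:
  fixes m b M \<kappa> N :: real
  defines "n \<equiv> real CARD('n::finite)"
  assumes m: "1 < m" and b: "- n / 2 \<le> b" and M: "n + b < M" and C: "0 \<le> C" and a0: "0 < a0" and \<kappa>: "0 < \<kappa>" "0 < N"
  obtains C' where "0 \<le> C'" "\<And>T X (Y::real^'n \<Rightarrow> real). 0 < T \<Longrightarrow> 0 \<le> X \<Longrightarrow> X \<le> N * T \<Longrightarrow>
     (\<And>c. \<kappa> \<le> norm c \<Longrightarrow> piece_bd n m b M C A a0 T X (norm c) (Y c)) \<Longrightarrow>
     (\<And>c. norm c < \<kappa> \<Longrightarrow> Y c = 0) \<Longrightarrow>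
     nnint Y
        \<le> ennreal (C' * (T powr (- M) + (if a0 * \<kappa> powr (m - 1) * T < X then T powr (- n / 2) else 0)))"
proof -
  have n: "1 \<le> n" by (simp add: n_def Suc_leI)
  have Mn: "n / 2 < M" using b M by simp
  define p3 where "p3 = b - m * M"
  have p3: "p3 < - n"
  proof -
    have "1 * M < m * M" using m Mn n by (intro mult_strict_right_mono) auto
    then show ?thesis using M by (simp add: p3_def)
  qed
  define p2 where "p2 = b - m * n / 2"
  define \<beta> where "\<beta> = (N / a0) powr (1 / (m - 1))"
  obtain C2 where C2: "0 \<le> C2" "\<And>R. 0 < R \<Longrightarrow>
    radial_mass p2 ({c. \<kappa> * R \<le> norm c \<and> norm c \<le> \<beta> * R} :: (real^'n) set)
      \<le> ennreal (C2 * R powr (p2 + n))"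
    using nn_integral_norm_powr_annulus[OF \<kappa>(1), where p=p2 and \<beta>=\<beta> and ?'n='n] unfolding n_def by blast
  obtain C3 where C3: "0 \<le> C3" "\<And>R. 0 < R \<Longrightarrow>
    radial_mass p3 ({c. R \<le> norm c} :: (real^'n) set) \<le> ennreal (C3 * R powr (p3 + n))"
    using nn_integral_norm_powr_outside[where p=p3 and ?'n='n] p3 unfolding n_def by blast
  define D where "D = C3 * \<kappa> powr (p3 + n)"
  have D: "0 \<le> D" using C3 by (simp add: D_def)
  show ?thesis
  proof (rule that[of "C * D + C * C2"])
    show "0 \<le> C * D + C * C2" using C D C2 by simp
    fix T X and Y :: "real^'n \<Rightarrow> real"
    assume T: "0 < T" and X: "0 \<le> X" "X \<le> N * T"
      and Y: "\<And>c. \<kappa> \<le> norm c \<Longrightarrow> piece_bd n m b M C A a0 T X (norm c) (Y c)"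
      and Y0: "\<And>c. norm c < \<kappa> \<Longrightarrow> Y c = 0"
    define t where "t = (if a0 * \<kappa> powr (m - 1) * T < X then T powr (- n / 2) else 0)"
    have t: "0 \<le> t" by (simp add: t_def)
    have "nnint Y \<le> ennreal ((C * T powr (- M)) * D + (C * t) * (C2 * 1 powr (p2 + n)))"
    proof (rule nn_integral_radial_split[where ?p1.0=p3 and ?p2.0=p2 and ?S1.0="{c. \<kappa> \<le> norm c}"
          and ?S2.0="{c. \<kappa> * 1 \<le> norm c \<and> norm c \<le> \<beta> * 1}"])
      fix c :: "real^'n" assume c: "c \<noteq> 0"
      show "Y c \<le> C * T powr (- M) * norm c powr p3 * indicator {c. \<kappa> \<le> norm c} c
          + C * t * norm c powr p2 * indicator {c. \<kappa> * 1 \<le> norm c \<and> norm c \<le> \<beta> * 1} c"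
      proof (cases "norm c < \<kappa>")
        case True
        then show ?thesis using Y0[OF True] by simp
      next
        case False
        then have k: "\<kappa> \<le> norm c" by simp
        have e3: "C * norm c powr b * (T * norm c powr m) powr (- M) = C * T powr (- M) * norm c powr p3"
          using c T by (simp add: p3_def powr_mult powr_powr powr_diff powr_minus_divide)
        have e2: "C * norm c powr b * (T * norm c powr m) powr (- n / 2) = C * T powr (- n / 2) * norm c powr p2"
          using c T by (simp add: p2_def powr_mult powr_powr powr_diff powr_minus_divide)
        show ?thesis
        proof (cases "X * norm c \<le> a0 * (T * norm c powr m)")
          case True
          then have le: "Y c \<le> C * T powr (- M) * norm c powr p3"
            using Y[OF k] unfolding piece_bd_def e3 by blast
          show ?thesis using k C t by (intro order_trans[OF le]) simp
        next
          case False
          have "\<not> N / a0 * norm c \<le> norm c powr m"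
          proof
            assume "N / a0 * norm c \<le> norm c powr m"
            then have "N * norm c \<le> a0 * norm c powr m" using a0 by (simp add: field_simps)
            then have "T * (N * norm c) \<le> T * (a0 * norm c powr m)" using T by (intro mult_left_mono) auto
            moreover have "X * norm c \<le> N * T * norm c" using X by (intro mult_right_mono) auto
            ultimately show False using False by (simp add: mult_ac)
          qed
          then have "norm c \<le> \<beta>"
            using powr_threshold[of m "norm c" "N / a0"] m c \<kappa> a0 unfolding \<beta>_def by force
          moreover have "a0 * \<kappa> powr (m - 1) * T < X"
          proof -
            have "a0 * T * \<kappa> powr (m - 1) * norm c \<le> a0 * T * norm c powr (m - 1) * norm c"
              using a0 T k m \<kappa> by (intro mult_right_mono mult_left_mono powr_mono2) auto
            also have "\<dots> = a0 * (T * norm c powr m)" using c by (simp add: powr_diff)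
            also have "\<dots> < X * norm c" using False by simp
            finally show ?thesis using c by (simp add: mult_ac)
          qed
          moreover have "Y c \<le> C * T powr (- n / 2) * norm c powr p2"
            using Y[OF k] unfolding piece_bd_def e2 by blast
          ultimately show ?thesis using k C by (simp add: t_def add_increasing)
        qed
      qed
    next
      show "{c::real^'n. \<kappa> * 1 \<le> norm c \<and> norm c \<le> \<beta> * 1} \<in> sets borel" by measurable
    next
      show "radial_mass p3 ({c. \<kappa> \<le> norm c} :: (real^'n) set) \<le> ennreal D"
        unfolding D_def using C3(2)[OF \<kappa>(1)] .
    qed (use C C2(1) C2(2)[of 1] D t in auto)
    also have "\<dots> \<le> ennreal ((C * D + C * C2) * (T powr (- M) + t))"
    proof (rule ennreal_leI)
      have "0 \<le> C * C2 * T powr (- M) + C * D * t" using C C2(1) D t by simp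
      then show "(C * T powr (- M)) * D + (C * t) * (C2 * 1 powr (p2 + n)) \<le> (C * D + C * C2) * (T powr (- M) + t)"
        by (simp add: algebra_simps)
    qed
    finally show "nnint Y
        \<le> ennreal ((C * D + C * C2) * (T powr (- M) + (if a0 * \<kappa> powr (m - 1) * T < X then T powr (- n / 2) else 0)))"
      by (simp add: t_def)
  qed
qed

section \<open>The claimed decay rate and its lower bounds by powers\<close>

definition decay :: "real \<Rightarrow> real \<Rightarrow> real \<Rightarrow> real \<Rightarrow> real \<Rightarrow> real" where
  "decay n m b T X = T powr (- (n + b) / m) *
     (1 + T powr (- 1 / m) * X) powr (- ((n * (m - 2) - 2 * b) / (2 * (m - 1))))"

lemma decay_nonneg: "0 \<le> decay n m b T X"
  by (simp add: decay_def)

text \<open>Each of the two inequalities is equivalent to b >= -n/2. The identity clears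
  \<open>m\<close> from the exponent of T once T^(-1/m) has been taken out of the second factor of
  the rate.\<close>

lemma nu_facts:
  fixes n m b :: real
  defines "\<nu> \<equiv> (n * (m - 2) - 2 * b) / (2 * (m - 1))"
  assumes "1 < m" "- n / 2 \<le> b"
  shows "\<nu> \<le> n / 2" "\<nu> \<le> n + b" "(n + b - \<nu>) / m = n / 2 - \<nu>"
proof -
  have "n * (m - 2) - 2 * b \<le> n / 2 * (2 * (m - 1))" using assms by (simp add: algebra_simps)
  then show "\<nu> \<le> n / 2" using assms(2) unfolding \<nu>_def by (subst pos_divide_le_eq) auto
  have "0 \<le> m * (n + 2 * b)" using assms by (intro mult_nonneg_nonneg) auto
  then have "n * (m - 2) - 2 * b \<le> (n + b) * (2 * (m - 1))" by (simp add: algebra_simps)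
  then show "\<nu> \<le> n + b" using assms(2) unfolding \<nu>_def by (subst pos_divide_le_eq) auto
  have "\<nu> * (2 * (m - 1)) = n * (m - 2) - 2 * b" using assms(2) by (simp add: \<nu>_def)
  then show "(n + b - \<nu>) / m = n / 2 - \<nu>" using assms(2) by (simp add: field_simps)
qed

text \<open>A form in which, apart from nu, \<open>m\<close> survives only in
  \<open>T powr (1 / m)\<close>. For T >= t0 that term is at most a multiple of T, which makes the
  rate easy to compare with powers of T and X.\<close>

lemma decay_eq:
  fixes n m b :: real
  defines "\<nu> \<equiv> (n * (m - 2) - 2 * b) / (2 * (m - 1))"
  assumes "1 < m" "- n / 2 \<le> b" "0 < T" "0 \<le> X"
  shows "decay n m b T X = T powr (- (n / 2 - \<nu>)) * (T powr (1 / m) + X) powr (- \<nu>)"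
proof -
  define \<sigma> where "\<sigma> = T powr (1 / m)"
  have \<sigma>: "0 < \<sigma>" using assms by (simp add: \<sigma>_def)
  have "1 + T powr (- 1 / m) * X = (\<sigma> + X) / \<sigma>"
    using \<sigma> assms by (simp add: \<sigma>_def powr_minus_divide field_simps)
  then have "(1 + T powr (- 1 / m) * X) powr (- \<nu>) = (\<sigma> + X) powr (- \<nu>) * T powr (\<nu> / m)"
    using \<sigma> assms(5) by (simp add: powr_divide powr_minus_divide \<sigma>_def powr_powr)
  moreover have "T powr (- (n + b) / m) * T powr (\<nu> / m) = T powr (- (n / 2 - \<nu>))"
  proof -
    have "- (n + b) / m + \<nu> / m = - (n / 2 - \<nu>)"
      using nu_facts(3)[OF assms(2,3), folded \<nu>_def] by (simp add: diff_divide_distrib add_divide_distrib)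
    then show ?thesis by (simp add: powr_add[symmetric])
  qed
  ultimately show ?thesis unfolding decay_def \<nu>_def[symmetric] \<sigma>_def[symmetric] by (simp add: mult_ac)
qed

lemma decay_ge_low:
  assumes m: "1 < m" and b: "- n / 2 \<le> b" and n: "0 < n" and T: "0 < T" "0 \<le> X"
  shows "(n * (m - 2) - 2 * b) / (2 * (m - 1)) < 0 \<Longrightarrow> T powr (- ((n + b) / m)) \<le> decay n m b T X"
proof -
  assume neg: "(n * (m - 2) - 2 * b) / (2 * (m - 1)) < 0"
  define \<nu> where "\<nu> = (n * (m - 2) - 2 * b) / (2 * (m - 1))"
  have e: "- (n + b) / m = - ((n + b) / m)" by (rule minus_divide_left[symmetric])
  have "T powr (- ((n + b) / m)) * 1 \<le> decay n m b T X"
    unfolding decay_def e \<nu>_def[symmetric] using neg[folded \<nu>_def] T by (intro mult_left_mono ge_one_powr_ge_zero) auto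
  then show ?thesis by simp
qed

lemma powr_le_powr_const:
  fixes T t0 M q :: real
  assumes "0 < t0" "t0 \<le> T" "q \<le> M"
  shows "T powr (- M) \<le> t0 powr (- (M - q)) * T powr (- q)"
proof -
  have "T powr (- M) = T powr (- (M - q)) * T powr (- q)"
    by (simp add: powr_add[symmetric])
  also have "\<dots> \<le> t0 powr (- (M - q)) * T powr (- q)"
    using assms by (intro mult_right_mono powr_mono2') auto
  finally show ?thesis .
qed

text \<open>The left-hand side is what low frequencies cost for bounded T. If nu >= 0, then nu <=
  n/2 makes it at most (1 + X)^(-nu), while the factor T^(-(n/2 - nu)) of the rate is bounded below.
  If nu < 0, the second factor of the rate is at least 1 and the first is bounded below.\<close>

lemma decay_ge_small_time:
  assumes m: "1 < m" and b: "- n / 2 \<le> b" and n: "0 < n" and t0: "0 < t0"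
  obtains C where "0 \<le> C" "\<And>T X. 0 < T \<Longrightarrow> T < t0 \<Longrightarrow> 0 \<le> X \<Longrightarrow> (1 + X) powr (- n / 2) \<le> C * decay n m b T X"
proof -
  define \<nu> where "\<nu> = (n * (m - 2) - 2 * b) / (2 * (m - 1))"
  have \<nu>: "\<nu> \<le> n / 2" using nu_facts(1)[OF m b] by (simp add: \<nu>_def)
  define \<sigma>0 where "\<sigma>0 = t0 powr (1 / m)"
  have \<sigma>0: "0 < \<sigma>0" using t0 by (simp add: \<sigma>0_def)
  define C1 where "C1 = t0 powr (n / 2 - \<nu>) * (\<sigma>0 + 1) powr \<nu>"
  define C2 where "C2 = t0 powr ((n + b) / m)"
  show ?thesis
  proof (rule that[of "C1 + C2"])
    show "0 \<le> C1 + C2" by (simp add: C1_def C2_def)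
    fix T X :: real assume T: "0 < T" "T < t0" and X: "0 \<le> X"
    show "(1 + X) powr (- n / 2) \<le> (C1 + C2) * decay n m b T X"
    proof (cases "\<nu> < 0")
      case True
      have "(1 + X) powr (- n / 2) \<le> 1 powr (- n / 2)" using X n by (intro powr_mono2') auto
      also have "\<dots> = C2 * t0 powr (- ((n + b) / m))" using t0 by (simp add: C2_def powr_minus_divide)
      also have "\<dots> \<le> C2 * T powr (- ((n + b) / m))"
        using T m b n by (intro mult_left_mono powr_mono2') (auto simp: C2_def)
      also have "\<dots> \<le> C2 * decay n m b T X"
        using decay_ge_low[OF m b n T(1) X] True unfolding \<nu>_def
        by (intro mult_left_mono) (auto simp: C2_def)
      also have "\<dots> \<le> (C1 + C2) * decay n m b T X"
        by (intro mult_right_mono) (auto simp: C1_def decay_nonneg)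
      finally show ?thesis .
    next
      case False
      have s: "T powr (1 / m) \<le> \<sigma>0" using T m unfolding \<sigma>0_def by (intro powr_mono2) auto
      have "(\<sigma>0 + 1) * (1 + X) = \<sigma>0 + 1 + X + X * \<sigma>0" by (simp add: algebra_simps)
      moreover have "0 \<le> X * \<sigma>0" using X \<sigma>0 by simp
      ultimately have "T powr (1 / m) + X \<le> (\<sigma>0 + 1) * (1 + X)" using s by linarith
      then have "((\<sigma>0 + 1) * (1 + X)) powr (- \<nu>) \<le> (T powr (1 / m) + X) powr (- \<nu>)"
        using False T X by (intro powr_mono2') (auto intro: add_pos_nonneg)
      moreover have "t0 powr (- (n / 2 - \<nu>)) \<le> T powr (- (n / 2 - \<nu>))"
        using T \<nu> by (intro powr_mono2') auto
      ultimately have "t0 powr (- (n / 2 - \<nu>)) * ((\<sigma>0 + 1) * (1 + X)) powr (- \<nu>) \<le> decay n m b T X"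
        unfolding decay_eq[OF m b T(1) X, folded \<nu>_def] by (intro mult_mono) auto
      then have "C1 * (t0 powr (- (n / 2 - \<nu>)) * ((\<sigma>0 + 1) * (1 + X)) powr (- \<nu>)) \<le> C1 * decay n m b T X"
        by (intro mult_left_mono) (auto simp: C1_def)
      moreover have "C1 * (t0 powr (- (n / 2 - \<nu>)) * ((\<sigma>0 + 1) * (1 + X)) powr (- \<nu>)) = (1 + X) powr (- \<nu>)"
        using t0 \<sigma>0 X by (simp add: C1_def powr_mult powr_minus_divide powr_diff)
      moreover have "(1 + X) powr (- n / 2) \<le> (1 + X) powr (- \<nu>)" using \<nu> X by (intro powr_mono) auto
      moreover have "C1 * decay n m b T X \<le> (C1 + C2) * decay n m b T X"
        by (intro mult_right_mono) (auto simp: C2_def decay_nonneg)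
      ultimately show ?thesis by linarith
    qed
  qed
qed

lemma time_root_le:
  fixes t0 T m :: real
  assumes "1 < m" "0 < t0" "t0 \<le> T"
  shows "T powr (1 / m) \<le> t0 powr (1 / m - 1) * T"
proof -
  have "T powr (1 / m) = T powr (1 / m - 1) * T" using assms by (simp add: powr_diff)
  also have "\<dots> \<le> t0 powr (1 / m - 1) * T"
    using assms by (intro mult_right_mono powr_mono2') auto
  finally show ?thesis .
qed

text \<open>For T >= t0 and X > eta T the sum T^(1/m) + X lies between X and a multiple of X, so it
  may be replaced by X for either sign of nu.\<close>

lemma decay_ge_far:
  assumes m: "1 < m" and b: "- n / 2 \<le> b" and n: "0 < n" and t0: "0 < t0" and \<eta>: "0 < \<eta>"
  defines "\<nu> \<equiv> (n * (m - 2) - 2 * b) / (2 * (m - 1))"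
  obtains C where "0 \<le> C" "\<And>T X. t0 \<le> T \<Longrightarrow> \<eta> * T < X \<Longrightarrow>
     T powr (- (n / 2 - \<nu>)) * X powr (- \<nu>) \<le> C * decay n m b T X"
proof -
  define c0 where "c0 = t0 powr (1 / m - 1) / \<eta>"
  have c0: "0 \<le> c0" using \<eta> by (simp add: c0_def)
  show ?thesis
  proof (rule that[of "(1 + c0) powr \<bar>\<nu>\<bar>"])
    show "0 \<le> (1 + c0) powr \<bar>\<nu>\<bar>" by simp
    fix T X assume T: "t0 \<le> T" and X: "\<eta> * T < X"
    have T0: "0 < T" using T t0 by simp
    have X0: "0 < X" using X \<eta> T0 by (meson less_trans mult_pos_pos)
    define \<sigma> where "\<sigma> = T powr (1 / m)"
    have "\<sigma> \<le> c0 * (\<eta> * T)" using time_root_le[OF m t0 T] \<eta> by (simp add: c0_def \<sigma>_def)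
    also have "\<dots> \<le> c0 * X" using X c0 by (intro mult_left_mono) auto
    finally have up: "(\<sigma> + X) / X \<le> 1 + c0" using X0 by (simp add: field_simps)
    have \<sigma>X: "0 < \<sigma> + X" using X0 by (simp add: \<sigma>_def add_nonneg_pos)
    have lo: "1 \<le> (\<sigma> + X) / X" using X0 by (simp add: \<sigma>_def)
    have "((\<sigma> + X) / X) powr \<nu> \<le> ((\<sigma> + X) / X) powr \<bar>\<nu>\<bar>" using lo by (intro powr_mono) auto
    also have "\<dots> \<le> (1 + c0) powr \<bar>\<nu>\<bar>" using lo up by (intro powr_mono2) auto
    finally have "X powr (- \<nu>) \<le> (1 + c0) powr \<bar>\<nu>\<bar> * (\<sigma> + X) powr (- \<nu>)"
      using X0 \<sigma>X by (simp add: powr_divide powr_minus_divide field_simps)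
    then have "T powr (- (n / 2 - \<nu>)) * X powr (- \<nu>)
        \<le> T powr (- (n / 2 - \<nu>)) * ((1 + c0) powr \<bar>\<nu>\<bar> * (\<sigma> + X) powr (- \<nu>))"
      by (intro mult_left_mono) auto
    also have "\<dots> = (1 + c0) powr \<bar>\<nu>\<bar> * decay n m b T X"
      using X0 unfolding decay_eq[OF m b T0 less_imp_le[OF X0], folded \<nu>_def] \<sigma>_def by (simp add: mult_ac)
    finally show "T powr (- (n / 2 - \<nu>)) * X powr (- \<nu>) \<le> (1 + c0) powr \<bar>\<nu>\<bar> * decay n m b T X" .
  qed
qed

text \<open>Serves to compare low frequencies with the rate of the high ones: n/2 - nu is
  nonnegative, so in the corresponding power X may be traded for eta T.\<close>

lemma decay_ge_far_x:
  assumes m: "1 < m" and b: "- n / 2 \<le> b" and n: "0 < n" and t0: "0 < t0" and \<eta>: "0 < \<eta>"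
  obtains C where "0 \<le> C" "\<And>T X. t0 \<le> T \<Longrightarrow> \<eta> * T < X \<Longrightarrow> X powr (- n / 2) \<le> C * decay n m b T X"
proof -
  define \<nu> where "\<nu> = (n * (m - 2) - 2 * b) / (2 * (m - 1))"
  have \<nu>: "\<nu> \<le> n / 2" using nu_facts(1)[OF m b] by (simp add: \<nu>_def)
  obtain C where C: "0 \<le> C" "\<And>T X. t0 \<le> T \<Longrightarrow> \<eta> * T < X \<Longrightarrow>
     T powr (- (n / 2 - \<nu>)) * X powr (- \<nu>) \<le> C * decay n m b T X"
    using decay_ge_far[OF m b n t0 \<eta>] unfolding \<nu>_def by blast
  show ?thesis
  proof (rule that[of "\<eta> powr (- (n / 2 - \<nu>)) * C"])
    show "0 \<le> \<eta> powr (- (n / 2 - \<nu>)) * C" using C by simp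
    fix T X assume T: "t0 \<le> T" and X: "\<eta> * T < X"
    have T0: "0 < T" using T t0 by simp
    have "X powr (- n / 2) = X powr (- (n / 2 - \<nu>)) * X powr (- \<nu>)" by (simp add: powr_add[symmetric])
    also have "\<dots> \<le> (\<eta> * T) powr (- (n / 2 - \<nu>)) * X powr (- \<nu>)"
      using X \<nu> \<eta> T0 by (intro mult_right_mono powr_mono2') auto
    also have "\<dots> = \<eta> powr (- (n / 2 - \<nu>)) * (T powr (- (n / 2 - \<nu>)) * X powr (- \<nu>))"
      using \<eta> T0 by (simp add: powr_mult mult_ac)
    also have "\<dots> \<le> \<eta> powr (- (n / 2 - \<nu>)) * (C * decay n m b T X)"
      using C(2)[OF T X] by (intro mult_left_mono) auto
    finally show "X powr (- n / 2) \<le> \<eta> powr (- (n / 2 - \<nu>)) * C * decay n m b T X" by simp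
  qed
qed

text \<open>When X / T lies between two positive constants, X and T may be exchanged in the rate,
  which then has total order -n/2.\<close>

lemma decay_ge_comparable:
  assumes m: "1 < m" and b: "- n / 2 \<le> b" and n: "0 < n" and t0: "0 < t0" and \<eta>: "0 < \<eta>"
  obtains C where "0 \<le> C" "\<And>T X. t0 \<le> T \<Longrightarrow> \<eta> * T < X \<Longrightarrow> X \<le> N * T \<Longrightarrow> T powr (- n / 2) \<le> C * decay n m b T X"
proof -
  define \<nu> where "\<nu> = (n * (m - 2) - 2 * b) / (2 * (m - 1))"
  obtain C where C: "0 \<le> C" "\<And>T X. t0 \<le> T \<Longrightarrow> \<eta> * T < X \<Longrightarrow>
     T powr (- (n / 2 - \<nu>)) * X powr (- \<nu>) \<le> C * decay n m b T X"
    using decay_ge_far[OF m b n t0 \<eta>] unfolding \<nu>_def by blast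
  define D where "D = \<eta> powr \<nu> + N powr \<nu>"
  show ?thesis
  proof (rule that[of "D * C"])
    show "0 \<le> D * C" using C by (simp add: D_def)
    fix T X assume T: "t0 \<le> T" and X: "\<eta> * T < X" "X \<le> N * T"
    have T0: "0 < T" using T t0 by simp
    have X0: "0 < X" using X \<eta> T0 by (meson less_trans mult_pos_pos)
    have q: "\<eta> \<le> X / T" "X / T \<le> N" "0 < X / T" using X T0 X0 by (auto simp: field_simps)
    have "(X / T) powr \<nu> \<le> D"
    proof (cases "0 \<le> \<nu>")
      case True
      then have "(X / T) powr \<nu> \<le> N powr \<nu>" using q by (intro powr_mono2) auto
      then show ?thesis unfolding D_def using powr_ge_zero[of \<eta> \<nu>] by linarith
    next
      case False
      then have "(X / T) powr \<nu> \<le> \<eta> powr \<nu>" using q \<eta> by (intro powr_mono2') auto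
      then show ?thesis unfolding D_def using powr_ge_zero[of N \<nu>] by linarith
    qed
    then have "(X / T) powr \<nu> * (T powr (- (n / 2 - \<nu>)) * X powr (- \<nu>)) \<le> D * (C * decay n m b T X)"
      using C T X by (intro mult_mono C(2)) (auto simp: D_def)
    moreover have "(X / T) powr \<nu> * (T powr (- (n / 2 - \<nu>)) * X powr (- \<nu>)) = T powr (- n / 2)"
      using X0 T0 by (simp add: powr_divide powr_minus_divide powr_diff)
    ultimately show "T powr (- n / 2) \<le> D * C * decay n m b T X" by simp
  qed
qed

text \<open>Absorbs the non-stationary term T^(-M) of the high frequencies. For nu >= 0 the rate is
  smallest at X = N T, where it has order T^(-n/2); for nu < 0 it is smallest at X = 0, with order
  T^(-(n+b)/m).\<close>

lemma decay_ge_near: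
  assumes m: "1 < m" and b: "- n / 2 \<le> b" and n: "0 < n" and t0: "0 < t0" and M: "n / 2 \<le> M" "n + b \<le> M" and N: "0 < N"
  obtains C where "0 \<le> C" "\<And>T X. t0 \<le> T \<Longrightarrow> 0 \<le> X \<Longrightarrow> X \<le> N * T \<Longrightarrow> T powr (- M) \<le> C * decay n m b T X"
proof -
  define \<nu> where "\<nu> = (n * (m - 2) - 2 * b) / (2 * (m - 1))"
  define c2 where "c2 = t0 powr (1 / m - 1) + N"
  have c2: "0 < c2" using N t0 by (simp add: c2_def add_nonneg_pos)
  have q: "(n + b) / m \<le> M"
  proof -
    have "(n + b) / m \<le> (n + b) / 1" using m b n by (intro divide_left_mono) auto
    then show ?thesis using M by simp
  qed
  define C1 where "C1 = t0 powr (- (M - n / 2)) * c2 powr \<nu>"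
  define C2 where "C2 = t0 powr (- (M - (n + b) / m))"
  show ?thesis
  proof (rule that[of "C1 + C2"])
    show "0 \<le> C1 + C2" by (simp add: C1_def C2_def)
    fix T X assume T: "t0 \<le> T" and X: "0 \<le> X" "X \<le> N * T"
    have T0: "0 < T" using T t0 by simp
    have d: "C1 * decay n m b T X \<le> (C1 + C2) * decay n m b T X" "C2 * decay n m b T X \<le> (C1 + C2) * decay n m b T X"
      by (intro mult_right_mono; simp add: C1_def C2_def decay_nonneg)+
    show "T powr (- M) \<le> (C1 + C2) * decay n m b T X"
    proof (cases "\<nu> < 0")
      case True
      have "T powr (- M) \<le> C2 * T powr (- ((n + b) / m))"
        unfolding C2_def by (rule powr_le_powr_const[OF t0 T q])
      also have "\<dots> \<le> C2 * decay n m b T X"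
        using decay_ge_low[OF m b n T0 X(1)] True unfolding \<nu>_def
        by (intro mult_left_mono) (auto simp: C2_def)
      finally show ?thesis using d by linarith
    next
      case False
      have "T powr (1 / m) + X \<le> c2 * T"
        using time_root_le[OF m t0 T] X by (simp add: c2_def algebra_simps)
      then have "(c2 * T) powr (- \<nu>) \<le> (T powr (1 / m) + X) powr (- \<nu>)"
        using False T0 X by (intro powr_mono2') (auto intro: add_pos_nonneg)
      then have "T powr (- (n / 2 - \<nu>)) * (c2 * T) powr (- \<nu>) \<le> decay n m b T X"
        unfolding decay_eq[OF m b T0 X(1), folded \<nu>_def] by (intro mult_left_mono) auto
      then have "C1 * (T powr (- (n / 2 - \<nu>)) * (c2 * T) powr (- \<nu>)) \<le> C1 * decay n m b T X"
        by (intro mult_left_mono) (auto simp: C1_def)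
      moreover have "C1 * (T powr (- (n / 2 - \<nu>)) * (c2 * T) powr (- \<nu>)) = t0 powr (- (M - n / 2)) * T powr (- (n / 2))"
        using c2 T0 by (simp add: C1_def powr_mult powr_minus_divide powr_diff)
      moreover have "T powr (- M) \<le> t0 powr (- (M - n / 2)) * T powr (- (n / 2))"
        by (rule powr_le_powr_const[OF t0 T M(1)])
      ultimately show ?thesis using d by linarith
    qed
  qed
qed

section \<open>Low and high frequencies together\<close>

lemma piece_bd_zero: "0 \<le> C \<Longrightarrow> piece_bd n m b M C A a0 T X \<rho> 0"
  by (simp add: piece_bd_def)

text \<open>Each range obeys the rate of its own scale by \<open>pieces_integral\<close>. The rest
  is the crossed comparison: \<open>low2\<close> bounds the low frequencies where the second rate is
  claimed, \<open>high1\<close> the high ones where the first is claimed.\<close>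

lemma pieces_integral_two_scale:
  fixes m1 m2 b1 b2 M \<kappa> N t0 :: real
  defines "n \<equiv> real CARD('n::finite)"
  assumes m: "1 < m1" "1 < m2" and b: "- n / 2 \<le> b1" "- n / 2 \<le> b2" and M: "n + b1 < M" "n + b2 < M"
    and C: "0 \<le> C1" "0 \<le> C2" and A: "0 < A1" "0 < A2" and a: "0 < a1" "0 < a2"
    and pos: "0 < \<kappa>" "0 < N" "0 < t0"
  obtains C' where "0 \<le> C'" "\<And>T X (Y1::real^'n \<Rightarrow> real) (Y2::real^'n \<Rightarrow> real).
     Y1 \<in> borel_measurable borel \<Longrightarrow> Y2 \<in> borel_measurable borel \<Longrightarrow> 0 < T \<Longrightarrow> 0 \<le> X \<Longrightarrow>
     (\<And>c. c \<noteq> 0 \<Longrightarrow> norm c < \<kappa> \<Longrightarrow> piece_bd n m1 b1 M C1 A1 a1 T X (norm c) (Y1 c)) \<Longrightarrow>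
     (\<And>c. \<kappa> \<le> norm c \<Longrightarrow> Y1 c = 0) \<Longrightarrow>
     (\<And>c. \<kappa> \<le> norm c \<Longrightarrow> piece_bd n m2 b2 M C2 A2 a2 T X (norm c) (Y2 c)) \<Longrightarrow>
     (\<And>c. norm c < \<kappa> \<Longrightarrow> Y2 c = 0) \<Longrightarrow>
     (T < t0 \<or> N * T < X \<longrightarrow>
        nnint Y1 + nnint Y2 \<le> ennreal (C' * decay n m2 b2 T X)) \<and>
     (t0 \<le> T \<and> X \<le> N * T \<longrightarrow>
        nnint Y1 + nnint Y2 \<le> ennreal (C' * decay n m1 b1 T X))"
proof -
  have n: "1 \<le> n" by (simp add: n_def Suc_leI)
  then have n0: "0 < n" by simp
  obtain P1 where P1: "0 \<le> P1" "\<And>T X (Y::real^'n \<Rightarrow> real). Y \<in> borel_measurable borel \<Longrightarrow> 0 < T \<Longrightarrow> 0 \<le> X \<Longrightarrow>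
     (\<And>c. c \<noteq> 0 \<Longrightarrow> piece_bd n m1 b1 M C1 A1 a1 T X (norm c) (Y c)) \<Longrightarrow>
     nnint Y \<le> ennreal (P1 * decay n m1 b1 T X)"
    using pieces_integral[where ?'n='n, OF m(1) b(1)[unfolded n_def] M(1)[unfolded n_def] C(1) A(1) a(1)]
    unfolding n_def decay_def mult.assoc by blast
  obtain P2 where P2: "0 \<le> P2" "\<And>T X (Y::real^'n \<Rightarrow> real). Y \<in> borel_measurable borel \<Longrightarrow> 0 < T \<Longrightarrow> 0 \<le> X \<Longrightarrow>
     (\<And>c. c \<noteq> 0 \<Longrightarrow> piece_bd n m2 b2 M C2 A2 a2 T X (norm c) (Y c)) \<Longrightarrow>
     nnint Y \<le> ennreal (P2 * decay n m2 b2 T X)"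
    using pieces_integral[where ?'n='n, OF m(2) b(2)[unfolded n_def] M(2)[unfolded n_def] C(2) A(2) a(2)]
    unfolding n_def decay_def mult.assoc by blast
  obtain L where L: "0 \<le> L" "\<And>T X (Y::real^'n \<Rightarrow> real). Y \<in> borel_measurable borel \<Longrightarrow> 0 < T \<Longrightarrow> 0 \<le> X \<Longrightarrow>
     (\<And>c. c \<noteq> 0 \<Longrightarrow> norm c < \<kappa> \<Longrightarrow> piece_bd n m1 b1 M C1 A1 a1 T X (norm c) (Y c)) \<Longrightarrow>
     (\<And>c. \<kappa> \<le> norm c \<Longrightarrow> Y c = 0) \<Longrightarrow>
     nnint Y \<le> ennreal L \<and>
     (0 < X \<longrightarrow> A1 * \<kappa> powr (m1 - 1) * T \<le> X \<longrightarrow> nnint Y \<le> ennreal (L * X powr (- (n + b1)))) \<and>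
     (0 < X \<longrightarrow> N * T \<le> X \<longrightarrow> nnint Y \<le> ennreal (L * (X powr (- (n + b1)) + T powr (- n / 2))))"
    using low_pieces_integral[where ?'n='n and ?a0.0=a1, OF m(1) b(1)[unfolded n_def] M(1)[unfolded n_def] C(1) A(1) pos(1,2)]
    unfolding n_def by blast
  obtain H where H: "0 \<le> H" "\<And>T X (Y::real^'n \<Rightarrow> real). 0 < T \<Longrightarrow> 0 \<le> X \<Longrightarrow> X \<le> N * T \<Longrightarrow>
     (\<And>c. \<kappa> \<le> norm c \<Longrightarrow> piece_bd n m2 b2 M C2 A2 a2 T X (norm c) (Y c)) \<Longrightarrow>
     (\<And>c. norm c < \<kappa> \<Longrightarrow> Y c = 0) \<Longrightarrow>
     nnint Y
        \<le> ennreal (H * (T powr (- M) + (if a2 * \<kappa> powr (m2 - 1) * T < X then T powr (- n / 2) else 0)))"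
    using high_pieces_integral[where ?'n='n and A=A2, OF m(2) b(2)[unfolded n_def] M(2)[unfolded n_def] C(2) a(2) pos(1,2)]
    unfolding n_def by blast
  define N' where "N' = A1 * \<kappa> powr (m1 - 1)"
  have N': "0 < N'" using A pos by (simp add: N'_def)
  define N'' where "N'' = a2 * \<kappa> powr (m2 - 1)"
  have N'': "0 < N''" using a pos by (simp add: N''_def)
  obtain D1 where D1: "0 \<le> D1" "\<And>T X. 0 < T \<Longrightarrow> T < t0 \<Longrightarrow> 0 \<le> X \<Longrightarrow> (1 + X) powr (- n / 2) \<le> D1 * decay n m2 b2 T X"
    using decay_ge_small_time[OF m(2) b(2) n0 pos(3)] by blast
  obtain D2 where D2: "0 \<le> D2" "\<And>T X. t0 \<le> T \<Longrightarrow> N * T < X \<Longrightarrow> X powr (- n / 2) \<le> D2 * decay n m2 b2 T X"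
    using decay_ge_far_x[OF m(2) b(2) n0 pos(3,2)] by blast
  obtain D3 where D3: "0 \<le> D3" "\<And>T X. t0 \<le> T \<Longrightarrow> N'' * T < X \<Longrightarrow> X \<le> N * T \<Longrightarrow> T powr (- n / 2) \<le> D3 * decay n m1 b1 T X"
    using decay_ge_comparable[OF m(1) b(1) n0 pos(3) N''] by blast
  have Mn: "n / 2 \<le> M" "n + b1 \<le> M" using b M by auto
  obtain D4 where D4: "0 \<le> D4" "\<And>T X. t0 \<le> T \<Longrightarrow> 0 \<le> X \<Longrightarrow> X \<le> N * T \<Longrightarrow> T powr (- M) \<le> D4 * decay n m1 b1 T X"
    using decay_ge_near[OF m(1) b(1) n0 pos(3) Mn pos(2)] by blast
  \<comment> \<open>For T < t0 and X >= X0 one has X >= N' T, so the linear phase dominates at all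
    low frequencies; for X < X0 the plain bound \<open>L\<close> suffices.\<close>
  define X0 where "X0 = N' * t0"
  have X0: "0 < X0" using N' pos by (simp add: X0_def)
  define E1 where "E1 = L * (1 + X0) powr (n / 2)"
  define E2 where "E2 = L * (X0 powr (- (n / 2 + b1)) * (1 / X0 + 1) powr (n / 2))"
  define E3 where "E3 = L * ((N * t0) powr (- (n / 2 + b1)) + N' powr (n / 2))"
  have E: "0 \<le> E1" "0 \<le> E2" "0 \<le> E3" using L by (auto simp: E1_def E2_def E3_def)
  define Q2 where "Q2 = P2 + (E1 + E2) * D1 + E3 * D2"
  define Q1 where "Q1 = P1 + H * (D3 + D4)"
  have Q: "0 \<le> Q1" "0 \<le> Q2" using E P1 P2 H D1 D2 D3 D4 by (auto simp: Q1_def Q2_def)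
  \<comment> \<open>Since b1 >= -n/2, the exponent -(n + b1) is at most -n/2, and away from the
    origin the excess is a constant.\<close>
  have xs: "x powr (- (n + b1)) \<le> x0 powr (- (n / 2 + b1)) * x powr (- n / 2)" if "0 < x0" "x0 \<le> x" for x x0
    using powr_le_powr_const[OF that, of "n / 2" "n + b1"] b by simp
  show ?thesis
  proof (rule that[of "Q1 + Q2"])
    show "0 \<le> Q1 + Q2" using Q by simp
    fix T X and Y1 Y2 :: "real^'n \<Rightarrow> real"
    assume Ym: "Y1 \<in> borel_measurable borel" "Y2 \<in> borel_measurable borel" and T: "0 < T" and X: "0 \<le> X"
     and Y1: "\<And>c. c \<noteq> 0 \<Longrightarrow> norm c < \<kappa> \<Longrightarrow> piece_bd n m1 b1 M C1 A1 a1 T X (norm c) (Y1 c)"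
     and Y10: "\<And>c. \<kappa> \<le> norm c \<Longrightarrow> Y1 c = 0"
     and Y2: "\<And>c. \<kappa> \<le> norm c \<Longrightarrow> piece_bd n m2 b2 M C2 A2 a2 T X (norm c) (Y2 c)"
     and Y20: "\<And>c. norm c < \<kappa> \<Longrightarrow> Y2 c = 0"
    let ?I1 = "nnint Y1" and ?I2 = "nnint Y2"
    have full1: "?I1 \<le> ennreal (P1 * decay n m1 b1 T X)"
    proof (rule P1(2)[OF Ym(1) T X])
      fix c :: "real^'n" assume "c \<noteq> 0"
      then show "piece_bd n m1 b1 M C1 A1 a1 T X (norm c) (Y1 c)"
        using Y1 Y10 piece_bd_zero[OF C(1)] by (cases "norm c < \<kappa>") auto
    qed
    have full2: "?I2 \<le> ennreal (P2 * decay n m2 b2 T X)"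
    proof (rule P2(2)[OF Ym(2) T X])
      fix c :: "real^'n" assume "c \<noteq> 0"
      show "piece_bd n m2 b2 M C2 A2 a2 T X (norm c) (Y2 c)"
        using Y2 Y20 piece_bd_zero[OF C(2)] by (cases "norm c < \<kappa>") auto
    qed
    note low = L(2)[OF Ym(1) T X Y1 Y10]
    have low2: "?I1 \<le> ennreal (((E1 + E2) * D1 + E3 * D2) * decay n m2 b2 T X)" if "T < t0 \<or> N * T < X"
    proof (cases "T < t0")
      case True
      have d: "(1 + X) powr (- n / 2) \<le> D1 * decay n m2 b2 T X" by (rule D1(2)[OF T True X])
      have "?I1 \<le> ennreal ((E1 + E2) * (1 + X) powr (- n / 2))"
      proof (cases "X0 \<le> X")
        case False
        have "(1 + X) powr (n / 2) \<le> (1 + X0) powr (n / 2)" using False X n0 by (intro powr_mono2) auto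
        then have "1 \<le> (1 + X0) powr (n / 2) * (1 + X) powr (- n / 2)"
          using X by (simp add: powr_minus_divide)
        then have "L * 1 \<le> L * ((1 + X0) powr (n / 2) * (1 + X) powr (- n / 2))"
          using L(1) by (intro mult_left_mono)
        also have "\<dots> \<le> (E1 + E2) * (1 + X) powr (- n / 2)"
          using E by (simp add: E1_def distrib_right)
        finally have "L \<le> (E1 + E2) * (1 + X) powr (- n / 2)" by simp
        then show ?thesis using low by (intro order_trans[OF conjunct1[OF low]] ennreal_leI)
      next
        case True': True
        have Xp: "0 < X" using True' X0 by simp
        have "N' * T \<le> X0" using True N' by (simp add: X0_def)
        then have "?I1 \<le> ennreal (L * X powr (- (n + b1)))"
          using low Xp True' unfolding N'_def by auto
        also have "\<dots> \<le> ennreal ((E1 + E2) * (1 + X) powr (- n / 2))"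
        proof (rule ennreal_leI)
          have "1 + X \<le> (1 / X0 + 1) * X" using True' X0 by (simp add: field_simps)
          then have "(1 + X) powr (n / 2) \<le> ((1 / X0 + 1) * X) powr (n / 2)"
            using X n0 by (intro powr_mono2) auto
          moreover have "x powr (- n / 2) \<le> z powr (n / 2) * (1 + x) powr (- n / 2)"
            if "(1 + x) powr (n / 2) \<le> (z * x) powr (n / 2)" "0 < x" "0 < z" for x z
            using that by (simp add: powr_mult powr_minus_divide field_simps)
          ultimately have "X powr (- n / 2) \<le> (1 / X0 + 1) powr (n / 2) * (1 + X) powr (- n / 2)"
            using Xp X0 by (simp add: add_pos_pos)
          then have "X0 powr (- (n / 2 + b1)) * X powr (- n / 2)
             \<le> X0 powr (- (n / 2 + b1)) * ((1 / X0 + 1) powr (n / 2) * (1 + X) powr (- n / 2))"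
            by (intro mult_left_mono) auto
          with xs[OF X0 True'] have "X powr (- (n + b1))
             \<le> X0 powr (- (n / 2 + b1)) * ((1 / X0 + 1) powr (n / 2) * (1 + X) powr (- n / 2))" by linarith
          then have "L * X powr (- (n + b1))
             \<le> L * (X0 powr (- (n / 2 + b1)) * ((1 / X0 + 1) powr (n / 2) * (1 + X) powr (- n / 2)))"
            using L(1) by (intro mult_left_mono)
          also have "\<dots> = E2 * (1 + X) powr (- n / 2)" by (simp add: E2_def mult_ac)
          also have "\<dots> \<le> (E1 + E2) * (1 + X) powr (- n / 2)" using E by (simp add: distrib_right)
          finally show "L * X powr (- (n + b1)) \<le> (E1 + E2) * (1 + X) powr (- n / 2)" .
        qed
        finally show ?thesis .
      qed
      also have "\<dots> \<le> ennreal (((E1 + E2) * D1 + E3 * D2) * decay n m2 b2 T X)"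
      proof (rule ennreal_leI)
        have "(E1 + E2) * (1 + X) powr (- n / 2) \<le> (E1 + E2) * (D1 * decay n m2 b2 T X)"
          using d E by (intro mult_left_mono) auto
        moreover have "0 \<le> E3 * D2 * decay n m2 b2 T X" using E D2 decay_nonneg by auto
        ultimately show "(E1 + E2) * (1 + X) powr (- n / 2) \<le> ((E1 + E2) * D1 + E3 * D2) * decay n m2 b2 T X"
          by (simp add: algebra_simps)
      qed
      finally show ?thesis .
    next
      case False
      then have T': "t0 \<le> T" and X': "N * T < X" using that by auto
      have Nt: "N * t0 \<le> X" using T' X' pos mult_left_mono[of t0 T N] by linarith
      have Nt0: "0 < N * t0" using pos by simp
      have Xp: "0 < X" using Nt Nt0 by linarith
      have "?I1 \<le> ennreal (E3 * X powr (- n / 2))"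
      proof (cases "N' * T \<le> X")
        case True
        then have "?I1 \<le> ennreal (L * X powr (- (n + b1)))"
          using low Xp unfolding N'_def by auto
        also have "\<dots> \<le> ennreal (E3 * X powr (- n / 2))"
        proof (rule ennreal_leI)
          have "L * X powr (- (n + b1)) \<le> L * ((N * t0) powr (- (n / 2 + b1)) * X powr (- n / 2))"
            using L(1) xs[OF Nt0 Nt] by (intro mult_left_mono)
          also have "\<dots> \<le> E3 * X powr (- n / 2)"
            using L(1) by (simp add: E3_def algebra_simps)
          finally show "L * X powr (- (n + b1)) \<le> E3 * X powr (- n / 2)" .
        qed
        finally show ?thesis .
      next
        \<comment> \<open>Here N T < X < N' T, so T^(-n/2) is at most a multiple of
          X^(-n/2).\<close>
        case False
        have "?I1 \<le> ennreal (L * (X powr (- (n + b1)) + T powr (- n / 2)))"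
          using low Xp X' by auto
        also have "\<dots> \<le> ennreal (E3 * X powr (- n / 2))"
        proof (rule ennreal_leI)
          have "X powr (n / 2) \<le> (N' * T) powr (n / 2)" using False Xp n0 by (intro powr_mono2) auto
          then have "T powr (- n / 2) \<le> N' powr (n / 2) * X powr (- n / 2)"
            using Xp T N' by (simp add: powr_mult powr_minus_divide field_simps)
          then have "X powr (- (n + b1)) + T powr (- n / 2)
              \<le> (N * t0) powr (- (n / 2 + b1)) * X powr (- n / 2) + N' powr (n / 2) * X powr (- n / 2)"
            using xs[OF Nt0 Nt] by linarith
          then have "L * (X powr (- (n + b1)) + T powr (- n / 2))
              \<le> L * ((N * t0) powr (- (n / 2 + b1)) * X powr (- n / 2) + N' powr (n / 2) * X powr (- n / 2))"
            using L(1) by (intro mult_left_mono)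
          then show "L * (X powr (- (n + b1)) + T powr (- n / 2)) \<le> E3 * X powr (- n / 2)"
            by (simp add: E3_def algebra_simps)
        qed
        finally show ?thesis .
      qed
      also have "\<dots> \<le> ennreal (((E1 + E2) * D1 + E3 * D2) * decay n m2 b2 T X)"
      proof (rule ennreal_leI)
        have "E3 * X powr (- n / 2) \<le> E3 * (D2 * decay n m2 b2 T X)"
          using D2(2)[OF T' X'] E by (intro mult_left_mono) auto
        moreover have "0 \<le> (E1 + E2) * D1 * decay n m2 b2 T X" using E D1 decay_nonneg by auto
        ultimately show "E3 * X powr (- n / 2) \<le> ((E1 + E2) * D1 + E3 * D2) * decay n m2 b2 T X"
          by (simp add: algebra_simps)
      qed
      finally show ?thesis .
    qed
    have high1: "?I2 \<le> ennreal (H * (D3 + D4) * decay n m1 b1 T X)" if "t0 \<le> T" "X \<le> N * T"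
    proof -
      have "?I2 \<le> ennreal (H * (T powr (- M) + (if N'' * T < X then T powr (- n / 2) else 0)))"
        unfolding N''_def by (rule H(2)[OF T X that(2) Y2 Y20])
      also have "\<dots> \<le> ennreal (H * (D3 + D4) * decay n m1 b1 T X)"
      proof (rule ennreal_leI)
        have "(if N'' * T < X then T powr (- n / 2) else 0) \<le> D3 * decay n m1 b1 T X"
          using D3 that decay_nonneg by auto
        with D4(2)[OF that(1) X that(2)]
        have "T powr (- M) + (if N'' * T < X then T powr (- n / 2) else 0) \<le> (D3 + D4) * decay n m1 b1 T X"
          by (simp add: distrib_right)
        then have "H * (T powr (- M) + (if N'' * T < X then T powr (- n / 2) else 0)) \<le> H * ((D3 + D4) * decay n m1 b1 T X)"
          using H(1) by (intro mult_left_mono)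
        then show "H * (T powr (- M) + (if N'' * T < X then T powr (- n / 2) else 0)) \<le> H * (D3 + D4) * decay n m1 b1 T X"
          by simp
      qed
      finally show ?thesis .
    qed
    have add: "?I1 + ?I2 \<le> ennreal ((Q1 + Q2) * d)"
      if "?I1 \<le> ennreal (x * d)" "?I2 \<le> ennreal (y * d)" "0 \<le> x" "0 \<le> y" "0 \<le> d" "x + y \<le> Q1 + Q2" for x y d
    proof -
      have "?I1 + ?I2 \<le> ennreal (x * d) + ennreal (y * d)" using that by (intro add_mono)
      also have "\<dots> = ennreal ((x + y) * d)" using that by (simp add: distrib_right)
      also have "\<dots> \<le> ennreal ((Q1 + Q2) * d)" using that by (intro ennreal_leI mult_right_mono)
      finally show ?thesis .
    qed
    show "(T < t0 \<or> N * T < X \<longrightarrow> ?I1 + ?I2 \<le> ennreal ((Q1 + Q2) * decay n m2 b2 T X)) \<and>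
     (t0 \<le> T \<and> X \<le> N * T \<longrightarrow> ?I1 + ?I2 \<le> ennreal ((Q1 + Q2) * decay n m1 b1 T X))"
    proof (intro conjI impI)
      assume "T < t0 \<or> N * T < X"
      from low2[OF this] full2 show "?I1 + ?I2 \<le> ennreal ((Q1 + Q2) * decay n m2 b2 T X)"
        by (rule add) (use E D1 D2 P2 Q in \<open>auto simp: decay_nonneg Q2_def\<close>)
    next
      assume "t0 \<le> T \<and> X \<le> N * T"
      then have "?I2 \<le> ennreal (H * (D3 + D4) * decay n m1 b1 T X)" using high1 by blast
      with full1 show "?I1 + ?I2 \<le> ennreal ((Q1 + Q2) * decay n m1 b1 T X)"
        by (rule add) (use H D3 D4 P1 Q in \<open>auto simp: decay_nonneg Q1_def\<close>)
    qed
  qed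
qed

subsection \<open>The continuous partition of unity\<close>

text \<open>The weight is supported where \<open>norm (\<xi> - c) \<le> r \<cdot> norm \<xi>\<close>, and its joint homogeneity of degree \<open>-n\<close> in
  \<open>(c, \<xi>)\<close> makes its integral over \<open>c\<close> independent of \<open>\<xi> \<noteq> 0\<close>.  It has fewer than \<open>q\<close> derivatives, which is
  enough since only finitely many integrations by parts are needed.\<close>
definition wgt :: "nat \<Rightarrow> real \<Rightarrow> real^'n::finite \<Rightarrow> real^'n \<Rightarrow> real" where
  "wgt q r c \<xi> = max 0 (r\<^sup>2 * (\<xi> \<bullet> \<xi>) - (\<xi> - c) \<bullet> (\<xi> - c)) ^ q * (\<xi> \<bullet> \<xi>) powr (- (real q + real CARD('n) / 2))"

lemma wgt_nonneg: "0 \<le> wgt q r c \<xi>"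
  by (simp add: wgt_def)

lemma wgt_eq_0:
  assumes "0 < q" "0 \<le> r" "r * norm \<xi> \<le> norm (\<xi> - c)"
  shows "wgt q r c \<xi> = 0"
proof -
  have "(r * norm \<xi>)\<^sup>2 \<le> (norm (\<xi> - c))\<^sup>2" using assms by (intro power_mono) auto
  then have "r\<^sup>2 * (\<xi> \<bullet> \<xi>) - (\<xi> - c) \<bullet> (\<xi> - c) \<le> 0"
    by (simp add: power_mult_distrib dot_square_norm)
  then show ?thesis using assms(1) by (simp add: wgt_def max_def zero_power)
qed

lemma wgt_scale:
  assumes "0 < \<rho>"
  shows "wgt q r (\<rho> *\<^sub>R c) (\<rho> *\<^sub>R \<xi>) = \<rho> powr (- real CARD('n)) * wgt q r c (\<xi>::real^'n::finite)"
proof -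
  let ?n = "real CARD('n)"
  have 1: "r\<^sup>2 * ((\<rho> *\<^sub>R \<xi>) \<bullet> (\<rho> *\<^sub>R \<xi>)) - (\<rho> *\<^sub>R \<xi> - \<rho> *\<^sub>R c) \<bullet> (\<rho> *\<^sub>R \<xi> - \<rho> *\<^sub>R c)
      = \<rho>\<^sup>2 * (r\<^sup>2 * (\<xi> \<bullet> \<xi>) - (\<xi> - c) \<bullet> (\<xi> - c))"
    by (simp add: scaleR_diff_right[symmetric] power2_eq_square algebra_simps del: scaleR_diff_right)
  have 2: "max 0 (\<rho>\<^sup>2 * z) = \<rho>\<^sup>2 * max 0 z" for z
    using assms by (simp add: max_def zero_le_mult_iff)
  have 3: "((\<rho> *\<^sub>R \<xi>) \<bullet> (\<rho> *\<^sub>R \<xi>)) = \<rho>\<^sup>2 * (\<xi> \<bullet> \<xi>)" by (simp add: power2_eq_square)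
  have "(\<rho>\<^sup>2) ^ q * (\<rho>\<^sup>2) powr (- (real q + ?n / 2)) = \<rho> powr (- ?n)"
  proof -
    have "\<rho>\<^sup>2 = \<rho> powr 2" using assms by simp
    then have "(\<rho>\<^sup>2) ^ q = \<rho> powr (2 * real q)" "(\<rho>\<^sup>2) powr (- (real q + ?n / 2)) = \<rho> powr (2 * (- (real q + ?n / 2)))"
      using assms by (simp_all only: powr_powr powr_realpow[symmetric] powr_gt_zero[THEN iffD2])
    then show ?thesis by (simp add: powr_add[symmetric])
  qed
  moreover have "(\<rho>\<^sup>2 * x) ^ q * (\<rho>\<^sup>2 * z) powr e = ((\<rho>\<^sup>2) ^ q * (\<rho>\<^sup>2) powr e) * (x ^ q * z powr e)"
    if "0 \<le> z" for x z e
    using that by (simp add: power_mult_distrib powr_mult)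
  ultimately show ?thesis
    unfolding wgt_def unfolding 1 2 unfolding 3 by simp
qed

section \<open>Derivative bounds for the weight\<close>

lemma has_pd_sqdist: "has_pd i (\<lambda>x. (x - p) \<bullet> (x - p)) x (2 * (x - p) $ i)"
proof -
  have "has_pd i (\<lambda>x. x - p) x (axis i 1)"
    unfolding has_pd_def by (auto intro!: derivative_eq_intros)
  from has_pd_bilinear[OF bounded_bilinear_inner this this] show ?thesis
    by (simp add: inner_axis inner_axis')
qed

lemma pd_bd_sqdist:
  assumes "\<And>x. x \<in> U \<Longrightarrow> norm (x - p) \<le> 2"
  shows "pd_bd i k 4 U (\<lambda>x. (x - p) \<bullet> (x - p))"
proof (cases k)
  have b0: "norm ((x - p) \<bullet> (x - p)) \<le> 4" if "x \<in> U" for x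
    using power_mono[OF assms[OF that], of 2] by (simp add: dot_square_norm)
  have c0: "continuous_on U (\<lambda>x. (x - p) \<bullet> (x - p))" by (intro continuous_intros)
  {
    case 0
    then show ?thesis using b0 c0 by simp
  next
    case (Suc j)
    have b1: "norm (2 * (x - p) $ i) \<le> 4" if "x \<in> U" for x
      using component_le_norm_cart[of "x - p" i] assms[OF that] by simp
    have c1: "continuous_on U (\<lambda>x. 2 * (x - p) $ i)" by (intro continuous_intros)
    have "pd_bd i j 4 U (\<lambda>x. 2 * (x - p) $ i)"
    proof (cases j)
      case 0
      then show ?thesis using b1 c1 by simp
    next
      case (Suc l)
      have "has_pd i (\<lambda>x. 2 * (x - p) $ i) x 2" for x
        unfolding has_pd_def by (auto intro!: derivative_eq_intros)
      then show ?thesis unfolding Suc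
        by (intro pd_bd_SucI[where f'="\<lambda>x. 2"] c1 b1 pd_bd_const) auto
    qed
    then show ?thesis unfolding Suc
      using pd_bd_SucI[OF c0 b0 has_pd_sqdist] by blast
  }
qed

text \<open>The exponent is at least 2, so that the difference quotient at 0 is a truncated power of
  positive order and tends to 0.\<close>

lemma DERIV_max_power:
  fixes y :: real
  shows "((\<lambda>y. max 0 y ^ Suc (Suc p)) has_real_derivative real (Suc (Suc p)) * max 0 y ^ Suc p) (at y)"
proof -
  consider "y < 0" | "y = 0" | "0 < y" by linarith
  then show ?thesis
  proof cases
    case 1
    have "((\<lambda>y. max 0 y ^ Suc (Suc p)) has_real_derivative 0) (at y)"
      by (rule has_field_derivative_transform_within_open[OF DERIV_const[of 0], of "{..<0}"]) (use 1 in auto)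
    then show ?thesis using 1 by simp
  next
    case 3
    have "((\<lambda>y. y ^ Suc (Suc p)) has_real_derivative real (Suc (Suc p)) * y ^ Suc p) (at y)"
      using DERIV_pow[of "Suc (Suc p)" y UNIV] by simp
    then have "((\<lambda>y. max 0 y ^ Suc (Suc p)) has_real_derivative real (Suc (Suc p)) * y ^ Suc p) (at y)"
      by (rule has_field_derivative_transform_within_open[of _ _ _ "{0<..}"]) (use 3 in auto)
    then show ?thesis using 3 by simp
  next
    case 2
    have "((\<lambda>h. max 0 h * max 0 h ^ p) \<longlongrightarrow> max 0 0 * max 0 0 ^ p) (at (0::real))"
      by (intro tendsto_intros)
    then have lim: "((\<lambda>h. max 0 h * max 0 h ^ p) \<longlongrightarrow> 0) (at (0::real))" by simp
    have eq: "max 0 h ^ Suc (Suc p) / h = max 0 h * max 0 h ^ p" if "h \<noteq> 0" for h :: real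
      using that by (simp add: max_def)
    have "((\<lambda>h. max 0 h ^ Suc (Suc p) / h) \<longlongrightarrow> 0) (at (0::real))"
    proof (rule Lim_transform_eventually[OF lim])
      show "\<forall>\<^sub>F h in at (0::real). max 0 h * max 0 h ^ p = max 0 h ^ Suc (Suc p) / h"
        unfolding eventually_at_filter
      proof (intro always_eventually allI impI)
        fix h :: real assume "h \<noteq> 0"
        then show "max 0 h * max 0 h ^ p = max 0 h ^ Suc (Suc p) / h" by (rule eq[symmetric])
      qed
    qed
    then show ?thesis unfolding 2 has_field_derivative_iff by simp
  qed
qed

lemma pd_bd_max_power:
  assumes "k < q" "0 \<le> L"
  obtains K where "0 \<le> K" "\<And>i U (f::real^'n::finite \<Rightarrow> real). pd_bd i k L U f \<Longrightarrow> pd_bd i k K U (\<lambda>x. max 0 (f x) ^ q)"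
proof -
  define H :: "nat \<Rightarrow> real \<Rightarrow> real" where "H j y = (\<Prod>l<j. real (q - l)) * max 0 y ^ (q - j)" for j y
  define B where "B = (\<Sum>j\<le>k. (\<Prod>l<j. real (q - l)) * L ^ (q - j))"
  have B: "0 \<le> B" using assms by (auto simp: B_def intro!: sum_nonneg mult_nonneg_nonneg prod_nonneg)
  show ?thesis
  proof (rule that[of "comp_bound k B L"])
    show "0 \<le> comp_bound k B L" using assms B by (intro comp_bound_nonneg)
    fix i U and f :: "real^'n \<Rightarrow> real"
    assume f: "pd_bd i k L U f"
    have "pd_bd i k (comp_bound k B L) U (\<lambda>x. H 0 (f x))"
    proof (rule pd_bd_comp[OF B assms(2) f])
      fix j x assume "j < k" "x \<in> U"
      \<comment> \<open>From \<open>j < k\<close> and \<open>k < q\<close> follows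
        \<open>q - j \<ge> 2\<close>, so the natural subtraction is exact and the truncated power is
        still differentiable.\<close>
      define p where "p = q - j - 2"
      have p: "q - j = Suc (Suc p)" using assms(1) \<open>j < k\<close> by (auto simp: p_def)
      have "((\<lambda>y. (\<Prod>l<j. real (q - l)) * max 0 y ^ Suc (Suc p)) has_real_derivative
         (\<Prod>l<j. real (q - l)) * (real (Suc (Suc p)) * max 0 (f x) ^ Suc p)) (at (f x))"
        by (intro DERIV_cmult DERIV_max_power)
      moreover have "q - Suc j = Suc p" using p by simp
      then have "H (Suc j) (f x) = (\<Prod>l<j. real (q - l)) * (real (Suc (Suc p)) * max 0 (f x) ^ Suc p)"
        by (simp only: H_def prod.lessThan_Suc p mult.assoc)
      moreover have "H j = (\<lambda>y. (\<Prod>l<j. real (q - l)) * max 0 y ^ Suc (Suc p))"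
        by (simp only: H_def[abs_def] p)
      ultimately show "(H j has_real_derivative H (Suc j) (f x)) (at (f x))"
        by (simp only:)
    next
      fix j assume "j \<le> k"
      show "continuous_on (f ` U) (H j)" unfolding H_def by (intro continuous_intros)
    next
      fix j x assume *: "j \<le> k" "x \<in> U"
      have "\<bar>H j (f x)\<bar> = (\<Prod>l<j. real (q - l)) * max 0 (f x) ^ (q - j)"
        by (simp add: H_def abs_mult prod_nonneg)
      also have "\<dots> \<le> (\<Prod>l<j. real (q - l)) * L ^ (q - j)"
        using pd_bd_norm[OF f *(2)] assms by (intro mult_left_mono power_mono prod_nonneg) auto
      also have "\<dots> \<le> B"
        unfolding B_def using * assms by (intro member_le_sum) (auto intro!: mult_nonneg_nonneg prod_nonneg)
      finally show "\<bar>H j (f x)\<bar> \<le> B" .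
    qed
    then show "pd_bd i k (comp_bound k B L) U (\<lambda>x. max 0 (f x) ^ q)" by (simp add: H_def)
  qed
qed

lemma pd_bd_powr:
  fixes p c L :: real
  assumes "0 < c" "c \<le> L"
  obtains K where "0 \<le> K" "\<And>i U (f::real^'n::finite \<Rightarrow> real). pd_bd i k L U f \<Longrightarrow>
     (\<And>x. x \<in> U \<Longrightarrow> c \<le> f x) \<Longrightarrow> pd_bd i k K U (\<lambda>x. f x powr p)"
proof -
  define H :: "nat \<Rightarrow> real \<Rightarrow> real" where "H j y = (\<Prod>l<j. p - real l) * y powr (p - real j)" for j y
  \<comment> \<open>The exponent \<open>p - real j\<close> may have either sign; the values at both
    ends of the interval from \<open>c\<close> to \<open>L\<close> cover the two cases.\<close>
  define B where "B = (\<Sum>j\<le>k. \<bar>\<Prod>l<j. p - real l\<bar> * (c powr (p - real j) + L powr (p - real j)))"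
  have B: "0 \<le> B" by (auto simp: B_def intro!: sum_nonneg)
  have L: "0 \<le> L" using assms by simp
  show ?thesis
  proof (rule that[of "comp_bound k B L"])
    show "0 \<le> comp_bound k B L" using L B by (intro comp_bound_nonneg)
    fix i U and f :: "real^'n \<Rightarrow> real"
    assume f: "pd_bd i k L U f" "\<And>x. x \<in> U \<Longrightarrow> c \<le> f x"
    have pos: "0 < f x" if "x \<in> U" for x using f(2)[OF that] assms by simp
    have "pd_bd i k (comp_bound k B L) U (\<lambda>x. H 0 (f x))"
    proof (rule pd_bd_comp[OF B L f(1)])
      fix j x assume "j < k" "x \<in> U"
      then have "((\<lambda>y. y powr (p - real j)) has_real_derivative (p - real j) * f x powr (p - real j - 1)) (at (f x))"
        using pos by (intro has_real_derivative_powr) auto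
      from DERIV_cmult[OF this, of "\<Prod>l<j. p - real l"]
      show "(H j has_real_derivative H (Suc j) (f x)) (at (f x))"
        unfolding H_def[abs_def] by (simp add: mult_ac diff_diff_eq add.commute)
    next
      fix j assume "j \<le> k"
      show "continuous_on (f ` U) (H j)" unfolding H_def using pos
        by (intro continuous_intros) (auto simp: less_imp_neq[symmetric])
    next
      fix j x assume *: "j \<le> k" "x \<in> U"
      have fx: "c \<le> f x" "f x \<le> L" using f(2)[OF *(2)] pd_bd_norm[OF f(1) *(2)] by auto
      have "f x powr (p - real j) \<le> c powr (p - real j) + L powr (p - real j)"
      proof (cases "0 \<le> p - real j")
        case True
        then have "f x powr (p - real j) \<le> L powr (p - real j)" using fx assms by (intro powr_mono2) auto
        then show ?thesis using powr_ge_zero[of c "p - real j"] by linarith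
      next
        case False
        then have "f x powr (p - real j) \<le> c powr (p - real j)" using fx assms by (intro powr_mono2') auto
        then show ?thesis using powr_ge_zero[of L "p - real j"] by linarith
      qed
      then have "\<bar>H j (f x)\<bar> \<le> \<bar>\<Prod>l<j. p - real l\<bar> * (c powr (p - real j) + L powr (p - real j))"
        unfolding H_def abs_mult by (intro mult_left_mono) auto
      also have "\<dots> \<le> B"
        unfolding B_def using * by (intro member_le_sum) auto
      finally show "\<bar>H j (f x)\<bar> \<le> B" .
    qed
    then show "pd_bd i k (comp_bound k B L) U (\<lambda>x. f x powr p)" by (simp add: H_def)
  qed
qed

text \<open>Within distance 1/2 of a unit vector the norm is at least 1/2, so the real power of
  \<open>x \<bullet> x\<close> is smooth there; the truncated power limits the order to
  \<open>k < q\<close>. One bound serves all unit vectors.\<close>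

lemma pd_bd_wgt:
  assumes "k < q" "0 \<le> r" "r \<le> 1"
  obtains K where "0 \<le> K" "\<And>i u. norm u = 1 \<Longrightarrow> pd_bd i k K (ball (u::real^'n::finite) (1/2)) (wgt q r u)"
proof -
  obtain K1 where K1: "0 \<le> K1" "\<And>i U (f::real^'n \<Rightarrow> real). pd_bd i k (2 ^ k * (1 * 4) + 4) U f \<Longrightarrow> pd_bd i k K1 U (\<lambda>x. max 0 (f x) ^ q)"
    using pd_bd_max_power[where ?'n='n and L="2 ^ k * (1 * 4) + 4", OF assms(1)] by auto
  obtain K2 where K2: "0 \<le> K2" "\<And>i U (f::real^'n::finite \<Rightarrow> real). pd_bd i k 4 U f \<Longrightarrow>
     (\<And>x. x \<in> U \<Longrightarrow> 1/4 \<le> f x) \<Longrightarrow> pd_bd i k K2 U (\<lambda>x. f x powr (- (real q + real CARD('n) / 2)))"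
    using pd_bd_powr[where ?'n='n and c="1/4" and L=4 and k=k and p="- (real q + real CARD('n) / 2)"] by auto
  show ?thesis
  proof (rule that[of "2 ^ k * (K1 * K2)"])
    show "0 \<le> 2 ^ k * (K1 * K2)" using K1 K2 by simp
    fix i and u :: "real^'n" assume u: "norm u = 1"
    let ?U = "ball u (1/2)"
    have nx: "norm x \<le> 2" "1/2 \<le> norm x" "norm (x - u) \<le> 2" if "x \<in> ?U" for x
    proof -
      have d: "norm (u - x) < 1/2" using that by (simp add: dist_norm)
      have "norm x \<le> norm u + norm (x - u)" "norm u \<le> norm x + norm (u - x)"
        using norm_triangle_sub[of x u] norm_triangle_sub[of u x] by auto
      then show "norm x \<le> 2" "1/2 \<le> norm x" "norm (x - u) \<le> 2"
        using d u by (auto simp: norm_minus_commute)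
    qed
    have s0: "pd_bd i k 4 ?U (\<lambda>x. x \<bullet> x)"
      using pd_bd_sqdist[of ?U 0 i k] nx by simp
    have su: "pd_bd i k 4 ?U (\<lambda>x. (x - u) \<bullet> (x - u))"
      using pd_bd_sqdist[of ?U u i k] nx by simp
    have "pd_bd i k (2 ^ k * (1 * 4)) ?U (\<lambda>x. r\<^sup>2 *\<^sub>R (x \<bullet> x))"
      using assms by (intro pd_bd_scaleR pd_bd_const s0) (auto simp: power_le_one)
    moreover have "pd_bd i k 4 ?U (\<lambda>x. - ((x - u) \<bullet> (x - u)))"
      by (rule pd_bd_linear[OF bounded_linear_minus[OF bounded_linear_ident] _ su]) simp
    ultimately have "pd_bd i k (2 ^ k * (1 * 4) + 4) ?U (\<lambda>x. r\<^sup>2 *\<^sub>R (x \<bullet> x) + - ((x - u) \<bullet> (x - u)))"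
      by (rule pd_bd_add)
    then have a: "pd_bd i k K1 ?U (\<lambda>x. max 0 (r\<^sup>2 * (x \<bullet> x) - (x - u) \<bullet> (x - u)) ^ q)"
      using K1(2) by simp
    have b: "pd_bd i k K2 ?U (\<lambda>x. (x \<bullet> x) powr (- (real q + real CARD('n) / 2)))"
    proof (rule K2(2)[OF s0])
      fix x assume "x \<in> ?U"
      then show "1/4 \<le> x \<bullet> x"
        using power_mono[OF nx(2), of x 2] by (simp add: dot_square_norm power2_eq_square)
    qed
    show "pd_bd i k (2 ^ k * (K1 * K2)) ?U (wgt q r u)"
      using pd_bd_mult[OF K1(1) K2(1) a b] by (simp add: wgt_def[abs_def])
  qed
qed

section \<open>Symbols rescaled to the unit sphere\<close>

lemma jet_le_order: "jet k K U P \<Longrightarrow> j \<le> k \<Longrightarrow> jet j K U P"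
  unfolding jet_def by auto

lemma finite_index_lists: "finite {is :: 'n::finite list. length is \<le> k}"
  using finite_lists_length_le[of "UNIV :: 'n set" k] by simp

text \<open>Symbol estimates are invariant under dilation: the components of the jet are the
  derivatives of eta -> rho^(-s) f(rho eta), whose powers of rho cancel against those in the
  estimate. What is left is a power of |eta|, and |eta| lies between 1/2 and 2.\<close>

lemma rescaled_jet:
  fixes f :: "real^'n::finite \<Rightarrow> 'b::real_normed_vector"
  assumes "symb s \<Omega> f"
  obtains K where "0 \<le> K" "\<And>\<rho> u \<delta>. 0 < \<rho> \<Longrightarrow> norm u = 1 \<Longrightarrow> \<delta> \<le> 1/2 \<Longrightarrow>
     (\<And>\<eta>. \<eta> \<in> ball u \<delta> \<Longrightarrow> \<rho> *\<^sub>R \<eta> \<in> \<Omega>) \<Longrightarrow>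
     jet k K (ball u \<delta>) (\<lambda>is \<eta>. \<rho> powr (real (length is) - s) *\<^sub>R pderivs is f (\<rho> *\<^sub>R \<eta>))"
proof -
  have sk: "symb_k s k \<Omega> f" using assms by (simp add: symb_def)
  then have "\<forall>is. length is \<le> k \<longrightarrow> (\<exists>c. \<forall>\<xi>\<in>\<Omega>. norm (pderivs is f \<xi>) \<le> c * norm \<xi> powr (s - real (length is)))"
    and ck: "Ck_on k \<Omega> f" by (auto simp: symb_k_def)
  then obtain c where c: "\<And>is \<xi>. length is \<le> k \<Longrightarrow> \<xi> \<in> \<Omega> \<Longrightarrow>
      norm (pderivs is f \<xi>) \<le> c is * norm \<xi> powr (s - real (length is))" by metis
  \<comment> \<open>Summing over the finitely many index lists gives one constant for all orders;
    the power of 2 bounds the power of |eta| for either sign of its exponent.\<close>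
  define K where "K = (\<Sum>is\<in>{is :: 'n list. length is \<le> k}. \<bar>c is\<bar> * 2 powr \<bar>s - real (length is)\<bar>)"
  show ?thesis
  proof (rule that[of K])
    show "0 \<le> K" unfolding K_def by (intro sum_nonneg) auto
    fix \<rho> \<delta> :: real and u :: "real^'n"
    assume \<rho>: "0 < \<rho>" and u: "norm u = 1" and \<delta>: "\<delta> \<le> 1/2" and \<Omega>: "\<And>\<eta>. \<eta> \<in> ball u \<delta> \<Longrightarrow> \<rho> *\<^sub>R \<eta> \<in> \<Omega>"
    show "jet k K (ball u \<delta>) (\<lambda>is \<eta>. \<rho> powr (real (length is) - s) *\<^sub>R pderivs is f (\<rho> *\<^sub>R \<eta>))"
      unfolding jet_def
    proof (intro conjI allI impI ballI)
      fix "is" :: "'n list" assume l: "length is \<le> k"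
      have "continuous_on \<Omega> (pderivs is f)" using ck l by (simp add: Ck_on_def)
      then have "continuous_on (ball u \<delta>) (\<lambda>\<eta>. pderivs is f (\<rho> *\<^sub>R \<eta>))"
        by (rule continuous_on_compose2) (auto intro!: continuous_intros \<Omega> simp del: mem_ball)
      then show "continuous_on (ball u \<delta>) (\<lambda>\<eta>. \<rho> powr (real (length is) - s) *\<^sub>R pderivs is f (\<rho> *\<^sub>R \<eta>))"
        by (intro continuous_intros)
      fix \<eta> assume \<eta>: "\<eta> \<in> ball u \<delta>"
      have d: "norm (u - \<eta>) < 1/2" using \<eta> \<delta> by (simp add: dist_norm)
      have "norm \<eta> \<le> norm u + norm (\<eta> - u)" "norm u \<le> norm \<eta> + norm (u - \<eta>)"
        using norm_triangle_sub[of \<eta> u] norm_triangle_sub[of u \<eta>] by auto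
      then have nx: "norm \<eta> \<le> 2" "1/2 \<le> norm \<eta>" using d u by (auto simp: norm_minus_commute)
      define e where "e = s - real (length is)"
      have "norm \<eta> powr e \<le> 2 powr \<bar>e\<bar>"
      proof (cases "0 \<le> e")
        case True
        then show ?thesis using nx by (auto intro: powr_mono2)
      next
        case False
        then have "norm \<eta> powr e \<le> (1/2) powr e" using nx by (intro powr_mono2') auto
        also have "\<dots> = 2 powr \<bar>e\<bar>" using False by (simp add: powr_divide powr_minus_divide)
        finally show ?thesis .
      qed
      moreover have "norm (pderivs is f (\<rho> *\<^sub>R \<eta>)) \<le> \<bar>c is\<bar> * (\<rho> powr e * norm \<eta> powr e)"
      proof -
        have "norm (pderivs is f (\<rho> *\<^sub>R \<eta>)) \<le> c is * norm (\<rho> *\<^sub>R \<eta>) powr e"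
          unfolding e_def using c[OF l \<Omega>[OF \<eta>]] .
        also have "\<dots> \<le> \<bar>c is\<bar> * norm (\<rho> *\<^sub>R \<eta>) powr e" by (intro mult_right_mono) auto
        finally show ?thesis using \<rho> by (simp add: powr_mult)
      qed
      moreover have "\<bar>c is\<bar> * (\<rho> powr e * norm \<eta> powr e) \<le> \<bar>c is\<bar> * (\<rho> powr e * 2 powr \<bar>e\<bar>)"
        if "norm \<eta> powr e \<le> 2 powr \<bar>e\<bar>"
        using that by (intro mult_left_mono) auto
      ultimately have "norm (pderivs is f (\<rho> *\<^sub>R \<eta>)) \<le> \<bar>c is\<bar> * (\<rho> powr e * 2 powr \<bar>e\<bar>)"
        by (meson order_trans)
      then have "\<rho> powr (- e) * norm (pderivs is f (\<rho> *\<^sub>R \<eta>)) \<le> \<rho> powr (- e) * (\<bar>c is\<bar> * (\<rho> powr e * 2 powr \<bar>e\<bar>))"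
        by (intro mult_left_mono) auto
      also have "\<dots> = \<bar>c is\<bar> * 2 powr \<bar>e\<bar>" using \<rho> by (simp add: powr_minus_divide)
      also have "\<dots> \<le> K" unfolding K_def e_def using l
        by (intro member_le_sum[of "is"] finite_index_lists) auto
      finally show "norm (\<rho> powr (real (length is) - s) *\<^sub>R pderivs is f (\<rho> *\<^sub>R \<eta>)) \<le> K"
        by (simp add: e_def)
    next
      fix "is" :: "'n list" and i \<eta> assume l: "length is < k" and \<eta>: "\<eta> \<in> ball u \<delta>"
      have "has_partial i (pderivs is f) (\<rho> *\<^sub>R \<eta>)" using ck l \<Omega>[OF \<eta>] by (simp add: Ck_on_def)
      then have "has_pd i (pderivs is f) (0 + \<rho> *\<^sub>R \<eta>) (pderivs (i # is) f (\<rho> *\<^sub>R \<eta>))"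
        using has_pd_partial_deriv by auto
      from has_pd_linear[OF bounded_linear_scaleR_right has_pd_affine[OF this]]
      have "has_pd i (\<lambda>\<eta>. \<rho> powr (real (length is) - s) *\<^sub>R pderivs is f (\<rho> *\<^sub>R \<eta>)) \<eta>
         (\<rho> powr (real (length is) - s) *\<^sub>R \<rho> *\<^sub>R pderivs (i # is) f (\<rho> *\<^sub>R \<eta>))" by simp
      moreover have "\<rho> powr (real (length is) - s) * \<rho> = \<rho> powr (real (length (i # is)) - s)"
        using \<rho> by (simp add: powr_diff powr_add)
      ultimately show "has_pd i (\<lambda>\<eta>. \<rho> powr (real (length is) - s) *\<^sub>R pderivs is f (\<rho> *\<^sub>R \<eta>)) \<eta>
         (\<rho> powr (real (length (i # is)) - s) *\<^sub>R pderivs (i # is) f (\<rho> *\<^sub>R \<eta>))" by simp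
    qed
  qed
qed

text \<open>The weights are not normalised here; their total mass \<open>Z\<close> is divided out
  only at the end.\<close>

definition piece :: "nat \<Rightarrow> real \<Rightarrow> (real^'n::finite \<Rightarrow> real) \<Rightarrow> (real^'n \<Rightarrow> complex) \<Rightarrow> real \<Rightarrow> real^'n \<Rightarrow> real^'n \<Rightarrow> complex" where
  "piece q r a \<psi> t x c = (\<integral>\<xi>. cis (t * a \<xi> + x \<bullet> \<xi>) * (wgt q r c \<xi> *\<^sub>R \<psi> \<xi>) \<partial>lborel)"

text \<open>The Jacobian rho^n of xi = rho eta cancels against the homogeneity of degree -n of the
  weight. Taking rho^b out of \<open>\<psi>\<close> and rho^m out of \<open>a\<close> leaves an
  integral centred at \<open>u\<close> with parameters \<open>t * \<rho> powr m\<close> and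
  \<open>\<rho> *\<^sub>R x\<close>.\<close>

lemma piece_rescale:
  fixes a :: "real^'n::finite \<Rightarrow> real"
  assumes [measurable]: "a \<in> borel_measurable borel" "\<psi> \<in> borel_measurable borel" and \<rho>: "0 < \<rho>"
  shows "piece q r a \<psi> t x (\<rho> *\<^sub>R u) = \<rho> powr b *\<^sub>R
     (\<integral>\<eta>. cis ((t * \<rho> powr m) * (\<rho> powr (- m) *\<^sub>R a (\<rho> *\<^sub>R \<eta>)) + (\<rho> *\<^sub>R x) \<bullet> \<eta>) *
        (wgt q r u \<eta> *\<^sub>R (\<rho> powr (- b) *\<^sub>R \<psi> (\<rho> *\<^sub>R \<eta>))) \<partial>lborel)"
proof -
  have [measurable]: "wgt q r c \<in> borel_measurable borel" for c :: "real^'n"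
    unfolding wgt_def by measurable
  have [measurable]: "cis \<in> borel_measurable borel"
    by (intro borel_measurable_continuous_onI continuous_intros)
  have "piece q r a \<psi> t x (\<rho> *\<^sub>R u) = (\<rho> powr CARD('n)) *\<^sub>R
     (\<integral>\<eta>. cis (t * a (\<rho> *\<^sub>R \<eta>) + x \<bullet> (\<rho> *\<^sub>R \<eta>)) * (wgt q r (\<rho> *\<^sub>R u) (\<rho> *\<^sub>R \<eta>) *\<^sub>R \<psi> (\<rho> *\<^sub>R \<eta>)) \<partial>lborel)"
    unfolding piece_def by (intro lborel_integral_scale \<rho>) measurable
  also have "\<dots> = (\<integral>\<eta>. \<rho> powr CARD('n) *\<^sub>R (cis (t * a (\<rho> *\<^sub>R \<eta>) + x \<bullet> (\<rho> *\<^sub>R \<eta>)) *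
      (wgt q r (\<rho> *\<^sub>R u) (\<rho> *\<^sub>R \<eta>) *\<^sub>R \<psi> (\<rho> *\<^sub>R \<eta>))) \<partial>lborel)"
    by (simp only: integral_scaleR_right)
  also have "\<dots> = (\<integral>\<eta>. \<rho> powr b *\<^sub>R (cis ((t * \<rho> powr m) * (\<rho> powr (- m) *\<^sub>R a (\<rho> *\<^sub>R \<eta>)) + (\<rho> *\<^sub>R x) \<bullet> \<eta>) *
        (wgt q r u \<eta> *\<^sub>R (\<rho> powr (- b) *\<^sub>R \<psi> (\<rho> *\<^sub>R \<eta>)))) \<partial>lborel)"
  proof (rule Bochner_Integration.integral_cong[OF refl])
    fix \<eta>
    have 1: "(t * \<rho> powr m) * (\<rho> powr (- m) *\<^sub>R a (\<rho> *\<^sub>R \<eta>)) + (\<rho> *\<^sub>R x) \<bullet> \<eta> = t * a (\<rho> *\<^sub>R \<eta>) + x \<bullet> (\<rho> *\<^sub>R \<eta>)"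
      using \<rho> by (simp add: powr_minus_divide)
    have 2: "\<rho> powr CARD('n) * (\<rho> powr (- real CARD('n)) * w) = w" for w
      using \<rho> by (simp add: powr_minus_divide)
    have 3: "\<rho> powr b * (w * \<rho> powr (- b)) = w" for w
      using \<rho> by (simp add: powr_minus_divide)
    show "\<rho> powr CARD('n) *\<^sub>R (cis (t * a (\<rho> *\<^sub>R \<eta>) + x \<bullet> (\<rho> *\<^sub>R \<eta>)) *
      (wgt q r (\<rho> *\<^sub>R u) (\<rho> *\<^sub>R \<eta>) *\<^sub>R \<psi> (\<rho> *\<^sub>R \<eta>))) =
      \<rho> powr b *\<^sub>R (cis ((t * \<rho> powr m) * (\<rho> powr (- m) *\<^sub>R a (\<rho> *\<^sub>R \<eta>)) + (\<rho> *\<^sub>R x) \<bullet> \<eta>) *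
        (wgt q r u \<eta> *\<^sub>R (\<rho> powr (- b) *\<^sub>R \<psi> (\<rho> *\<^sub>R \<eta>))))"
      unfolding 1 unfolding wgt_scale[OF \<rho>] mult_scaleR_right scaleR_scaleR 2 3 ..
  qed
  finally show ?thesis by (simp only: integral_scaleR_right)
qed

section \<open>Bounds for all pieces of one scale\<close>

lemma wgt_support:
  assumes "0 < q" "0 \<le> r" "r \<le> 1/2" "norm u = 1" "\<eta> \<notin> cball u (2 * r)"
  shows "wgt q r u \<eta> = 0"
proof (rule wgt_eq_0[OF assms(1,2)])
  have far: "2 * r < norm (\<eta> - u)" using assms(5) by (simp add: dist_norm norm_minus_commute)
  have "norm \<eta> \<le> 1 + norm (\<eta> - u)" using norm_triangle_sub[of \<eta> u] assms(4) by simp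
  then have "r * norm \<eta> \<le> r + r * norm (\<eta> - u)"
    using mult_left_mono[of "norm \<eta>" "1 + norm (\<eta> - u)" r] assms(2) by (simp add: distrib_left)
  also have "r * norm (\<eta> - u) \<le> 1/2 * norm (\<eta> - u)" using assms(3) by (intro mult_right_mono) auto
  finally show "r * norm \<eta> \<le> norm (\<eta> - u)" using far by simp
qed

lemma det_scaled:
  fixes H :: "real^'n::finite^'n"
  shows "det (\<chi> i j. s * H $ i $ j) = s ^ CARD('n) * det H"
proof -
  have "(\<chi> i j. s * H $ i $ j) = (\<chi> i. s *s H $ i)"
    by (simp add: vec_eq_iff)
  then show ?thesis using det_rows_mul[of "\<lambda>i. s" "\<lambda>i. H $ i"] by simp
qed

text \<open>The trivial bound and the three oscillatory ones are applied to the rescaled piece,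
  whose jets are bounded independently of \<open>c\<close>. Every sufficiently small
  \<open>r\<close> is offered because a single weight must later serve both scales.\<close>

lemma scale_piece_bound:
  fixes a :: "real^'n::finite \<Rightarrow> real" and \<psi> :: "real^'n \<Rightarrow> complex" and M q :: nat
  defines "n \<equiv> real CARD('n)"
  assumes meas: "a \<in> borel_measurable borel" "\<psi> \<in> borel_measurable borel"
    and symb: "symb m \<Omega> a" "symb b \<Omega> \<psi>"
    and pos: "0 < c1" "0 < d" "0 < \<delta>"
    and det: "\<And>\<xi>. \<xi> \<in> \<Omega> \<Longrightarrow> c1 * norm \<xi> powr (n * (m - 2)) \<le> \<bar>det (hessian a \<xi>)\<bar>"
    and grad: "\<And>\<xi>. \<xi> \<in> \<Omega> \<Longrightarrow> d * norm \<xi> powr (m - 1) \<le> norm (grad a \<xi>)"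
    and M: "Suc CARD('n) \<le> M" and q: "M < q"
  obtains r1 where "0 < r1" "\<And>r. 0 < r \<Longrightarrow> r \<le> r1 \<Longrightarrow> \<exists>C A a0. 0 \<le> C \<and> 0 < A \<and> 0 < a0 \<and>
     (\<forall>c t x. c \<noteq> 0 \<longrightarrow> (\<forall>\<eta>\<in>ball (c /\<^sub>R norm c) \<delta>. norm c *\<^sub>R \<eta> \<in> \<Omega>) \<longrightarrow> t \<noteq> 0 \<longrightarrow>
        piece_bd n m b (real M) C A a0 \<bar>t\<bar> (norm x) (norm c) (norm (piece q r a \<psi> t x c)))"
proof -
  have n: "1 \<le> n" by (simp add: n_def Suc_leI)
  obtain K where K: "0 \<le> K" "\<And>\<rho> u \<delta>. 0 < \<rho> \<Longrightarrow> norm u = 1 \<Longrightarrow> \<delta> \<le> 1/2 \<Longrightarrow>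
     (\<And>\<eta>. \<eta> \<in> ball u \<delta> \<Longrightarrow> \<rho> *\<^sub>R \<eta> \<in> \<Omega>) \<Longrightarrow>
     jet (M + 2) K (ball u \<delta>) (\<lambda>is \<eta>. \<rho> powr (real (length is) - m) *\<^sub>R pderivs is a (\<rho> *\<^sub>R \<eta>))"
    using rescaled_jet[OF symb(1), of "M + 2"] by blast
  obtain K\<psi> where K\<psi>: "0 \<le> K\<psi>" "\<And>\<rho> u \<delta>. 0 < \<rho> \<Longrightarrow> norm u = 1 \<Longrightarrow> \<delta> \<le> 1/2 \<Longrightarrow>
     (\<And>\<eta>. \<eta> \<in> ball u \<delta> \<Longrightarrow> \<rho> *\<^sub>R \<eta> \<in> \<Omega>) \<Longrightarrow>
     jet M K\<psi> (ball u \<delta>) (\<lambda>is \<eta>. \<rho> powr (real (length is) - b) *\<^sub>R pderivs is \<psi> (\<rho> *\<^sub>R \<eta>))"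
    using rescaled_jet[OF symb(2), of M] by blast
  obtain c' where c': "0 < c'" "\<And>(A::real^'n^'n) h. (\<And>i j. \<bar>A $ i $ j\<bar> \<le> K) \<Longrightarrow> c1 \<le> \<bar>det A\<bar> \<Longrightarrow>
     \<exists>i. c' * norm h \<le> \<bar>\<Sum>l\<in>UNIV. h $ l * A $ l $ i\<bar>"
    using det_bound_imp_lower_bound[OF pos(1), where K=K and ?'n='n] by blast
  \<comment> \<open>Some component of a gradient is at least 1/n times its norm.\<close>
  define d' where "d' = d / n"
  have d': "0 < d'" using pos n by (simp add: d'_def)
  obtain A CA where A: "0 < A" "0 \<le> CA" "\<And>(P::'n list \<Rightarrow> real^'n \<Rightarrow> real) u \<delta> \<rho> \<beta> K\<beta> \<tau> y.
     jet (Suc M) K (ball u \<delta>) P \<Longrightarrow> \<rho> < \<delta> \<Longrightarrow> \<rho> \<le> 1 \<Longrightarrow>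
     (\<And>i. pd_bd i M K\<beta> UNIV \<beta>) \<Longrightarrow> (\<And>x. x \<notin> cball u \<rho> \<Longrightarrow> \<beta> x = 0) \<Longrightarrow>
     y \<noteq> 0 \<Longrightarrow> A * \<bar>\<tau>\<bar> \<le> norm y \<Longrightarrow>
     norm (\<integral>x. cis (\<tau> * P [] x + y \<bullet> x) * \<beta> x \<partial>lborel) \<le> CA * K\<beta> / norm y ^ M"
    using nonstationary_linear_dominates[OF K(1), where M=M and ?'n='n] by blast
  obtain CT where CT: "0 \<le> CT" "\<And>(P::'n list \<Rightarrow> real^'n \<Rightarrow> real) u \<delta> \<rho> \<beta> K\<beta> \<tau> y.
     jet (Suc (Suc M)) K (ball u \<delta>) P \<Longrightarrow> \<exists>i. d' \<le> \<bar>P [i] u\<bar> \<Longrightarrow> 0 \<le> \<rho> \<Longrightarrow> \<rho> < \<delta> \<Longrightarrow> \<rho> \<le> 1 \<Longrightarrow>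
     K * (real CARD('n) * \<delta>) \<le> d' / 2 \<Longrightarrow>
     (\<And>i. pd_bd i M K\<beta> UNIV \<beta>) \<Longrightarrow> (\<And>x. x \<notin> cball u \<rho> \<Longrightarrow> \<beta> x = 0) \<Longrightarrow>
     \<tau> \<noteq> 0 \<Longrightarrow> norm y \<le> d' / 4 * \<bar>\<tau>\<bar> \<Longrightarrow>
     norm (\<integral>x. cis (\<tau> * P [] x + y \<bullet> x) * \<beta> x \<partial>lborel) \<le> CT * K\<beta> / \<bar>\<tau>\<bar> ^ M"
    using nonstationary_phase_dominates[OF K(1) d', where M=M and ?'n='n] by blast
  obtain CS where CS: "0 \<le> CS" "\<And>(P::'n list \<Rightarrow> real^'n \<Rightarrow> real) u r \<beta> K\<beta> \<tau> y.
     jet (CARD('n) + 3) K (ball u (8 * r)) P \<Longrightarrow> (\<And>h. \<exists>i. c' * norm h \<le> \<bar>\<Sum>l\<in>UNIV. h $ l * P [l, i] u\<bar>) \<Longrightarrow>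
     0 < r \<Longrightarrow> 8 * r \<le> 1 \<Longrightarrow> K * (real CARD('n) * (8 * r)) * real CARD('n) \<le> c' / 2 \<Longrightarrow>
     (\<And>i. pd_bd i (Suc CARD('n)) K\<beta> UNIV \<beta>) \<Longrightarrow> (\<And>x. x \<notin> cball u (2 * r) \<Longrightarrow> \<beta> x = 0) \<Longrightarrow> \<tau> \<noteq> 0 \<Longrightarrow>
     norm (\<integral>x. cis (\<tau> * P [] x + y \<bullet> x) * \<beta> x \<partial>lborel) \<le> CS * K\<beta> * \<bar>\<tau>\<bar> powr (- real CARD('n) / 2)"
    using stationary_bound[OF K(1) c'(1), where ?'n='n] by blast
  define k1 where "k1 = (K + 1) * (n * 8)"
  have k1: "0 < k1" using K n by (auto simp: k1_def)
  \<comment> \<open>The four entries keep the ball of radius \<open>8 * r\<close> inside the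
    admissible region, keep its radius at most 1/2, and make the variation over it of first
    derivatives, and of gradient increments relative to the Hessian, at most half of the respective
    lower bound.\<close>
  define r1 where "r1 = min (min (\<delta> / 8) (1 / 16)) (min (d' / 2 / k1) (c' / 2 / (k1 * n)))"
  show ?thesis
  proof (rule that[of r1])
    show "0 < r1" using pos k1 c' d' n by (simp add: r1_def)
    fix r assume r: "0 < r" "r \<le> r1"
    have r8: "8 * r \<le> \<delta>" "8 * r \<le> 1/2" "r * k1 \<le> d' / 2" "r * (k1 * n) \<le> c' / 2"
      using r k1 n by (auto simp: r1_def pos_le_divide_eq)
    have Kle: "K * (n * (8 * r)) \<le> r * k1"
      using r n by (simp add: k1_def algebra_simps)
    have rd: "K * (real CARD('n) * (8 * r)) \<le> d' / 2" using Kle r8 by (simp add: n_def)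
    have rc: "K * (real CARD('n) * (8 * r)) * real CARD('n) \<le> c' / 2"
      using mult_right_mono[OF Kle, of n] r8 n by (simp add: n_def mult_ac)
    have rle: "0 \<le> r" "r \<le> 1" "r \<le> 1/2" using r r8 by auto
    obtain Kw where Kw: "0 \<le> Kw" "\<And>i u. norm u = 1 \<Longrightarrow> pd_bd i M Kw (ball (u::real^'n) (1/2)) (wgt q r u)"
      using pd_bd_wgt[OF q rle(1,2), where ?'n='n] by blast
    define K\<beta> where "K\<beta> = 2 ^ M * (Kw * K\<psi>)"
    have K\<beta>: "0 \<le> K\<beta>" using Kw K\<psi> by (simp add: K\<beta>_def)
    define C where "C = (unit_ball_vol n + CS + CA + CT) * K\<beta>"
    have V: "0 \<le> unit_ball_vol n" by (simp add: n_def)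
    have C0: "0 \<le> C" using V CS A CT K\<beta> by (simp add: C_def)
    have Cge: "unit_ball_vol n * K\<beta> \<le> C" "CS * K\<beta> \<le> C" "CA * K\<beta> \<le> C" "CT * K\<beta> \<le> C"
      unfolding C_def using V CS(1) A(2) CT(1) K\<beta> by (auto intro!: mult_right_mono)
    have "piece_bd n m b (real M) C A (d' / 4) \<bar>t\<bar> (norm x) (norm c) (norm (piece q r a \<psi> t x c))"
      if c: "c \<noteq> 0" and \<Omega>: "\<forall>\<eta>\<in>ball (c /\<^sub>R norm c) \<delta>. norm c *\<^sub>R \<eta> \<in> \<Omega>" and t: "t \<noteq> 0" for c t x
    proof -
      define \<rho> where "\<rho> = norm c"
      have \<rho>: "0 < \<rho>" using c by (simp add: \<rho>_def)
      define u where "u = c /\<^sub>R \<rho>"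
      have u: "norm u = 1" using c by (simp add: u_def \<rho>_def)
      have cu: "c = \<rho> *\<^sub>R u" using \<rho> by (simp add: u_def)
      have in\<Omega>: "\<rho> *\<^sub>R \<eta> \<in> \<Omega>" if "\<eta> \<in> ball u (8 * r)" for \<eta>
        using \<Omega> that r8(1) unfolding u_def \<rho>_def by auto
      have u\<Omega>: "\<rho> *\<^sub>R u \<in> \<Omega>" using in\<Omega>[of u] r by simp
      define P where "P is \<eta> = \<rho> powr (real (length is) - m) *\<^sub>R pderivs is a (\<rho> *\<^sub>R \<eta>)" for "is" \<eta>
      define Q where "Q is \<eta> = \<rho> powr (real (length is) - b) *\<^sub>R pderivs is \<psi> (\<rho> *\<^sub>R \<eta>)" for "is" \<eta>
      have jP: "jet (M + 2) K (ball u (8 * r)) P"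
        unfolding P_def using in\<Omega> r8 by (intro K(2)[OF \<rho> u]) auto
      have jQ: "jet M K\<psi> (ball u (8 * r)) Q"
        unfolding Q_def using in\<Omega> r8 by (intro K\<psi>(2)[OF \<rho> u]) auto
      define \<beta> where "\<beta> \<eta> = wgt q r u \<eta> *\<^sub>R Q [] \<eta>" for \<eta>
      have \<beta>0: "\<beta> \<eta> = 0" if "\<eta> \<notin> cball u (2 * r)" for \<eta>
        using wgt_support[OF _ rle(1,3) u that] q by (simp add: \<beta>_def)
      have \<beta>: "pd_bd i M K\<beta> UNIV \<beta>" for i
      proof (rule pd_bd_zero_extend[of "ball u (8 * r)" "cball u (2 * r)", OF _ _ _ K\<beta> _ \<beta>0])
        have "pd_bd i M Kw (ball u (8 * r)) (wgt q r u)"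
          using r8 by (intro pd_bd_mono[OF Kw(2)[OF u]]) auto
        then show "pd_bd i M K\<beta> (ball u (8 * r)) \<beta>"
          unfolding K\<beta>_def \<beta>_def using Kw K\<psi> by (intro pd_bd_scaleR jet_imp_pd_bd[OF jQ]) auto
      qed (use r in auto)
      have \<beta>': "pd_bd i (Suc CARD('n)) K\<beta> UNIV \<beta>" for i by (rule pd_bd_le_order[OF M \<beta>])
      have \<beta>n: "norm (\<beta> x) \<le> K\<beta>" for x using pd_bd_norm[OF \<beta>] by auto
      define \<tau> where "\<tau> = t * \<rho> powr m"
      define y where "y = \<rho> *\<^sub>R x"
      define J where "J = (\<integral>\<eta>. cis (\<tau> * P [] \<eta> + y \<bullet> \<eta>) * \<beta> \<eta> \<partial>lborel)"
      have \<tau>: "\<tau> \<noteq> 0" "\<bar>\<tau>\<bar> = \<bar>t\<bar> * \<rho> powr m" using t \<rho> by (auto simp: \<tau>_def abs_mult)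
      have y: "norm y = norm x * \<rho>" using \<rho> by (simp add: y_def)
      have "piece q r a \<psi> t x c = \<rho> powr b *\<^sub>R J"
        unfolding cu piece_rescale[OF meas \<rho>, of q r t x u b m] J_def \<tau>_def y_def \<beta>_def P_def Q_def by simp
      then have np: "norm (piece q r a \<psi> t x c) = \<rho> powr b * norm J" by simp
      have hess: "\<exists>i. c' * norm h \<le> \<bar>\<Sum>l\<in>UNIV. h $ l * P [l, i] u\<bar>" for h
      proof -
        define Z :: "real^'n^'n" where "Z = (\<chi> l i. P [l, i] u)"
        have "\<bar>Z $ l $ i\<bar> \<le> K" for l i
          using jet_norm[OF jP, of "[l, i]" u] M r by (simp add: Z_def)
        \<comment> \<open>Each entry carries the factor \<open>\<rho> powr (2 - m)\<close>, so the
          determinant carries its n-th power, which is inverse to the power of \<open>\<rho>\<close>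
          in the hypothesis on the Hessian.\<close>
        moreover have "c1 \<le> \<bar>det Z\<bar>"
        proof -
          have "Z = (\<chi> l i. \<rho> powr (2 - m) * hessian a (\<rho> *\<^sub>R u) $ l $ i)"
            by (simp add: Z_def P_def hessian_def vec_eq_iff)
          then have "\<bar>det Z\<bar> = (\<rho> powr (2 - m)) ^ CARD('n) * \<bar>det (hessian a (\<rho> *\<^sub>R u))\<bar>"
            by (simp add: det_scaled abs_mult)
          moreover have "c1 * \<rho> powr (n * (m - 2)) \<le> \<bar>det (hessian a (\<rho> *\<^sub>R u))\<bar>"
            using det[OF u\<Omega>] u \<rho> by simp
          then have "(\<rho> powr (2 - m)) ^ CARD('n) * (c1 * \<rho> powr (n * (m - 2)))
              \<le> (\<rho> powr (2 - m)) ^ CARD('n) * \<bar>det (hessian a (\<rho> *\<^sub>R u))\<bar>"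
            by (intro mult_left_mono) auto
          moreover have "(\<rho> powr (2 - m)) ^ CARD('n) * (c1 * \<rho> powr (n * (m - 2))) = c1"
          proof -
            have "(\<rho> powr (2 - m)) ^ CARD('n) = \<rho> powr ((2 - m) * n)"
              using \<rho> by (simp add: powr_realpow[symmetric] powr_powr n_def)
            then have "(\<rho> powr (2 - m)) ^ CARD('n) * \<rho> powr (n * (m - 2)) = \<rho> powr ((2 - m) * n + n * (m - 2))"
              by (simp only: powr_add)
            also have "(2 - m) * n + n * (m - 2) = 0" by (simp add: algebra_simps)
            finally show ?thesis using \<rho> by (simp add: mult_ac)
          qed
          ultimately show ?thesis by simp
        qed
        ultimately show ?thesis using c'(2)[of Z h] by (simp add: Z_def)
      qed
      have gr: "\<exists>i. d' \<le> \<bar>P [i] u\<bar>"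
      proof -
        obtain i where i: "norm (grad a (\<rho> *\<^sub>R u)) \<le> n * \<bar>grad a (\<rho> *\<^sub>R u) $ i\<bar>"
          using exists_large_component n_def by blast
        have "P [i] u = \<rho> powr (1 - m) * grad a (\<rho> *\<^sub>R u) $ i"
          by (simp add: P_def grad_def)
        then have Pi: "\<bar>P [i] u\<bar> = \<rho> powr (1 - m) * \<bar>grad a (\<rho> *\<^sub>R u) $ i\<bar>" by (simp add: abs_mult)
        have "d * \<rho> powr (m - 1) \<le> n * \<bar>grad a (\<rho> *\<^sub>R u) $ i\<bar>"
          using grad[OF u\<Omega>] i u \<rho> by simp
        then have "\<rho> powr (1 - m) * (d * \<rho> powr (m - 1)) \<le> \<rho> powr (1 - m) * (n * \<bar>grad a (\<rho> *\<^sub>R u) $ i\<bar>)"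
          by (intro mult_left_mono) auto
        moreover have "\<rho> powr (1 - m) * (d * \<rho> powr (m - 1)) = d"
          using \<rho> by (simp add: powr_diff)
        ultimately have "d \<le> \<rho> powr (1 - m) * (n * \<bar>grad a (\<rho> *\<^sub>R u) $ i\<bar>)" by linarith
        then have "d \<le> n * \<bar>P [i] u\<bar>" unfolding Pi by (simp only: mult.left_commute)
        then have "d' \<le> \<bar>P [i] u\<bar>" using n by (simp add: d'_def field_simps)
        then show ?thesis by blast
      qed
      have J1: "norm J \<le> C"
      proof -
        have "norm J \<le> unit_ball_vol (real CARD('n)) * K\<beta>" unfolding J_def
          using \<beta>0 \<beta>n r r8 by (intro norm_integral_le_cball[of u "2 * r"]) (auto simp: norm_mult)
        then show ?thesis using Cge(1) by (simp add: n_def)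
      qed
      have J2: "norm J \<le> C * \<bar>\<tau>\<bar> powr (- n / 2)"
      proof -
        have "norm J \<le> CS * K\<beta> * \<bar>\<tau>\<bar> powr (- real CARD('n) / 2)" unfolding J_def
          using jet_le_order[OF jP] M hess r r8 rc \<beta>' \<beta>0 \<tau> by (intro CS(2)) auto
        also have "\<dots> \<le> C * \<bar>\<tau>\<bar> powr (- real CARD('n) / 2)"
          using Cge(2) by (intro mult_right_mono) auto
        finally show ?thesis by (simp add: n_def)
      qed
      have J3: "norm J \<le> C * (norm y) powr (- real M)" if le: "A * \<bar>\<tau>\<bar> \<le> norm y"
      proof -
        have y0: "y \<noteq> 0" using le A \<tau> by (auto simp: zero_less_mult_iff mult_le_0_iff)
        have "norm J \<le> CA * K\<beta> / norm y ^ M" unfolding J_def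
          by (rule A(3)[OF jet_le_order[OF jP] _ _ \<beta> \<beta>0 y0 le]) (use r r8 in auto)
        also have "\<dots> \<le> C / norm y ^ M" using Cge(3) by (intro divide_right_mono) auto
        finally show ?thesis using y0 by (simp add: powr_minus_divide powr_realpow)
      qed
      have J4: "norm J \<le> C * \<bar>\<tau>\<bar> powr (- real M)" if le: "norm y \<le> d' / 4 * \<bar>\<tau>\<bar>"
      proof -
        have "norm J \<le> CT * K\<beta> / \<bar>\<tau>\<bar> ^ M" unfolding J_def
          by (rule CT(2)[OF jet_le_order[OF jP] gr _ _ _ rd \<beta> \<beta>0 \<tau>(1) le]) (use r r8 in auto)
        also have "\<dots> \<le> C / \<bar>\<tau>\<bar> ^ M" using Cge(4) by (intro divide_right_mono) auto
        finally show ?thesis using \<tau> by (simp add: powr_minus_divide powr_realpow)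
      qed
      have mul: "\<rho> powr b * norm J \<le> C * \<rho> powr b * z" if "norm J \<le> C * z" for z
        using mult_left_mono[OF that, of "\<rho> powr b"] by (simp add: mult_ac)
      show ?thesis
        unfolding piece_bd_def np \<rho>_def[symmetric] \<tau>(2)[symmetric] y[symmetric]
        using mul[of 1] mul[OF J2] mul[OF J3] mul[OF J4] J1 by auto
    qed
    then show "\<exists>C A a0. 0 \<le> C \<and> 0 < A \<and> 0 < a0 \<and>
     (\<forall>c t x. c \<noteq> 0 \<longrightarrow> (\<forall>\<eta>\<in>ball (c /\<^sub>R norm c) \<delta>. norm c *\<^sub>R \<eta> \<in> \<Omega>) \<longrightarrow> t \<noteq> 0 \<longrightarrow>
        piece_bd n m b (real M) C A a0 \<bar>t\<bar> (norm x) (norm c) (norm (piece q r a \<psi> t x c)))"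
      using C0 A(1) d' by (intro exI[of _ C] exI[of _ A] exI[of _ "d' / 4"]) auto
  qed
qed

subsection \<open>Representation of the distribution\<close>

lemma nn_integral_lborel_translate:
  fixes f :: "real^'n::finite \<Rightarrow> ennreal"
  assumes f: "f \<in> borel_measurable borel"
  shows "(\<integral>\<^sup>+x. f (h + x) \<partial>lborel) = (\<integral>\<^sup>+x. f x \<partial>lborel)"
proof -
  have "(\<integral>\<^sup>+x. f x \<partial>lborel) = (\<integral>\<^sup>+x. f x \<partial>(distr lborel borel ((+) h)))"
    by (subst lborel_distr_plus) simp
  also have "\<dots> = (\<integral>\<^sup>+x. f (h + x) \<partial>lborel)"
    using f by (subst nn_integral_distr) auto
  finally show ?thesis by simp
qed

lemma wgt_measurable_first [measurable]: "(\<lambda>c. wgt q r c \<xi>) \<in> borel_measurable borel"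
  unfolding wgt_def by measurable

lemma wgt_measurable_second [measurable]: "wgt q r c \<in> borel_measurable borel"
  unfolding wgt_def by measurable

text \<open>Homogeneity reduces to a unit vector \<open>e\<close>, and centring at \<open>e\<close>
  leaves the profile \<open>G\<close>, which no longer involves \<open>e\<close>; hence the mass is
  the same for all nonzero frequencies.\<close>

lemma wgt_integral:
  assumes r: "0 < r" and q: "0 < q"
  obtains Z where "0 < Z" "\<And>\<xi>::real^'n::finite. \<xi> \<noteq> 0 \<Longrightarrow> (\<integral>\<^sup>+c. ennreal (wgt q r c \<xi>) \<partial>lborel) = ennreal Z"
    "\<And>\<xi>::real^'n::finite. \<xi> \<noteq> 0 \<Longrightarrow> integrable lborel (\<lambda>c. wgt q r c \<xi>)"
    "\<And>\<xi>::real^'n::finite. \<xi> \<noteq> 0 \<Longrightarrow> (\<integral>c. wgt q r c \<xi> \<partial>lborel) = Z"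
proof -
  define G :: "real^'n \<Rightarrow> real" where "G z = max 0 (r\<^sup>2 - z \<bullet> z) ^ q" for z
  have [measurable]: "G \<in> borel_measurable borel" unfolding G_def by measurable
  define W where "W = (\<integral>\<^sup>+z. ennreal (G z) \<partial>lborel)"
  have eq: "(\<integral>\<^sup>+c. ennreal (wgt q r c \<xi>) \<partial>lborel) = W" if \<xi>: "\<xi> \<noteq> 0" for \<xi> :: "real^'n"
  proof -
    define \<rho> where "\<rho> = norm \<xi>"
    have \<rho>: "0 < \<rho>" using \<xi> by (simp add: \<rho>_def)
    define e where "e = \<xi> /\<^sub>R \<rho>"
    have e: "e \<bullet> e = 1" using \<xi> by (simp add: e_def \<rho>_def dot_square_norm power2_eq_square)
    have \<xi>e: "\<xi> = \<rho> *\<^sub>R e" using \<rho> by (simp add: e_def)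
    have "(\<integral>\<^sup>+c. ennreal (wgt q r c \<xi>) \<partial>lborel)
        = ennreal (\<rho> powr CARD('n)) * (\<integral>\<^sup>+c. ennreal (wgt q r (\<rho> *\<^sub>R c) \<xi>) \<partial>lborel)"
      by (rule nn_integral_lborel_scale[OF _ \<rho>]) measurable
    also have "\<dots> = ennreal (\<rho> powr CARD('n)) * (\<integral>\<^sup>+c. ennreal (\<rho> powr (- real CARD('n))) * ennreal (wgt q r c e) \<partial>lborel)"
      unfolding \<xi>e wgt_scale[OF \<rho>] by (simp add: ennreal_mult wgt_nonneg)
    also have "\<dots> = ennreal (\<rho> powr CARD('n)) * (ennreal (\<rho> powr (- real CARD('n))) * (\<integral>\<^sup>+c. ennreal (wgt q r c e) \<partial>lborel))"
      by (subst nn_integral_cmult) auto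
    also have "\<dots> = (\<integral>\<^sup>+c. ennreal (wgt q r c e) \<partial>lborel)"
      using \<rho> by (simp add: mult.assoc[symmetric] ennreal_mult[symmetric] powr_add[symmetric])
    also have "\<dots> = (\<integral>\<^sup>+c. ennreal (wgt q r (e + c) e) \<partial>lborel)"
      by (rule nn_integral_lborel_translate[symmetric]) measurable
    also have "\<dots> = W" unfolding W_def by (simp add: wgt_def e G_def)
    finally show ?thesis .
  qed
  have "W < \<infinity>"
  proof -
    have "W \<le> (\<integral>\<^sup>+z. ennreal ((r\<^sup>2) ^ q) * indicator (cball (0::real^'n) r) z \<partial>lborel)"
      unfolding W_def
    proof (rule nn_integral_mono)
      fix z :: "real^'n"
      show "ennreal (G z) \<le> ennreal ((r\<^sup>2) ^ q) * indicator (cball 0 r) z"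
      proof (cases "norm z \<le> r")
        case True
        have "G z \<le> (r\<^sup>2) ^ q" unfolding G_def by (intro power_mono) auto
        then show ?thesis using True by (simp add: ennreal_leI)
      next
        case False
        then have "r\<^sup>2 \<le> z \<bullet> z" using r power_mono[of r "norm z" 2] by (simp add: dot_square_norm)
        then have "G z = 0" using q by (simp add: G_def max_def zero_power)
        then show ?thesis by simp
      qed
    qed
    also have "\<dots> = ennreal ((r\<^sup>2) ^ q) * ennreal (unit_ball_vol CARD('n) * r powr CARD('n))"
      using r by (subst nn_integral_cmult_indicator) (auto simp: emeasure_lborel_cball_real_n)
    also have "\<dots> < \<infinity>" by (simp add: ennreal_mult_less_top)
    finally show ?thesis .
  qed
  then obtain Z where Z: "0 \<le> Z" "W = ennreal Z" by (cases W) auto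
  \<comment> \<open>On the ball of radius r / 2 the profile is bounded below by a positive
    constant.\<close>
  have "0 < W"
  proof -
    have "0 < ennreal ((3 / 4 * r\<^sup>2) ^ q) * ennreal (unit_ball_vol CARD('n) * (r / 2) powr CARD('n))"
      using r by (simp add: ennreal_zero_less_mult_iff)
    also have "\<dots> = (\<integral>\<^sup>+z. ennreal ((3 / 4 * r\<^sup>2) ^ q) * indicator (cball (0::real^'n) (r / 2)) z \<partial>lborel)"
      using r by (subst nn_integral_cmult_indicator) (auto simp: emeasure_lborel_cball_real_n)
    also have "\<dots> \<le> W" unfolding W_def
    proof (rule nn_integral_mono)
      fix z :: "real^'n"
      show "ennreal ((3 / 4 * r\<^sup>2) ^ q) * indicator (cball 0 (r / 2)) z \<le> ennreal (G z)"
      proof (cases "norm z \<le> r / 2")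
        case True
        then have "z \<bullet> z \<le> r\<^sup>2 / 4" using power_mono[of "norm z" "r / 2" 2] by (simp add: dot_square_norm power_divide)
        then have "3 / 4 * r\<^sup>2 \<le> max 0 (r\<^sup>2 - z \<bullet> z)" by (intro order_trans[OF _ max.cobounded2]) simp
        then have "(3 / 4 * r\<^sup>2) ^ q \<le> G z" unfolding G_def by (intro power_mono) auto
        then show ?thesis using True by (simp add: ennreal_leI)
      next
        case False
        then show ?thesis by simp
      qed
    qed
    finally show ?thesis .
  qed
  then have Zp: "0 < Z" using Z by simp
  show ?thesis
  proof (rule that[of Z])
    show "0 < Z" by (rule Zp)
    fix \<xi> :: "real^'n" assume \<xi>: "\<xi> \<noteq> 0"
    show 1: "(\<integral>\<^sup>+c. ennreal (wgt q r c \<xi>) \<partial>lborel) = ennreal Z" using eq[OF \<xi>] Z by simp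
    show int: "integrable lborel (\<lambda>c. wgt q r c \<xi>)"
      using 1 by (intro integrableI_nonneg) (auto simp: wgt_nonneg)
    show "(\<integral>c. wgt q r c \<xi> \<partial>lborel) = Z"
      using nn_integral_eq_integral[OF int] 1 Z(1) by (simp add: wgt_nonneg integral_nonneg)
  qed
qed

section \<open>Test functions and the decay of their transforms\<close>

lemma test_fun_cont: "test_fun \<phi> \<Longrightarrow> continuous_on UNIV (pderivs is \<phi>)"
  unfolding test_fun_def smooth_on_def Ck_on_def by blast

lemma test_fun_support:
  assumes \<phi>: "test_fun \<phi>" and R: "\<And>x. R < norm x \<Longrightarrow> \<phi> x = 0"
  shows "x \<notin> cball 0 R \<Longrightarrow> pderivs is \<phi> x = 0"
proof (induction "is" arbitrary: x)
  case Nil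
  then show ?case using R by simp
next
  case (Cons i "is")
  have "Ck_on (Suc (length is)) UNIV \<phi>" using \<phi> by (simp add: test_fun_def smooth_on_def)
  then have "has_partial i (pderivs is \<phi>) x" by (simp add: Ck_on_def)
  from has_pd_unique[OF has_pd_partial_deriv[OF this] has_pd_zero[OF closed_cball Cons.prems Cons.IH]]
  show ?case by simp
qed

lemma test_fun_pd_bd:
  assumes \<phi>: "test_fun \<phi>" and R: "\<And>x. R < norm x \<Longrightarrow> \<phi> x = 0"
  shows "\<exists>K. pd_bd i k K UNIV (pderivs is \<phi>)"
proof (induction k arbitrary: "is")
  have b: "\<exists>K. \<forall>x. norm (pderivs is \<phi> x) \<le> K" for "is"
  proof -
    have "compact (pderivs is \<phi> ` cball 0 R)"
      using test_fun_cont[OF \<phi>] by (intro compact_continuous_image) (auto intro: continuous_on_subset)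
    then obtain B where B: "\<And>x. x \<in> cball 0 R \<Longrightarrow> norm (pderivs is \<phi> x) \<le> B"
      by (meson bounded_iff compact_imp_bounded imageI)
    have "pderivs is \<phi> x = 0" if "x \<notin> cball 0 R" for x by (rule test_fun_support[OF \<phi> R that])
    then have "norm (pderivs is \<phi> x) \<le> max B 0" for x
      using B[of x] by (cases "x \<in> cball 0 R") (auto simp: le_max_iff_disj)
    then show ?thesis by blast
  qed
  {
    case 0
    then show ?case using b test_fun_cont[OF \<phi>] by simp
  next
    case (Suc k)
    obtain K1 where K1: "\<forall>x. norm (pderivs is \<phi> x) \<le> K1" using b by blast
    obtain K2 where K2: "pd_bd i k K2 UNIV (pderivs (i # is) \<phi>)" using Suc.IH by blast
    have "Ck_on (Suc (length is)) UNIV \<phi>" using \<phi> by (simp add: test_fun_def smooth_on_def)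
    then have "has_partial i (pderivs is \<phi>) x" for x by (simp add: Ck_on_def)
    then have "has_pd i (pderivs is \<phi>) x (pderivs (i # is) \<phi> x)" for x
      by (simp add: has_pd_partial_deriv)
    then have "pd_bd i (Suc k) (max K1 K2) UNIV (pderivs is \<phi>)"
      using K1 test_fun_cont[OF \<phi>] pd_bd_mono[OF K2, of "max K1 K2" UNIV]
      by (intro pd_bd_SucI[of _ _ _ _ "pderivs (i # is) \<phi>"]) (auto simp: le_max_iff_disj)
    then show ?case by blast
  }
qed

lemma test_fun_bounded_support:
  assumes "test_fun \<phi>"
  obtains R where "0 < R" "\<And>x. R < norm x \<Longrightarrow> \<phi> x = 0"
proof -
  have "bounded {x. \<phi> x \<noteq> 0}" using assms by (simp add: test_fun_def)
  then obtain R where "0 < R" "\<forall>x\<in>{x. \<phi> x \<noteq> 0}. norm x \<le> R" using bounded_pos by blast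
  then show ?thesis using that[of R] by force
qed

lemma test_fun_integrable:
  assumes "test_fun \<phi>"
  shows "integrable lborel \<phi>"
proof -
  obtain R where R: "0 < R" "\<And>x. R < norm x \<Longrightarrow> \<phi> x = 0" using test_fun_bounded_support[OF assms] by blast
  then show ?thesis using test_fun_cont[OF assms, of "[]"]
    by (intro integrable_compact_support[of \<phi> "cball 0 R"]) auto
qed

text \<open>Non-stationary phase for a linear phase: in the direction of a largest component of the
  frequency the reciprocal derivative is a constant of modulus at most n. The first estimate, by the
  integral of the modulus, serves near the origin.\<close>

lemma test_fun_transform_decay:
  fixes \<phi> :: "real^'n::finite \<Rightarrow> complex"
  assumes \<phi>: "test_fun \<phi>"
  obtains C where "0 \<le> C" "\<And>\<xi>. norm (\<integral>x. cis (x \<bullet> \<xi>) * \<phi> x \<partial>lborel) \<le> C"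
    "\<And>\<xi>. \<xi> \<noteq> 0 \<Longrightarrow> norm (\<integral>x. cis (x \<bullet> \<xi>) * \<phi> x \<partial>lborel) \<le> C * norm \<xi> powr (- real M)"
proof -
  obtain R where R: "0 < R" "\<And>x. R < norm x \<Longrightarrow> \<phi> x = 0" using test_fun_bounded_support[OF \<phi>] by blast
  have "\<exists>K. pd_bd i M K UNIV (pderivs [] \<phi>)" for i by (rule test_fun_pd_bd[OF \<phi> R(2)])
  then have "\<forall>i. \<exists>K. pd_bd i M K UNIV \<phi>" by simp
  then obtain K where K: "\<And>i. pd_bd i M (K i) UNIV \<phi>" by metis
  define K' where "K' = (\<Sum>i\<in>UNIV. \<bar>K i\<bar>)"
  have K': "pd_bd i M K' UNIV \<phi>" for i
  proof (rule pd_bd_mono[OF K])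
    have "K i \<le> \<bar>K i\<bar>" by simp
    also have "\<dots> \<le> K'" unfolding K'_def by (intro member_le_sum) auto
    finally show "K i \<le> K'" .
  qed auto
  have K'0: "0 \<le> K'" unfolding K'_def by (intro sum_nonneg) auto
  define V where "V = measure lborel (cball (0::real^'n) R)"
  define n where "n = real CARD('n)"
  have n: "1 \<le> n" by (simp add: n_def Suc_leI)
  define C1 where "C1 = (\<integral>x. norm (\<phi> x) \<partial>lborel)"
  define C2 where "C2 = V * K' * ns_const n M"
  have C1: "0 \<le> C1" by (simp add: C1_def)
  have C2: "0 \<le> C2" using K'0 n by (auto simp: C2_def V_def ns_const_nonneg)
  show ?thesis
  proof (rule that[of "C1 + C2"])
    show "0 \<le> C1 + C2" using C1 C2 by simp
    fix \<xi> :: "real^'n"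
    have "norm (\<integral>x. cis (x \<bullet> \<xi>) * \<phi> x \<partial>lborel) \<le> (\<integral>x. norm (cis (x \<bullet> \<xi>) * \<phi> x) \<partial>lborel)"
      by (rule integral_norm_bound)
    also have "\<dots> = C1" by (simp add: C1_def norm_mult)
    finally show "norm (\<integral>x. cis (x \<bullet> \<xi>) * \<phi> x \<partial>lborel) \<le> C1 + C2" using C2 by simp
    assume \<xi>: "\<xi> \<noteq> 0"
    obtain i where i: "norm \<xi> \<le> n * \<bar>\<xi> $ i\<bar>" using exists_large_component n_def by blast
    then have \<xi>i: "\<xi> $ i \<noteq> 0" using \<xi> by auto
    define g where "g x = (\<xi> /\<^sub>R norm \<xi>) \<bullet> x" for x
    have "norm (\<integral>x. cis (norm \<xi> * g x) * \<phi> x \<partial>lborel) \<le> V * K' * ns_const n M / norm \<xi> ^ M"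
    proof (rule nonstationary_phase[where U=UNIV and S="cball 0 R" and i=i and g'="\<lambda>x. \<xi> $ i / norm \<xi>"
          and v="\<lambda>x. norm \<xi> / \<xi> $ i"])
      show "continuous_on UNIV g" unfolding g_def by (intro continuous_intros)
      show "has_pd i g x (\<xi> $ i / norm \<xi>)" for x
        using has_pd_inner_left[of i "\<xi> /\<^sub>R norm \<xi>" x] by (simp add: g_def[abs_def] divide_inverse mult.commute)
      show "pd_bd i M n UNIV (\<lambda>x. norm \<xi> / \<xi> $ i)"
        using i \<xi>i by (intro pd_bd_const) (simp add: abs_divide pos_divide_le_eq)
      show "\<phi> x = 0" if "x \<notin> cball 0 R" for x using that R(2) by simp
    qed (use \<xi> \<xi>i n K' in \<open>auto simp: V_def\<close>)
    moreover have "norm \<xi> * g x = x \<bullet> \<xi>" for x using \<xi> by (simp add: g_def inner_commute)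
    ultimately have "norm (\<integral>x. cis (x \<bullet> \<xi>) * \<phi> x \<partial>lborel) \<le> C2 / norm \<xi> ^ M" by (simp add: C2_def)
    also have "\<dots> \<le> (C1 + C2) / norm \<xi> ^ M" using C1 by (intro divide_right_mono) auto
    finally show "norm (\<integral>x. cis (x \<bullet> \<xi>) * \<phi> x \<partial>lborel) \<le> (C1 + C2) * norm \<xi> powr (- real M)"
      using \<xi> by (simp add: powr_minus_divide powr_realpow)
  qed
qed

section \<open>Measurability and exchange of integrals\<close>

lemma measurable_off_origin:
  fixes f :: "real^'n::finite \<Rightarrow> 'b::real_normed_vector"
  assumes "continuous_on (UNIV - {0}) f"
  shows "f \<in> borel_measurable borel"
proof -
  have "(\<lambda>x. if x \<in> UNIV - {0} then f x else f 0) \<in> borel_measurable borel"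
    using assms by (intro borel_measurable_continuous_on_if) auto
  moreover have "(\<lambda>x. if x \<in> UNIV - {0} then f x else f 0) = f" by auto
  ultimately show ?thesis by simp
qed

lemma cis_measurable [measurable]: "cis \<in> borel_measurable borel"
  by (intro borel_measurable_continuous_onI continuous_intros)

lemma piece_measurable:
  fixes a :: "real^'n::finite \<Rightarrow> real"
  assumes [measurable]: "a \<in> borel_measurable borel" "\<psi> \<in> borel_measurable borel"
  shows "(\<lambda>(x, c). piece q r a \<psi> t x c) \<in> borel_measurable (lborel \<Otimes>\<^sub>M lborel)"
proof -
  have "(\<lambda>(p, \<xi>). cis (t * a \<xi> + fst p \<bullet> \<xi>) * (wgt q r (snd p) \<xi> *\<^sub>R \<psi> \<xi>))
      \<in> borel_measurable ((lborel \<Otimes>\<^sub>M lborel) \<Otimes>\<^sub>M (lborel :: (real^'n) measure))"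
    unfolding wgt_def by measurable
  from lborel.borel_measurable_lebesgue_integral[OF this]
  show ?thesis unfolding piece_def by (simp add: case_prod_beta)
qed

text \<open>\<open>\<psi>\<close> may be singular at 0, but for r < 1 the support of the weight lies
  in a compact set, which avoids the origin if c is nonzero; for c = 0 the weight vanishes.\<close>

lemma wgt_psi_finite:
  fixes \<psi> :: "real^'n::finite \<Rightarrow> complex"
  assumes \<psi>: "continuous_on (UNIV - {0}) \<psi>" and r: "0 < r" "r < 1" and q: "0 < q"
  shows "(\<integral>\<^sup>+\<xi>. ennreal (norm (wgt q r c \<xi> *\<^sub>R \<psi> \<xi>)) \<partial>lborel) < \<infinity>"
proof (cases "c = 0")
  case True
  have "wgt q r c \<xi> = 0" for \<xi>
    using r q True mult_right_mono[of r 1 "norm \<xi>"] by (intro wgt_eq_0) auto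
  then show ?thesis by simp
next
  case False
  define S where "S = {\<xi>. norm (\<xi> - c) \<le> r * norm \<xi>}"
  have "closed S" unfolding S_def by (intro closed_Collect_le continuous_intros)
  moreover have "bounded S"
  proof (rule boundedI)
    fix \<xi> assume "\<xi> \<in> S"
    then have "norm \<xi> \<le> norm c + r * norm \<xi>" using norm_triangle_sub[of \<xi> c] by (simp add: S_def)
    then show "norm \<xi> \<le> norm c / (1 - r)" using r by (simp add: field_simps)
  qed
  ultimately have S: "compact S" by (simp add: compact_eq_bounded_closed)
  have S0: "S \<subseteq> UNIV - {0}" using False by (auto simp: S_def)
  have "continuous_on S (\<lambda>\<xi>. wgt q r c \<xi> *\<^sub>R \<psi> \<xi>)"
    unfolding wgt_def using S0 by (intro continuous_intros continuous_on_subset[OF \<psi>]) auto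
  then have "integrable lborel (\<lambda>\<xi>. indicator S \<xi> *\<^sub>R (wgt q r c \<xi> *\<^sub>R \<psi> \<xi>))"
    by (rule borel_integrable_compact[OF S])
  moreover have "(\<lambda>\<xi>. indicator S \<xi> *\<^sub>R (wgt q r c \<xi> *\<^sub>R \<psi> \<xi>)) = (\<lambda>\<xi>. wgt q r c \<xi> *\<^sub>R \<psi> \<xi>)"
  proof
    fix \<xi>
    show "indicator S \<xi> *\<^sub>R (wgt q r c \<xi> *\<^sub>R \<psi> \<xi>) = wgt q r c \<xi> *\<^sub>R \<psi> \<xi>"
      using wgt_eq_0[of q r \<xi> c] q r by (cases "\<xi> \<in> S") (auto simp: S_def)
  qed
  ultimately have "integrable lborel (\<lambda>\<xi>. wgt q r c \<xi> *\<^sub>R \<psi> \<xi>)" by (simp only:)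
  then show ?thesis unfolding integrable_iff_bounded by blast
qed

text \<open>The weights \<open>wgt q r c\<close>, integrated over \<open>c\<close>, form a continuous partition of unity, so
  that the absolutely convergent superposition of the pieces represents the distribution.\<close>
lemma superposition_identity:
  fixes a :: "real^'n::finite \<Rightarrow> real" and \<psi> \<phi> :: "real^'n \<Rightarrow> complex"
  assumes a[measurable]: "a \<in> borel_measurable borel" and \<psi>: "continuous_on (UNIV - {0}) \<psi>"
    and r: "0 < r" "r < 1" and q: "0 < q"
    and Z: "\<And>\<xi>::real^'n. \<xi> \<noteq> 0 \<Longrightarrow> (\<integral>\<^sup>+c. ennreal (wgt q r c \<xi>) \<partial>lborel) = ennreal Z"
      "\<And>\<xi>::real^'n. \<xi> \<noteq> 0 \<Longrightarrow> (\<integral>c. wgt q r c \<xi> \<partial>lborel) = Z"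
    and bnd: "\<And>R. \<exists>D. \<forall>x. norm x \<le> R \<longrightarrow> (\<integral>\<^sup>+c. ennreal (norm (piece q r a \<psi> t x c)) \<partial>lborel) \<le> ennreal D"
    and \<phi>: "test_fun \<phi>"
    and fin: "(\<integral>\<^sup>+\<xi>. ennreal (norm (\<psi> \<xi>) * norm (\<integral>x. cis (x \<bullet> \<xi>) * \<phi> x \<partial>lborel)) \<partial>lborel) < \<infinity>"
  shows "(\<integral>x. (\<integral>c. piece q r a \<psi> t x c \<partial>lborel) * \<phi> x \<partial>lborel) =
     Z *\<^sub>R (\<integral>\<xi>. cis (t * a \<xi>) * \<psi> \<xi> * (\<integral>x. cis (x \<bullet> \<xi>) * \<phi> x \<partial>lborel) \<partial>lborel)"
proof -
  have [measurable]: "\<psi> \<in> borel_measurable borel" by (rule measurable_off_origin[OF \<psi>])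
  have [measurable]: "\<phi> \<in> borel_measurable borel"
    using test_fun_cont[OF \<phi>, of "[]"] by (intro borel_measurable_continuous_onI) simp
  have [measurable]: "(\<lambda>(x, c). piece q r a \<psi> t x c) \<in> borel_measurable (lborel \<Otimes>\<^sub>M lborel)"
    by (rule piece_measurable) measurable
  define \<phi>h where "\<phi>h \<xi> = (\<integral>x. cis (x \<bullet> \<xi>) * \<phi> x \<partial>lborel)" for \<xi>
  have [measurable]: "\<phi>h \<in> borel_measurable borel"
  proof -
    have "(\<lambda>(\<xi>, x). cis (x \<bullet> \<xi>) * \<phi> x) \<in> borel_measurable (borel \<Otimes>\<^sub>M (lborel :: (real^'n) measure))"
      by measurable
    from lborel.borel_measurable_lebesgue_integral[OF this] show ?thesis unfolding \<phi>h_def .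
  qed
  have \<phi>1: "(\<integral>\<^sup>+x. ennreal (norm (\<phi> x)) \<partial>lborel) < \<infinity>"
    using test_fun_integrable[OF \<phi>] by (simp add: integrable_iff_bounded)
  \<comment> \<open>Absolute convergence in (x, c): the bound on the superposed pieces is uniform on
    the bounded support of \<open>\<phi>\<close>.\<close>
  have fin1: "(\<integral>\<^sup>+x. \<integral>\<^sup>+c. ennreal (norm (piece q r a \<psi> t x c * \<phi> x)) \<partial>lborel \<partial>lborel) < \<infinity>"
  proof -
    obtain R where R: "0 < R" "\<And>x. R < norm x \<Longrightarrow> \<phi> x = 0" using test_fun_bounded_support[OF \<phi>] by blast
    obtain D where D: "\<And>x. norm x \<le> R \<Longrightarrow> (\<integral>\<^sup>+c. ennreal (norm (piece q r a \<psi> t x c)) \<partial>lborel) \<le> ennreal D"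
      using bnd[of R] by blast
    have "(\<integral>\<^sup>+x. \<integral>\<^sup>+c. ennreal (norm (piece q r a \<psi> t x c * \<phi> x)) \<partial>lborel \<partial>lborel)
        \<le> (\<integral>\<^sup>+x. ennreal D * ennreal (norm (\<phi> x)) \<partial>lborel)"
    proof (rule nn_integral_mono)
      fix x :: "real^'n"
      have "(\<lambda>c. piece q r a \<psi> t x c) \<in> borel_measurable lborel" by measurable
      then have "(\<integral>\<^sup>+c. ennreal (norm (piece q r a \<psi> t x c * \<phi> x)) \<partial>lborel)
          = (\<integral>\<^sup>+c. ennreal (norm (piece q r a \<psi> t x c)) \<partial>lborel) * ennreal (norm (\<phi> x))"
        by (simp add: norm_mult ennreal_mult nn_integral_multc)
      also have "\<dots> \<le> ennreal D * ennreal (norm (\<phi> x))"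
        using D[of x] R(2)[of x] by (cases "norm x \<le> R") (auto intro: mult_right_mono)
      finally show "(\<integral>\<^sup>+c. ennreal (norm (piece q r a \<psi> t x c * \<phi> x)) \<partial>lborel) \<le> ennreal D * ennreal (norm (\<phi> x))" .
    qed
    also have "\<dots> = ennreal D * (\<integral>\<^sup>+x. ennreal (norm (\<phi> x)) \<partial>lborel)" by (intro nn_integral_cmult) measurable
    also have "\<dots> < \<infinity>" using \<phi>1 by (simp add: ennreal_mult_less_top)
    finally show ?thesis .
  qed
  have "(\<integral>x. (\<integral>c. piece q r a \<psi> t x c \<partial>lborel) * \<phi> x \<partial>lborel) = (\<integral>x. \<integral>c. piece q r a \<psi> t x c * \<phi> x \<partial>lborel \<partial>lborel)"
    by simp
  also have "\<dots> = (\<integral>c. \<integral>x. piece q r a \<psi> t x c * \<phi> x \<partial>lborel \<partial>lborel)"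
    by (rule lborel_Fubini(1)[OF _ fin1, symmetric]) measurable
  also have "\<dots> = (\<integral>c. \<integral>\<xi>. wgt q r c \<xi> *\<^sub>R (cis (t * a \<xi>) * \<psi> \<xi> * \<phi>h \<xi>) \<partial>lborel \<partial>lborel)"
  proof (rule Bochner_Integration.integral_cong[OF refl])
    fix c :: "real^'n"
    define f where "f x \<xi> = cis (t * a \<xi> + x \<bullet> \<xi>) * (wgt q r c \<xi> *\<^sub>R \<psi> \<xi>) * \<phi> x" for x \<xi>
    \<comment> \<open>For fixed \<open>c\<close> the double integral of the modulus factorises into
      two finite integrals.\<close>
    have fin2: "(\<integral>\<^sup>+x. \<integral>\<^sup>+\<xi>. ennreal (norm (f x \<xi>)) \<partial>lborel \<partial>lborel) < \<infinity>"
    proof -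
      have "(\<integral>\<^sup>+\<xi>. ennreal (norm (f x \<xi>)) \<partial>lborel)
          = (\<integral>\<^sup>+\<xi>. ennreal (norm (wgt q r c \<xi> *\<^sub>R \<psi> \<xi>)) \<partial>lborel) * ennreal (norm (\<phi> x))" for x
        unfolding f_def norm_mult norm_cis mult_1
        by (subst ennreal_mult) (auto intro!: nn_integral_multc)
      then have "(\<integral>\<^sup>+x. \<integral>\<^sup>+\<xi>. ennreal (norm (f x \<xi>)) \<partial>lborel \<partial>lborel)
          = (\<integral>\<^sup>+\<xi>. ennreal (norm (wgt q r c \<xi> *\<^sub>R \<psi> \<xi>)) \<partial>lborel) * (\<integral>\<^sup>+x. ennreal (norm (\<phi> x)) \<partial>lborel)"
        by (simp only:) (intro nn_integral_cmult, measurable)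
      then show ?thesis using \<phi>1 wgt_psi_finite[OF \<psi> r q, of c] by (simp only: infinity_ennreal_def ennreal_mult_less_top) simp
    qed
    have "(\<lambda>(x, \<xi>). f x \<xi>) \<in> borel_measurable (lborel \<Otimes>\<^sub>M lborel)"
      unfolding f_def by measurable
    note fub = lborel_Fubini(1)[OF this fin2]
    have "(\<integral>x. piece q r a \<psi> t x c * \<phi> x \<partial>lborel) = (\<integral>x. \<integral>\<xi>. f x \<xi> \<partial>lborel \<partial>lborel)"
      unfolding f_def piece_def by (simp only: integral_mult_left_zero)
    also have "\<dots> = (\<integral>\<xi>. \<integral>x. f x \<xi> \<partial>lborel \<partial>lborel)" by (rule fub[symmetric])
    also have "\<dots> = (\<integral>\<xi>. wgt q r c \<xi> *\<^sub>R (cis (t * a \<xi>) * \<psi> \<xi> * \<phi>h \<xi>) \<partial>lborel)"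
    proof (rule Bochner_Integration.integral_cong[OF refl])
      fix \<xi> :: "real^'n"
      have "f x \<xi> = (wgt q r c \<xi> *\<^sub>R (cis (t * a \<xi>) * \<psi> \<xi>)) * (cis (x \<bullet> \<xi>) * \<phi> x)" for x
        by (simp add: f_def cis_mult[symmetric] mult_ac)
      then have "(\<integral>x. f x \<xi> \<partial>lborel) = (wgt q r c \<xi> *\<^sub>R (cis (t * a \<xi>) * \<psi> \<xi>)) * \<phi>h \<xi>"
        unfolding \<phi>h_def by (simp only: integral_mult_right_zero)
      then show "(\<integral>x. f x \<xi> \<partial>lborel) = wgt q r c \<xi> *\<^sub>R (cis (t * a \<xi>) * \<psi> \<xi> * \<phi>h \<xi>)" by simp
    qed
    finally show "(\<integral>x. piece q r a \<psi> t x c * \<phi> x \<partial>lborel)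
        = (\<integral>\<xi>. wgt q r c \<xi> *\<^sub>R (cis (t * a \<xi>) * \<psi> \<xi> * \<phi>h \<xi>) \<partial>lborel)" .
  qed
  \<comment> \<open>The last exchange: integrating the weight over \<open>c\<close> first gives the
    constant \<open>Z\<close> except at the null set xi = 0, and absolute convergence comes from
    \<open>fin\<close>.\<close>
  also have "\<dots> = (\<integral>\<xi>. \<integral>c. wgt q r c \<xi> *\<^sub>R (cis (t * a \<xi>) * \<psi> \<xi> * \<phi>h \<xi>) \<partial>lborel \<partial>lborel)"
  proof (rule lborel_Fubini(1))
    have [measurable]: "(\<lambda>(\<xi>::real^'n, c). wgt q r c \<xi>) \<in> borel_measurable (lborel \<Otimes>\<^sub>M lborel)"
      unfolding wgt_def by measurable
    show "(\<lambda>(\<xi>, c). wgt q r c \<xi> *\<^sub>R (cis (t * a \<xi>) * \<psi> \<xi> * \<phi>h \<xi>)) \<in> borel_measurable (lborel \<Otimes>\<^sub>M lborel)"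
      by measurable
    have "(\<integral>\<^sup>+\<xi>. \<integral>\<^sup>+c. ennreal (norm (wgt q r c \<xi> *\<^sub>R (cis (t * a \<xi>) * \<psi> \<xi> * \<phi>h \<xi>))) \<partial>lborel \<partial>lborel)
        = (\<integral>\<^sup>+\<xi>. ennreal Z * ennreal (norm (\<psi> \<xi>) * norm (\<phi>h \<xi>)) \<partial>lborel)"
    proof (rule nn_integral_cong_AE)
      show "AE \<xi> in lborel. (\<integral>\<^sup>+c. ennreal (norm (wgt q r c \<xi> *\<^sub>R (cis (t * a \<xi>) * \<psi> \<xi> * \<phi>h \<xi>))) \<partial>lborel)
          = ennreal Z * ennreal (norm (\<psi> \<xi>) * norm (\<phi>h \<xi>))"
        using AE_lborel_singleton[of "0::real^'n"]
      proof eventually_elim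
        case (elim \<xi>)
        have "(\<integral>\<^sup>+c. ennreal (norm (wgt q r c \<xi> *\<^sub>R (cis (t * a \<xi>) * \<psi> \<xi> * \<phi>h \<xi>))) \<partial>lborel)
           = (\<integral>\<^sup>+c. ennreal (wgt q r c \<xi>) * ennreal (norm (\<psi> \<xi>) * norm (\<phi>h \<xi>)) \<partial>lborel)"
          by (intro nn_integral_cong) (simp add: norm_mult ennreal_mult[symmetric] wgt_nonneg)
        also have "\<dots> = (\<integral>\<^sup>+c. ennreal (wgt q r c \<xi>) \<partial>lborel) * ennreal (norm (\<psi> \<xi>) * norm (\<phi>h \<xi>))"
          by (intro nn_integral_multc) measurable
        finally show ?case using Z(1)[OF elim] by simp
      qed
    qed
    also have "\<dots> = ennreal Z * (\<integral>\<^sup>+\<xi>. ennreal (norm (\<psi> \<xi>) * norm (\<phi>h \<xi>)) \<partial>lborel)"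
      by (intro nn_integral_cmult) measurable
    also have "\<dots> < \<infinity>" using fin unfolding \<phi>h_def by (simp add: ennreal_mult_less_top)
    finally show "(\<integral>\<^sup>+\<xi>. \<integral>\<^sup>+c. ennreal (norm (wgt q r c \<xi> *\<^sub>R (cis (t * a \<xi>) * \<psi> \<xi> * \<phi>h \<xi>))) \<partial>lborel \<partial>lborel) < \<infinity>" .
  qed
  also have "\<dots> = (\<integral>\<xi>. Z *\<^sub>R (cis (t * a \<xi>) * \<psi> \<xi> * \<phi>h \<xi>) \<partial>lborel)"
  proof (rule integral_cong_AE)
    show "AE \<xi> in lborel. (\<integral>c. wgt q r c \<xi> *\<^sub>R (cis (t * a \<xi>) * \<psi> \<xi> * \<phi>h \<xi>) \<partial>lborel)
        = Z *\<^sub>R (cis (t * a \<xi>) * \<psi> \<xi> * \<phi>h \<xi>)"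
      using AE_lborel_singleton[of "0::real^'n"]
    proof eventually_elim
      case (elim \<xi>)
      have "integrable lborel (\<lambda>c. wgt q r c \<xi>)"
        using Z(1)[OF elim] by (intro integrableI_nonneg) (auto simp: wgt_nonneg)
      then show ?case using Z(2)[OF elim] by (simp only: integral_scaleR_left)
    qed
    have "(\<lambda>(\<xi>::real^'n, c). wgt q r c \<xi> *\<^sub>R (cis (t * a \<xi>) * \<psi> \<xi> * \<phi>h \<xi>)) \<in> borel_measurable (lborel \<Otimes>\<^sub>M lborel)"
      unfolding wgt_def by measurable
    from lborel.borel_measurable_lebesgue_integral[OF this]
    show "(\<lambda>\<xi>. \<integral>c. wgt q r c \<xi> *\<^sub>R (cis (t * a \<xi>) * \<psi> \<xi> * \<phi>h \<xi>) \<partial>lborel) \<in> borel_measurable lborel" .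
  qed measurable
  also have "\<dots> = Z *\<^sub>R (\<integral>\<xi>. cis (t * a \<xi>) * \<psi> \<xi> * \<phi>h \<xi> \<partial>lborel)" by (rule integral_scaleR_right)
  finally show ?thesis unfolding \<phi>h_def .
qed

section \<open>Local boundedness of the rate and convergence of the pairing\<close>

lemma decay_bounded:
  assumes T: "0 < T"
  obtains D where "0 \<le> D" "\<And>X. 0 \<le> X \<Longrightarrow> X \<le> R \<Longrightarrow> decay n m b T X \<le> D"
proof -
  define \<nu> where "\<nu> = (n * (m - 2) - 2 * b) / (2 * (m - 1))"
  show ?thesis
  proof (rule that[of "T powr (- (n + b) / m) * (1 + T powr (- 1 / m) * R) powr \<bar>\<nu>\<bar>"])
    show "0 \<le> T powr (- (n + b) / m) * (1 + T powr (- 1 / m) * R) powr \<bar>\<nu>\<bar>" by simp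
    fix X assume X: "0 \<le> X" "X \<le> R"
    have "(1 + T powr (- 1 / m) * X) powr (- \<nu>) \<le> (1 + T powr (- 1 / m) * X) powr \<bar>\<nu>\<bar>"
      using X by (intro powr_mono) auto
    also have "\<dots> \<le> (1 + T powr (- 1 / m) * R) powr \<bar>\<nu>\<bar>"
      using X by (intro powr_mono2 add_left_mono mult_left_mono) (auto simp: add_nonneg_nonneg)
    finally show "decay n m b T X \<le> T powr (- (n + b) / m) * (1 + T powr (- 1 / m) * R) powr \<bar>\<nu>\<bar>"
      unfolding decay_def \<nu>_def[symmetric] by (intro mult_left_mono) auto
  qed
qed

lemma smooth_on_continuous: "smooth_on U f \<Longrightarrow> continuous_on U f"
  unfolding smooth_on_def Ck_on_def by (metis le0 list.size(3) pderivs.simps(1))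

lemma symb_norm_bound:
  assumes "symb b U f"
  obtains c where "0 \<le> c" "\<And>\<xi>. \<xi> \<in> U \<Longrightarrow> norm (f \<xi>) \<le> c * norm \<xi> powr b"
proof -
  have "symb_k b 0 U f" using assms by (simp add: symb_def)
  then have "\<exists>c. \<forall>\<xi>\<in>U. norm (pderivs [] f \<xi>) \<le> c * norm \<xi> powr (b - real (length ([] :: 'a list)))"
    unfolding symb_k_def by (metis le0 list.size(3))
  then obtain c where c: "\<forall>\<xi>\<in>U. norm (f \<xi>) \<le> c * norm \<xi> powr b" by auto
  have "norm (f \<xi>) \<le> \<bar>c\<bar> * norm \<xi> powr b" if "\<xi> \<in> U" for \<xi>
    using c that by (intro order_trans[OF _ mult_right_mono[OF abs_ge_self[of c]]]) auto
  then show ?thesis using that[of "\<bar>c\<bar>"] by simp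
qed

text \<open>Absolute convergence of the pairing that defines the distribution: near 0 the symbol is
  integrable because b1 > -n, and beyond \<open>\<kappa>\<close> the transform decays faster than
  the symbol can grow.\<close>

lemma symbol_times_transform_finite:
  fixes \<psi> \<phi> :: "real^'n::finite \<Rightarrow> complex"
  assumes \<psi>: "symb b1 U1 \<psi>" "symb b2 U2 \<psi>" and \<phi>: "test_fun \<phi>" and b1: "- real CARD('n) < b1" and \<kappa>: "0 < \<kappa>"
    and U: "\<And>\<xi>. \<xi> \<noteq> 0 \<Longrightarrow> norm \<xi> \<le> \<kappa> \<Longrightarrow> \<xi> \<in> U1" "\<And>\<xi>. \<kappa> \<le> norm \<xi> \<Longrightarrow> \<xi> \<in> U2"
  shows "(\<integral>\<^sup>+\<xi>. ennreal (norm (\<psi> \<xi>) * norm (\<integral>x. cis (x \<bullet> \<xi>) * \<phi> x \<partial>lborel)) \<partial>lborel) < \<infinity>"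
proof -
  obtain M :: nat where M: "real CARD('n) + b2 < real M" using reals_Archimedean2 by blast
  obtain k1 where k1: "0 \<le> k1" "\<And>\<xi>. \<xi> \<in> U1 \<Longrightarrow> norm (\<psi> \<xi>) \<le> k1 * norm \<xi> powr b1"
    using symb_norm_bound[OF \<psi>(1)] by blast
  obtain k2 where k2: "0 \<le> k2" "\<And>\<xi>. \<xi> \<in> U2 \<Longrightarrow> norm (\<psi> \<xi>) \<le> k2 * norm \<xi> powr b2"
    using symb_norm_bound[OF \<psi>(2)] by blast
  obtain C where C: "0 \<le> C" "\<And>\<xi>. norm (\<integral>x. cis (x \<bullet> \<xi>) * \<phi> x \<partial>lborel) \<le> C"
    "\<And>\<xi>. \<xi> \<noteq> 0 \<Longrightarrow> norm (\<integral>x. cis (x \<bullet> \<xi>) * \<phi> x \<partial>lborel) \<le> C * norm \<xi> powr (- real M)"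
    using test_fun_transform_decay[OF \<phi>, of M] by blast
  obtain D1 where D1: "0 \<le> D1" "\<And>R. 0 < R \<Longrightarrow>
    radial_mass b1 ({c. norm c \<le> R} :: (real^'n) set) \<le> ennreal (D1 * R powr (b1 + CARD('n)))"
    using nn_integral_norm_powr_cball[OF b1] by blast
  have "b2 - real M < - real CARD('n)" using M by simp
  then obtain D2 where D2: "0 \<le> D2" "\<And>R. 0 < R \<Longrightarrow>
    radial_mass (b2 - real M) ({c. R \<le> norm c} :: (real^'n) set)
      \<le> ennreal (D2 * R powr (b2 - real M + CARD('n)))"
    using nn_integral_norm_powr_outside by blast
  have "(\<integral>\<^sup>+\<xi>. ennreal (norm (\<psi> \<xi>) * norm (\<integral>x. cis (x \<bullet> \<xi>) * \<phi> x \<partial>lborel)) \<partial>lborel)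
    \<le> ennreal ((k1 * C) * (D1 * \<kappa> powr (b1 + CARD('n))) + (k2 * C) * (D2 * \<kappa> powr (b2 - real M + CARD('n))))"
  proof (rule nn_integral_radial_split[where ?p1.0=b1 and ?p2.0="b2 - real M" and ?S1.0="{c. norm c \<le> \<kappa>}" and ?S2.0="{c. \<kappa> \<le> norm c}"])
    fix \<xi> :: "real^'n" assume \<xi>: "\<xi> \<noteq> 0"
    let ?h = "norm (\<integral>x. cis (x \<bullet> \<xi>) * \<phi> x \<partial>lborel)"
    show "norm (\<psi> \<xi>) * ?h \<le> k1 * C * norm \<xi> powr b1 * indicator {c. norm c \<le> \<kappa>} \<xi>
        + k2 * C * norm \<xi> powr (b2 - real M) * indicator {c. \<kappa> \<le> norm c} \<xi>"
    proof (cases "norm \<xi> \<le> \<kappa>")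
      case True
      have le: "norm (\<psi> \<xi>) * ?h \<le> (k1 * norm \<xi> powr b1) * C"
        using k1(2)[OF U(1)[OF \<xi> True]] C(2)[of \<xi>] k1(1) by (intro mult_mono) auto
      show ?thesis using True k2(1) C(1) by (intro order_trans[OF le]) (simp add: mult_ac)
    next
      case False
      have "norm (\<psi> \<xi>) * ?h \<le> (k2 * norm \<xi> powr b2) * (C * norm \<xi> powr (- real M))"
        using k2(2)[OF U(2), of \<xi>] False C(3)[OF \<xi>] k2(1) by (intro mult_mono) auto
      also have "\<dots> = k2 * C * norm \<xi> powr (b2 - real M)" by (simp add: powr_diff powr_minus_divide)
      finally show ?thesis using False by simp
    qed
  qed (use k1 k2 C D1 D2 \<kappa> in auto)
  also have "\<dots> < \<infinity>" by simp
  finally show ?thesis .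
qed

theorem theorem3p1:
  fixes a :: "real^'n::finite \<Rightarrow> real" and \<psi> :: "real^'n \<Rightarrow> complex"
    and m1 m2 b1 b2 r0 R0 c1' c2' d1 d1' d2 d2' :: real
  defines "n \<equiv> real CARD('n)"
  defines "\<nu>1 \<equiv> (n * (m1 - 2) - 2 * b1) / (2 * (m1 - 1))"
  defines "\<nu>2 \<equiv> (n * (m2 - 2) - 2 * b2) / (2 * (m2 - 1))"
  defines "B1 \<equiv> {\<xi>. \<xi> \<noteq> 0 \<and> norm \<xi> < R0}"
  defines "B2 \<equiv> {\<xi>. norm \<xi> > r0}"
  assumes hm: "1 < m1" "m1 \<le> m2"
    and hb: "- n / 2 \<le> b1" "b1 \<le> b2"
    and ha_smooth: "smooth_on (UNIV - {0}) a"
    and hpsi_smooth: "smooth_on (UNIV - {0}) \<psi>"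
    and hr: "0 < r0" "r0 < R0"
    and ha1: "symb m1 B1 a" and ha2: "symb m2 B2 a"
    and hpsi1: "symb b1 B1 \<psi>" and hpsi2: "symb b2 B2 \<psi>"
    and hc: "c1' > 0" "c2' > 0"
    and hdet1: "\<forall>\<xi>\<in>B1. c1' * norm \<xi> powr (n * (m1 - 2)) \<le> \<bar>det (hessian a \<xi>)\<bar>
                        \<and> \<bar>det (hessian a \<xi>)\<bar> \<le> c2' * norm \<xi> powr (n * (m1 - 2))"
    and hdet2: "\<forall>\<xi>\<in>B2. c1' * norm \<xi> powr (n * (m2 - 2)) \<le> \<bar>det (hessian a \<xi>)\<bar>
                        \<and> \<bar>det (hessian a \<xi>)\<bar> \<le> c2' * norm \<xi> powr (n * (m2 - 2))"
    and hd: "d1 > 0" "d1' > 0" "d2 > 0" "d2' > 0"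
    and hdr: "d1 * r0 powr (m2 - 1) \<le> d2 * R0 powr (m1 - 1)"
    and hgrad1: "\<forall>\<xi>\<in>B1. d2' * norm \<xi> powr (m1 - 1) \<le> norm (grad a \<xi>)
                         \<and> norm (grad a \<xi>) \<le> d2 * norm \<xi> powr (m1 - 1)"
    and hgrad2: "\<forall>\<xi>\<in>B2. d1 * norm \<xi> powr (m2 - 1) \<le> norm (grad a \<xi>)
                         \<and> norm (grad a \<xi>) \<le> d1' * norm \<xi> powr (m2 - 1)"
    and ht0: "t0 > 0" and hN: "N > 0"
  shows "\<exists>C. \<forall>t::real. t \<noteq> 0 \<longrightarrow>
           (\<exists>I :: real^'n \<Rightarrow> complex. I \<in> borel_measurable lborel \<and>
              (\<forall>\<phi>. test_fun \<phi> \<longrightarrow>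
                 (LINT x|lborel. I x * \<phi> x) =
                 (LINT \<xi>|lborel. exp (\<i> * complex_of_real (t * a \<xi>)) * \<psi> \<xi> *
                        (LINT x|lborel. exp (\<i> * complex_of_real (x \<bullet> \<xi>)) * \<phi> x))) \<and>
              (\<forall>x. ((0 < \<bar>t\<bar> \<and> \<bar>t\<bar> < t0) \<or> (\<bar>t\<bar> \<ge> t0 \<and> norm x / \<bar>t\<bar> > N)) \<longrightarrow>
                     norm (I x) \<le> C * \<bar>t\<bar> powr (- (n + b2) / m2)
                                   * (1 + \<bar>t\<bar> powr (- 1 / m2) * norm x) powr (- \<nu>2)) \<and>
              (\<forall>x. (\<bar>t\<bar> \<ge> t0 \<and> norm x / \<bar>t\<bar> \<le> N) \<longrightarrow>
                     norm (I x) \<le> C * \<bar>t\<bar> powr (- (n + b1) / m1)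
                                   * (1 + \<bar>t\<bar> powr (- 1 / m1) * norm x) powr (- \<nu>1)))"
proof -
  let ?n = "real CARD('n)"
  have n: "1 \<le> ?n" by (simp add: Suc_leI)
  have m2: "1 < m2" using hm by simp
  have b: "- ?n / 2 \<le> b1" "- ?n / 2 \<le> b2" using hb by (auto simp: n_def)
  have bn: "- ?n < b1" using b(1) n by linarith
  have conta: "continuous_on (UNIV - {0}) a" and cont\<psi>: "continuous_on (UNIV - {0}) \<psi>"
    using ha_smooth hpsi_smooth by (auto intro: smooth_on_continuous)
  have meas: "a \<in> borel_measurable borel" "\<psi> \<in> borel_measurable borel"
    using conta cont\<psi> by (auto intro: measurable_off_origin)
  obtain k :: nat where k: "\<bar>?n + b1\<bar> + \<bar>?n + b2\<bar> < real k" using reals_Archimedean2 by blast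
  \<comment> \<open>At least n + 1, as the stationary bound requires, and larger than n + b1 and n +
    b2, as the radial integrals at infinity require.\<close>
  define M where "M = k + Suc CARD('n)"
  have M: "Suc CARD('n) \<le> M" "?n + b1 < real M" "?n + b2 < real M" using k by (auto simp: M_def)
  \<comment> \<open>The frequencies are divided in the middle of the overlap of \<open>B1\<close>
    and \<open>B2\<close>, so that every piece has room inside its region.\<close>
  define \<kappa> where "\<kappa> = (r0 + R0) / 2"
  have \<kappa>: "0 < \<kappa>" "r0 < \<kappa>" "\<kappa> < R0" using hr by (auto simp: \<kappa>_def)
  \<comment> \<open>A relative radius: a point within \<open>\<delta>\<close> of c / |c|, multiplied
    by |c|, has norm below R0 when |c| < kappa and above r0 when |c| >= kappa.\<close>
  define \<delta> where "\<delta> = min (1/2) (min ((\<kappa> - r0) / \<kappa>) ((R0 - \<kappa>) / \<kappa>))"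
  have \<delta>0: "0 < \<delta>" "\<delta> \<le> 1/2"
    using \<kappa> unfolding \<delta>_def by (simp, intro min.cobounded1)
  have "\<delta> \<le> (\<kappa> - r0) / \<kappa>" "\<delta> \<le> (R0 - \<kappa>) / \<kappa>" by (simp_all add: \<delta>_def)
  then have "\<kappa> * \<delta> \<le> \<kappa> - r0" "\<kappa> * \<delta> \<le> R0 - \<kappa>"
    using \<kappa> by (simp_all add: pos_le_divide_eq mult.commute)
  note \<delta> = \<delta>0 this
  have ball: "1 - \<delta> < norm \<eta>" "norm \<eta> < 1 + \<delta>" if "c \<noteq> 0" "\<eta> \<in> ball (c /\<^sub>R norm c) \<delta>" for c \<eta> :: "real^'n"
  proof -
    have u: "norm (c /\<^sub>R norm c) = 1" using that by simp
    have "norm (c /\<^sub>R norm c - \<eta>) < \<delta>" using that by (simp add: dist_norm)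
    then show "1 - \<delta> < norm \<eta>" "norm \<eta> < 1 + \<delta>"
      using norm_triangle_sub[of "c /\<^sub>R norm c" \<eta>] norm_triangle_sub[of \<eta> "c /\<^sub>R norm c"] u
      by (auto simp: norm_minus_commute)
  qed
  have reg1: "\<forall>\<eta>\<in>ball (c /\<^sub>R norm c) \<delta>. norm c *\<^sub>R \<eta> \<in> B1" if c: "c \<noteq> 0" "norm c < \<kappa>" for c
  proof
    fix \<eta> assume \<eta>: "\<eta> \<in> ball (c /\<^sub>R norm c) \<delta>"
    have \<eta>0: "\<eta> \<noteq> 0" using ball(1)[OF c(1) \<eta>] \<delta> by auto
    have "norm c * norm \<eta> \<le> \<kappa> * norm \<eta>" using c by (intro mult_right_mono) auto
    also have "\<dots> < \<kappa> * (1 + \<delta>)" using ball(2)[OF c(1) \<eta>] \<kappa> by (intro mult_strict_left_mono)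
    also have "\<dots> \<le> R0" using \<delta>(4) by (simp add: distrib_left)
    finally show "norm c *\<^sub>R \<eta> \<in> B1" using c \<eta>0 by (simp add: B1_def)
  qed
  have reg2: "\<forall>\<eta>\<in>ball (c /\<^sub>R norm c) \<delta>. norm c *\<^sub>R \<eta> \<in> B2" if c: "c \<noteq> 0" "\<kappa> \<le> norm c" for c
  proof
    fix \<eta> assume \<eta>: "\<eta> \<in> ball (c /\<^sub>R norm c) \<delta>"
    have "r0 \<le> \<kappa> * (1 - \<delta>)" using \<delta>(3) by (simp add: right_diff_distrib)
    also have "\<dots> < \<kappa> * norm \<eta>" using ball(1)[OF c(1) \<eta>] \<kappa> by (intro mult_strict_left_mono)
    also have "\<dots> \<le> norm c * norm \<eta>" using c by (intro mult_right_mono) auto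
    finally show "norm c *\<^sub>R \<eta> \<in> B2" by (simp add: B2_def)
  qed
  obtain r1 where r1: "0 < r1" "\<And>r. 0 < r \<Longrightarrow> r \<le> r1 \<Longrightarrow> \<exists>C A a0. 0 \<le> C \<and> 0 < A \<and> 0 < a0 \<and>
     (\<forall>c t x. c \<noteq> 0 \<longrightarrow> (\<forall>\<eta>\<in>ball (c /\<^sub>R norm c) \<delta>. norm c *\<^sub>R \<eta> \<in> B1) \<longrightarrow> t \<noteq> 0 \<longrightarrow>
        piece_bd ?n m1 b1 (real M) C A a0 \<bar>t\<bar> (norm x) (norm c) (norm (piece (Suc M) r a \<psi> t x c)))"
  proof (rule scale_piece_bound[OF meas ha1 hpsi1 hc(1) hd(4) \<delta>(1) _ _ M(1) lessI])
    fix \<xi> assume "\<xi> \<in> B1"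
    then show "c1' * norm \<xi> powr (?n * (m1 - 2)) \<le> \<bar>det (hessian a \<xi>)\<bar>"
      "d2' * norm \<xi> powr (m1 - 1) \<le> norm (grad a \<xi>)" using hdet1 hgrad1 by (auto simp: n_def)
  qed blast
  obtain r2 where r2: "0 < r2" "\<And>r. 0 < r \<Longrightarrow> r \<le> r2 \<Longrightarrow> \<exists>C A a0. 0 \<le> C \<and> 0 < A \<and> 0 < a0 \<and>
     (\<forall>c t x. c \<noteq> 0 \<longrightarrow> (\<forall>\<eta>\<in>ball (c /\<^sub>R norm c) \<delta>. norm c *\<^sub>R \<eta> \<in> B2) \<longrightarrow> t \<noteq> 0 \<longrightarrow>
        piece_bd ?n m2 b2 (real M) C A a0 \<bar>t\<bar> (norm x) (norm c) (norm (piece (Suc M) r a \<psi> t x c)))"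
  proof (rule scale_piece_bound[OF meas ha2 hpsi2 hc(1) hd(1) \<delta>(1) _ _ M(1) lessI])
    fix \<xi> assume "\<xi> \<in> B2"
    then show "c1' * norm \<xi> powr (?n * (m2 - 2)) \<le> \<bar>det (hessian a \<xi>)\<bar>"
      "d1 * norm \<xi> powr (m2 - 1) \<le> norm (grad a \<xi>)" using hdet2 hgrad2 by (auto simp: n_def)
  qed blast
  \<comment> \<open>One \<open>r\<close> for both scales, since the partition must be the same at
    all frequencies; r < 1 keeps the supports away from the origin.\<close>
  define r where "r = min (1/2) (min r1 r2)"
  have r: "0 < r" "r < 1" "r \<le> r1" "r \<le> r2" using r1(1) r2(1) by (auto simp: r_def)
  define pc where "pc = piece (Suc M) r a \<psi>"
  obtain C1 A1 a1 where P1: "0 \<le> C1" "0 < A1" "0 < a1"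
    "\<And>c t x. c \<noteq> 0 \<Longrightarrow> \<forall>\<eta>\<in>ball (c /\<^sub>R norm c) \<delta>. norm c *\<^sub>R \<eta> \<in> B1 \<Longrightarrow> t \<noteq> 0 \<Longrightarrow>
        piece_bd ?n m1 b1 (real M) C1 A1 a1 \<bar>t\<bar> (norm x) (norm c) (norm (pc t x c))"
    using r1(2)[OF r(1,3)] unfolding pc_def by blast
  obtain C2 A2 a2 where P2: "0 \<le> C2" "0 < A2" "0 < a2"
    "\<And>c t x. c \<noteq> 0 \<Longrightarrow> \<forall>\<eta>\<in>ball (c /\<^sub>R norm c) \<delta>. norm c *\<^sub>R \<eta> \<in> B2 \<Longrightarrow> t \<noteq> 0 \<Longrightarrow>
        piece_bd ?n m2 b2 (real M) C2 A2 a2 \<bar>t\<bar> (norm x) (norm c) (norm (pc t x c))"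
    using r2(2)[OF r(1,4)] unfolding pc_def by blast
  obtain Z where Z: "0 < Z" "\<And>\<xi>::real^'n. \<xi> \<noteq> 0 \<Longrightarrow> (\<integral>\<^sup>+c. ennreal (wgt (Suc M) r c \<xi>) \<partial>lborel) = ennreal Z"
    "\<And>\<xi>::real^'n. \<xi> \<noteq> 0 \<Longrightarrow> (\<integral>c. wgt (Suc M) r c \<xi> \<partial>lborel) = Z"
    using wgt_integral[OF r(1), of "Suc M", where ?'n='n] by blast
  obtain C where C: "0 \<le> C" "\<And>T X (Y1::real^'n \<Rightarrow> real) (Y2::real^'n \<Rightarrow> real).
     Y1 \<in> borel_measurable borel \<Longrightarrow> Y2 \<in> borel_measurable borel \<Longrightarrow> 0 < T \<Longrightarrow> 0 \<le> X \<Longrightarrow>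
     (\<And>c. c \<noteq> 0 \<Longrightarrow> norm c < \<kappa> \<Longrightarrow> piece_bd ?n m1 b1 (real M) C1 A1 a1 T X (norm c) (Y1 c)) \<Longrightarrow>
     (\<And>c. \<kappa> \<le> norm c \<Longrightarrow> Y1 c = 0) \<Longrightarrow>
     (\<And>c. \<kappa> \<le> norm c \<Longrightarrow> piece_bd ?n m2 b2 (real M) C2 A2 a2 T X (norm c) (Y2 c)) \<Longrightarrow>
     (\<And>c. norm c < \<kappa> \<Longrightarrow> Y2 c = 0) \<Longrightarrow>
     (T < t0 \<or> N * T < X \<longrightarrow>
        nnint Y1 + nnint Y2 \<le> ennreal (C * decay ?n m2 b2 T X)) \<and>
     (t0 \<le> T \<and> X \<le> N * T \<longrightarrow>
        nnint Y1 + nnint Y2 \<le> ennreal (C * decay ?n m1 b1 T X))"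
    by (rule pieces_integral_two_scale[where ?'n='n, OF hm(1) m2 b M(2,3) P1(1) P2(1) P1(2) P2(2) P1(3) P2(3) \<kappa>(1) hN ht0])
      blast
  have pm: "(\<lambda>(x, c). pc t x c) \<in> borel_measurable (lborel \<Otimes>\<^sub>M lborel)" for t
    unfolding pc_def by (rule piece_measurable[OF meas])
  have pm1[measurable]: "pc t x \<in> borel_measurable borel" for t x
    using measurable_Pair2[OF pm[of t], of x] by simp
  have est: "(\<bar>t\<bar> < t0 \<or> N * \<bar>t\<bar> < norm x \<longrightarrow>
        (\<integral>\<^sup>+c. ennreal (norm (pc t x c)) \<partial>lborel) \<le> ennreal (C * decay ?n m2 b2 \<bar>t\<bar> (norm x))) \<and>
     (t0 \<le> \<bar>t\<bar> \<and> norm x \<le> N * \<bar>t\<bar> \<longrightarrow>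
        (\<integral>\<^sup>+c. ennreal (norm (pc t x c)) \<partial>lborel) \<le> ennreal (C * decay ?n m1 b1 \<bar>t\<bar> (norm x)))"
    if t: "t \<noteq> 0" for t x
  proof -
    \<comment> \<open>The division at kappa is made in the variable \<open>c\<close> of the
      superposition and not in the amplitude, so no cutoff has to be differentiated.\<close>
    define L where "L = {c::real^'n. norm c < \<kappa>}"
    have L[measurable]: "L \<in> sets borel" unfolding L_def by measurable
    have split: "(\<integral>\<^sup>+c. ennreal (norm (pc t x c)) \<partial>lborel) =
        (\<integral>\<^sup>+c. ennreal (if c \<in> L then norm (pc t x c) else 0) \<partial>lborel)
      + (\<integral>\<^sup>+c. ennreal (if c \<in> L then 0 else norm (pc t x c)) \<partial>lborel)"
      by (rule nn_integral_split_set) measurable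
    show ?thesis unfolding split
    proof (rule C(2))
      fix c :: "real^'n" assume "c \<noteq> 0" "norm c < \<kappa>"
      then show "piece_bd ?n m1 b1 (real M) C1 A1 a1 \<bar>t\<bar> (norm x) (norm c) (if c \<in> L then norm (pc t x c) else 0)"
        using P1(4)[OF _ reg1 t] by (simp add: L_def)
    next
      fix c :: "real^'n" assume c: "\<kappa> \<le> norm c"
      then have "c \<noteq> 0" using \<kappa> by auto
      with c show "piece_bd ?n m2 b2 (real M) C2 A2 a2 \<bar>t\<bar> (norm x) (norm c) (if c \<in> L then 0 else norm (pc t x c))"
        using P2(4)[OF _ reg2 t] by (simp add: L_def)
    qed (use t in \<open>auto simp: L_def\<close>)
  qed
  show ?thesis
  proof (intro exI[of _ "C / Z"] allI impI)
    fix t :: real assume t: "t \<noteq> 0"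
    \<comment> \<open>Division by the mass \<open>Z\<close> turns the weights into a partition of
      unity.\<close>
    define I where "I x = (1 / Z) *\<^sub>R (\<integral>c. pc t x c \<partial>lborel)" for x
    have nI: "norm (I x) \<le> C / Z * d" if le: "(\<integral>\<^sup>+c. ennreal (norm (pc t x c)) \<partial>lborel) \<le> ennreal (C * d)" and d: "0 \<le> d" for x d
    proof -
      have "integrable lborel (pc t x)"
        using le by (intro integrableI_bounded) (auto intro: le_less_trans)
      then have "ennreal (norm (\<integral>c. pc t x c \<partial>lborel)) \<le> ennreal (C * d)"
        using integral_norm_bound_ennreal le order_trans by blast
      then have "norm (\<integral>c. pc t x c \<partial>lborel) \<le> C * d" using C(1) d by (simp add: ennreal_le_iff)
      then show ?thesis using Z(1) by (simp add: I_def divide_right_mono)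
    qed
    \<comment> \<open>For fixed t the rates are bounded on bounded sets of x; this is the local
      uniformity used in the exchange of integrals.\<close>
    have bnd: "\<exists>D. \<forall>x. norm x \<le> R \<longrightarrow> (\<integral>\<^sup>+c. ennreal (norm (piece (Suc M) r a \<psi> t x c)) \<partial>lborel) \<le> ennreal D" for R
    proof -
      have T: "0 < \<bar>t\<bar>" using t by simp
      obtain D1 where D1: "0 \<le> D1" "\<And>X. 0 \<le> X \<Longrightarrow> X \<le> R \<Longrightarrow> decay ?n m1 b1 \<bar>t\<bar> X \<le> D1"
        using decay_bounded[OF T] by blast
      obtain D2 where D2: "0 \<le> D2" "\<And>X. 0 \<le> X \<Longrightarrow> X \<le> R \<Longrightarrow> decay ?n m2 b2 \<bar>t\<bar> X \<le> D2"
        using decay_bounded[OF T] by blast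
      have "(\<integral>\<^sup>+c. ennreal (norm (pc t x c)) \<partial>lborel) \<le> ennreal (C * (D1 + D2))" if x: "norm x \<le> R" for x
      proof (cases "\<bar>t\<bar> < t0 \<or> N * \<bar>t\<bar> < norm x")
        case True
        have "C * decay ?n m2 b2 \<bar>t\<bar> (norm x) \<le> C * (D1 + D2)"
          using C(1) D1(1) D2(2)[OF _ x] by (intro mult_left_mono) auto
        with est[OF t, of x] True show ?thesis by (meson ennreal_leI order_trans)
      next
        case False
        have "C * decay ?n m1 b1 \<bar>t\<bar> (norm x) \<le> C * (D1 + D2)"
          using C(1) D2(1) D1(2)[OF _ x] by (intro mult_left_mono) auto
        with est[OF t, of x] False show ?thesis by (meson ennreal_leI order_trans not_less)
      qed
      then show ?thesis unfolding pc_def by blast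
    qed
    have Im: "I \<in> borel_measurable lborel"
      unfolding I_def using lborel.borel_measurable_lebesgue_integral[OF pm[of t]] by measurable
    have ident: "(LINT x|lborel. I x * \<phi> x) =
          (LINT \<xi>|lborel. exp (\<i> * complex_of_real (t * a \<xi>)) * \<psi> \<xi> *
             (LINT x|lborel. exp (\<i> * complex_of_real (x \<bullet> \<xi>)) * \<phi> x))" if \<phi>: "test_fun \<phi>" for \<phi>
    proof -
      have fin: "(\<integral>\<^sup>+\<xi>. ennreal (norm (\<psi> \<xi>) * norm (\<integral>x. cis (x \<bullet> \<xi>) * \<phi> x \<partial>lborel)) \<partial>lborel) < \<infinity>"
        using \<kappa> by (intro symbol_times_transform_finite[OF hpsi1 hpsi2 \<phi> bn \<kappa>(1)]) (auto simp: B1_def B2_def)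
      have "(\<integral>x. I x * \<phi> x \<partial>lborel) = (1 / Z) *\<^sub>R (\<integral>x. (\<integral>c. pc t x c \<partial>lborel) * \<phi> x \<partial>lborel)"
        unfolding I_def by (simp only: mult_scaleR_left integral_scaleR_right)
      also have "\<dots> = (1 / Z) *\<^sub>R (Z *\<^sub>R (\<integral>\<xi>. cis (t * a \<xi>) * \<psi> \<xi> * (\<integral>x. cis (x \<bullet> \<xi>) * \<phi> x \<partial>lborel) \<partial>lborel))"
        unfolding pc_def
        by (rule arg_cong[OF superposition_identity[OF meas(1) cont\<psi> r(1,2) _ Z(2,3) bnd \<phi> fin]]) simp
      finally show ?thesis using Z(1) by (simp add: cis_conv_exp)
    qed
    show "\<exists>I :: real^'n \<Rightarrow> complex. I \<in> borel_measurable lborel \<and>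
              (\<forall>\<phi>. test_fun \<phi> \<longrightarrow>
                 (LINT x|lborel. I x * \<phi> x) =
                 (LINT \<xi>|lborel. exp (\<i> * complex_of_real (t * a \<xi>)) * \<psi> \<xi> *
                        (LINT x|lborel. exp (\<i> * complex_of_real (x \<bullet> \<xi>)) * \<phi> x))) \<and>
              (\<forall>x. ((0 < \<bar>t\<bar> \<and> \<bar>t\<bar> < t0) \<or> (\<bar>t\<bar> \<ge> t0 \<and> norm x / \<bar>t\<bar> > N)) \<longrightarrow>
                     norm (I x) \<le> C / Z * \<bar>t\<bar> powr (- (n + b2) / m2)
                                   * (1 + \<bar>t\<bar> powr (- 1 / m2) * norm x) powr (- \<nu>2)) \<and>
              (\<forall>x. (\<bar>t\<bar> \<ge> t0 \<and> norm x / \<bar>t\<bar> \<le> N) \<longrightarrow>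
                     norm (I x) \<le> C / Z * \<bar>t\<bar> powr (- (n + b1) / m1)
                                   * (1 + \<bar>t\<bar> powr (- 1 / m1) * norm x) powr (- \<nu>1))"
    proof (intro exI[of _ I] conjI allI impI)
      show "I \<in> borel_measurable lborel" by (rule Im)
    next
      fix \<phi> :: "real^'n \<Rightarrow> complex" assume "test_fun \<phi>"
      then show "(LINT x|lborel. I x * \<phi> x) =
                 (LINT \<xi>|lborel. exp (\<i> * complex_of_real (t * a \<xi>)) * \<psi> \<xi> *
                        (LINT x|lborel. exp (\<i> * complex_of_real (x \<bullet> \<xi>)) * \<phi> x))" by (rule ident)
    next
      fix x :: "real^'n" assume "(0 < \<bar>t\<bar> \<and> \<bar>t\<bar> < t0) \<or> (\<bar>t\<bar> \<ge> t0 \<and> norm x / \<bar>t\<bar> > N)"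
      then have "\<bar>t\<bar> < t0 \<or> N * \<bar>t\<bar> < norm x" using t by (auto simp: pos_less_divide_eq)
      then have "norm (I x) \<le> C / Z * decay ?n m2 b2 \<bar>t\<bar> (norm x)"
        using est[OF t, of x] by (intro nI decay_nonneg) blast
      then show "norm (I x) \<le> C / Z * \<bar>t\<bar> powr (- (n + b2) / m2)
                                   * (1 + \<bar>t\<bar> powr (- 1 / m2) * norm x) powr (- \<nu>2)"
        unfolding decay_def \<nu>2_def n_def by (simp only: mult.assoc)
    next
      fix x :: "real^'n" assume "\<bar>t\<bar> \<ge> t0 \<and> norm x / \<bar>t\<bar> \<le> N"
      then have "t0 \<le> \<bar>t\<bar> \<and> norm x \<le> N * \<bar>t\<bar>" using t by (auto simp: pos_divide_le_eq)
      then have "norm (I x) \<le> C / Z * decay ?n m1 b1 \<bar>t\<bar> (norm x)"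
        using est[OF t, of x] by (intro nI decay_nonneg) blast
      then show "norm (I x) \<le> C / Z * \<bar>t\<bar> powr (- (n + b1) / m1)
                                   * (1 + \<bar>t\<bar> powr (- 1 / m1) * norm x) powr (- \<nu>1)"
        unfolding decay_def \<nu>1_def n_def by (simp only: mult.assoc)
    qed
  qed
qed

end
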